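(* Let $K=l_0\,p\,\|b\|_\infty$, let $g\in L^\infty(U)$ satisfy $\|g\|_\infty<\frac1{l_0}\left(\frac1{2^pK}\right)^{\frac1{p-1}}$, choose $0<c_0<1$ and set $\varepsilon_0:=\left(\frac{(1-c_0)^p}{2^pK}\right)^{\frac1{p-1}}$. Let $\{X_j\}_{j\in\mathbb{N}}$ be an independent sequence of random variables $X_j:\Omega\to\mathcal{M}(U)$. Assume that the admissible set $\mathcal{A}_j$ of $X_j$ (defined in the context) equals $\Omega$ for all $j$, and let $u_j(\cdot,\omega)\in L^\infty(U)$ be the corresponding solution with respect to $X_j(\omega)=\mu_{\omega,j}$ and $g$. If $X_j\to X$ a.s. (in $\mathcal{M}(U)$, for some $\mathcal{M}(U)$-valued random variable $X$) and $$L=\sup_{j\in\mathbb{N}}\left(\operatorname*{ess\,sup}_{\omega\in\Omega}|\mu_{\omega,j}|\right)<\frac1{l_0\|f\|_\infty},$$ then $$\sum_{j=1}^k\frac{u_j(x,\omega)-\mathbb{E}_\Omega[u_j(x,\omega)]}{k}\to0$$ and $$\sum_{j=1}^k\frac{\|u_j(\cdot,\omega)\|_\infty-\mathbb{E}_\Omega[\|u_j(\cdot,\omega)\|_\infty]}{k}\to0$$ when $k\to\infty$, where both convergences are in probability (the first as $L^\infty(U)$-valued random variables, the second as real random variables).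
   Context: Let $n\ge3$, $p>1$, and let $U\subset\mathbb{R}^n$ be a bounded domain with diameter $d_U$; put $l_0:=\frac{d_U^2}{2(n-2)}$. $(\Omega,\mathcal{F},\mathbb{P})$ is a complete probability space. $\mathcal{M}(U)$ is the space of (signed) Radon measures on $U$ of finite total variation, with total variation norm denoted $|\mu|$ and its Borel $\sigma$-algebra; $\mathcal{M}(U)$-valued random variables are Borel measurable maps, and convergence in $\mathcal{M}(U)$ is in total variation norm. $f\in BC(\mathbb{R}^n)$ (bounded continuous real functions) and $b\in L^\infty(U)$ are fixed, both nonzero, with $\|f\|_\infty:=\sup_{\mathbb{R}^n}|f|$ and $\|\cdot\|_\infty$ the essential supremum norm on $L^\infty(U)$. For an $\mathcal{M}(U)$-valued random variable $X$ put $\mu_\omega:=X(\omega)$ and $V_\omega(x):=\int_U f(x-y)\,d\mu_\omega(y)$, $x\in U$. The problem considered is $$-\Delta u+V_\omega(x)u=b(x)u|u|^{p-1}+g(x)\ \text{ in }U,\qquad u=0\ \text{ on }\partial U.$$ $G$ is the Green function of $-\Delta$ in $U$ with zero Dirichlet boundary condition, which satisfies $0\le G(x,y)\le\frac{1}{n\alpha_n(n-2)}|x-y|^{2-n}$ ($\alpha_n$ = volume of the unit ball of $\mathbb{R}^n$), and $H(\varphi)(x):=\int_U G(x,y)\varphi(y)\,dy$ for $\varphi\in L^\infty(U)$. An integral solution of the problem is a function $u\in L^\infty(U)$ satisfying $u=H(g)-H(V_\omega u)+H(bu|u|^{p-1})$. Set $\tau_\omega:=l_0\|f\|_\infty|\mu_\omega|$.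 Basic existence result: if $\varepsilon>0$ satisfies $0\le\tau_\omega<1$, $\frac{2^pK\varepsilon^{p-1}}{(1-\tau_\omega)^{p-1}}+\tau_\omega<1$ and $\|g\|_\infty\le\varepsilon/l_0$, then there is a unique integral solution $u_\omega$ with $\|u_\omega\|_\infty\le\frac{2\varepsilon}{1-\tau_\omega}$. The admissible set $\mathcal{A}$ for $X$ is the set of $\omega\in\Omega$ for which the problem has a unique solution $u(\cdot,\omega)$ given by this existence result with $\varepsilon=\varepsilon_0$, i.e. the set of $\omega$ for which its hypotheses hold with $\varepsilon=\varepsilon_0$; $u(\cdot,\omega)$ is then that unique solution. $\mathbb{E}_\Omega[Y]=\int_\Omega Y\,d\mathbb{P}$, understood as a Bochner integral when $Y$ is $L^\infty(U)$-valued. For a Banach space $\mathcal{X}$, $\mathcal{X}$-valued random variables $Y_k$ converge to $Y$ in probability if $\mathbb{P}(\|Y_k-Y\|_{\mathcal{X}}\ge\delta)\to0$ for every $\delta>0$. *)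

theory Defs
  imports "HOL-Probability.Probability"
begin

text \<open>
  Elements of $L^\infty(U)$ are given by representatives; two representatives are identified
  when they agree almost everywhere on \<open>U\<close>.
\<close>

definition Linf :: "'a::euclidean_space set \<Rightarrow> ('a \<Rightarrow> real) set" where
  "Linf U = {\<phi> \<in> borel_measurable (lebesgue_on U).
               esssup (lebesgue_on U) (\<lambda>x. ereal \<bar>\<phi> x\<bar>) < \<infinity>}"

definition Linf_norm :: "'a::euclidean_space set \<Rightarrow> ('a \<Rightarrow> real) \<Rightarrow> real" where
  "Linf_norm U \<phi> = real_of_ereal (esssup (lebesgue_on U) (\<lambda>x. ereal \<bar>\<phi> x\<bar>))"

text \<open>
  The library's Bochner integral is restricted to second countable spaces, which $L^\infty(U)$ is
  not. Hence the usual definition by simple functions that converge almost surely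
  (strong measurability) and in mean.
\<close>

definition has_Linf_bochner_integral ::
  "'w measure \<Rightarrow> 'a::euclidean_space set \<Rightarrow> ('w \<Rightarrow> 'a \<Rightarrow> real) \<Rightarrow> ('a \<Rightarrow> real) \<Rightarrow> bool" where
  "has_Linf_bochner_integral M U Y v \<longleftrightarrow> v \<in> Linf U \<and> (\<forall>\<omega>\<in>space M. Y \<omega> \<in> Linf U) \<and>
     (\<exists>s :: nat \<Rightarrow> 'w \<Rightarrow> 'a \<Rightarrow> real.
        (\<forall>i. simple_function M (s i) \<and> (\<forall>\<omega>\<in>space M. s i \<omega> \<in> Linf U)) \<and>
        (AE \<omega> in M. (\<lambda>i. Linf_norm U (\<lambda>x. Y \<omega> x - s i \<omega> x)) \<longlonglongrightarrow> 0) \<and>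
        (\<lambda>i. \<integral>\<^sup>+\<omega>. ennreal (Linf_norm U (\<lambda>x. Y \<omega> x - s i \<omega> x)) \<partial>M) \<longlonglongrightarrow> 0 \<and>
        (\<lambda>i. Linf_norm U (\<lambda>x. (\<Sum>\<phi>\<in>s i ` space M. measure M (s i -` {\<phi>} \<inter> space M) * \<phi> x) - v x))
          \<longlonglongrightarrow> 0)"

definition Linf_expectation ::
  "'w measure \<Rightarrow> 'a::euclidean_space set \<Rightarrow> ('w \<Rightarrow> 'a \<Rightarrow> real) \<Rightarrow> 'a \<Rightarrow> real" where
  "Linf_expectation M U Y = (SOME v. has_Linf_bochner_integral M U Y v)"

text \<open>
  Since \<^const>\<open>measure\<close> is \<open>0\<close> on non-measurable sets, measurability of the events in question is
  part of the definitions.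
\<close>

definition tendsto_in_prob ::
  "'w measure \<Rightarrow> (nat \<Rightarrow> 'w \<Rightarrow> real) \<Rightarrow> ('w \<Rightarrow> real) \<Rightarrow> bool" where
  "tendsto_in_prob M Y Z \<longleftrightarrow> (\<forall>\<delta>>0.
     (\<forall>k. {\<omega> \<in> space M. \<bar>Y k \<omega> - Z \<omega>\<bar> \<ge> \<delta>} \<in> sets M) \<and>
     (\<lambda>k. measure M {\<omega> \<in> space M. \<bar>Y k \<omega> - Z \<omega>\<bar> \<ge> \<delta>}) \<longlonglongrightarrow> 0)"

definition Linf_tendsto_in_prob ::
  "'w measure \<Rightarrow> 'a::euclidean_space set \<Rightarrow> (nat \<Rightarrow> 'w \<Rightarrow> 'a \<Rightarrow> real) \<Rightarrow> ('w \<Rightarrow> 'a \<Rightarrow> real) \<Rightarrow> bool" where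
  "Linf_tendsto_in_prob M U Y Z \<longleftrightarrow>
     (\<forall>\<omega>\<in>space M. (\<forall>k. Y k \<omega> \<in> Linf U) \<and> Z \<omega> \<in> Linf U) \<and>
     (\<forall>\<delta>>0.
       (\<forall>k. {\<omega> \<in> space M. Linf_norm U (\<lambda>x. Y k \<omega> x - Z \<omega> x) \<ge> \<delta>} \<in> sets M) \<and>
       (\<lambda>k. measure M {\<omega> \<in> space M. Linf_norm U (\<lambda>x. Y k \<omega> x - Z \<omega> x) \<ge> \<delta>}) \<longlonglongrightarrow> 0)"

definition borel_partitions :: "'a::topological_space set \<Rightarrow> 'a set set set" where
  "borel_partitions A = {P. finite P \<and> partition_on A P \<and> P \<subseteq> sets borel}"

definition total_variation :: "('a::topological_space set \<Rightarrow> real) \<Rightarrow> 'a set \<Rightarrow> real" where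
  "total_variation \<mu> A = (SUP P\<in>borel_partitions A. \<Sum>B\<in>P. \<bar>\<mu> B\<bar>)"

text \<open>
  A signed measure on \<open>U\<close> is a countably additive real set function on the Borel subsets of \<open>U\<close>;
  the convention that it vanishes on all other sets makes equality of signed measures equality
  of functions. The last clause is inner regularity.
\<close>

definition radon_measures :: "'a::topological_space set \<Rightarrow> ('a set \<Rightarrow> real) set" where
  "radon_measures U = {\<mu>.
     (\<forall>A. A \<notin> sets (restrict_space borel U) \<longrightarrow> \<mu> A = 0) \<and>
     (\<forall>A :: nat \<Rightarrow> 'a set. range A \<subseteq> sets (restrict_space borel U) \<and> disjoint_family A \<longrightarrow>
        (\<lambda>i. \<mu> (A i)) sums \<mu> (\<Union>i. A i)) \<and>
     bdd_above ((\<lambda>P. \<Sum>B\<in>P. \<bar>\<mu> B\<bar>) ` borel_partitions U) \<and>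
     (\<forall>A \<in> sets (restrict_space borel U). \<forall>e>0.
        \<exists>C. compact C \<and> C \<subseteq> A \<and> total_variation \<mu> (A - C) < e)}"

abbreviation tv_norm :: "'a::topological_space set \<Rightarrow> ('a set \<Rightarrow> real) \<Rightarrow> real" where
  "tv_norm U \<mu> \<equiv> total_variation \<mu> U"

abbreviation tv_dist ::
  "'a::topological_space set \<Rightarrow> ('a set \<Rightarrow> real) \<Rightarrow> ('a set \<Rightarrow> real) \<Rightarrow> real" where
  "tv_dist U \<mu> \<nu> \<equiv> tv_norm U (\<lambda>A. \<mu> A - \<nu> A)"

definition tv_open :: "'a::topological_space set \<Rightarrow> ('a set \<Rightarrow> real) set \<Rightarrow> bool" where
  "tv_open U \<O> \<longleftrightarrow> \<O> \<subseteq> radon_measures U \<and>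
     (\<forall>\<mu>\<in>\<O>. \<exists>r>0. \<forall>\<nu>\<in>radon_measures U. tv_dist U \<mu> \<nu> < r \<longrightarrow> \<nu> \<in> \<O>)"

definition radon_borel :: "'a::topological_space set \<Rightarrow> ('a set \<Rightarrow> real) measure" where
  "radon_borel U = sigma (radon_measures U) {\<O>. tv_open U \<O>}"

text \<open>Jordan decomposition: the positive and negative parts are $(|\mu|\pm\mu)/2$.\<close>

definition pos_part :: "'a::topological_space set \<Rightarrow> ('a set \<Rightarrow> real) \<Rightarrow> 'a measure" where
  "pos_part U \<mu> = measure_of U (sets (restrict_space borel U))
                    (\<lambda>A. ennreal ((total_variation \<mu> A + \<mu> A) / 2))"

definition neg_part :: "'a::topological_space set \<Rightarrow> ('a set \<Rightarrow> real) \<Rightarrow> 'a measure" where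
  "neg_part U \<mu> = measure_of U (sets (restrict_space borel U))
                    (\<lambda>A. ennreal ((total_variation \<mu> A - \<mu> A) / 2))"

definition signed_integral ::
  "'a::topological_space set \<Rightarrow> ('a set \<Rightarrow> real) \<Rightarrow> ('a \<Rightarrow> real) \<Rightarrow> real" where
  "signed_integral U \<mu> \<phi> = (\<integral>y. \<phi> y \<partial>pos_part U \<mu>) - (\<integral>y. \<phi> y \<partial>neg_part U \<mu>)"

text \<open>\<open>D\<close> is the gradient and \<open>D2\<close> the Hessian, so this says that \<open>h\<close> is $C^2$ with $\Delta h=0$.\<close>

definition harmonic_on :: "('a::euclidean_space \<Rightarrow> real) \<Rightarrow> 'a set \<Rightarrow> bool" where
  "harmonic_on h S \<longleftrightarrow> (\<exists>(D :: 'a \<Rightarrow> 'a) (D2 :: 'a \<Rightarrow> 'a \<Rightarrow> 'a).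
     (\<forall>x\<in>S. (h has_derivative (\<lambda>v. D x \<bullet> v)) (at x)) \<and>
     (\<forall>x\<in>S. (D has_derivative D2 x) (at x)) \<and>
     (\<forall>v. continuous_on S (\<lambda>x. D2 x v)) \<and>
     (\<forall>x\<in>S. (\<Sum>i\<in>Basis. D2 x i \<bullet> i) = 0))"

definition subharmonic_on :: "('a::euclidean_space \<Rightarrow> real) \<Rightarrow> 'a set \<Rightarrow> bool" where
  "subharmonic_on v S \<longleftrightarrow> continuous_on S v \<and>
     (\<forall>a r h. r > 0 \<and> cball a r \<subseteq> S \<and> continuous_on (cball a r) h \<and> harmonic_on h (ball a r) \<and>
        (\<forall>y\<in>sphere a r. v y \<le> h y) \<longrightarrow> (\<forall>y\<in>ball a r. v y \<le> h y))"

text \<open>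
  Perron solution of the Dirichlet problem $\Delta w=0$ in \<open>U\<close>, $w=\varphi$ on the boundary. For a
  general bounded domain, where some boundary points may be irregular, this is the standard
  meaning of the solution; it is the classical solution whenever there is one.
\<close>

definition perron_solution ::
  "'a::euclidean_space set \<Rightarrow> ('a \<Rightarrow> real) \<Rightarrow> 'a \<Rightarrow> real" where
  "perron_solution U \<phi> y = Sup {v y | v. continuous_on (closure U) v \<and> subharmonic_on v U \<and>
                                       (\<forall>z\<in>frontier U. v z \<le> \<phi> z)}"

definition fundamental_solution :: "'a::euclidean_space \<Rightarrow> real" where
  "fundamental_solution z =
     1 / (real DIM('a) * measure lborel (ball (0::'a) 1) * real (DIM('a) - 2))
       * (1 / norm z ^ (DIM('a) - 2))"

definition green :: "'a::euclidean_space set \<Rightarrow> 'a \<Rightarrow> 'a \<Rightarrow> real" where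
  "green U x y = fundamental_solution (x - y)
                   - perron_solution U (\<lambda>z. fundamental_solution (x - z)) y"

definition green_op :: "'a::euclidean_space set \<Rightarrow> ('a \<Rightarrow> real) \<Rightarrow> 'a \<Rightarrow> real" where
  "green_op U \<phi> x = (\<integral>y. green U x y * \<phi> y \<partial>lebesgue_on U)"

definition potential ::
  "'a::euclidean_space set \<Rightarrow> ('a \<Rightarrow>\<^sub>C real) \<Rightarrow> ('a set \<Rightarrow> real) \<Rightarrow> 'a \<Rightarrow> real" where
  "potential U f \<mu> x = signed_integral U \<mu> (\<lambda>y. apply_bcontfun f (x - y))"

definition integral_solution ::
  "'a::euclidean_space set \<Rightarrow> real \<Rightarrow> ('a \<Rightarrow>\<^sub>C real) \<Rightarrow> ('a \<Rightarrow> real) \<Rightarrow> ('a \<Rightarrow> real)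
     \<Rightarrow> ('a set \<Rightarrow> real) \<Rightarrow> ('a \<Rightarrow> real) \<Rightarrow> bool" where
  "integral_solution U p f b g \<mu> u \<longleftrightarrow> u \<in> Linf U \<and>
     (AE x in lebesgue_on U.
        u x = green_op U g x - green_op U (\<lambda>y. potential U f \<mu> y * u y) x
              + green_op U (\<lambda>y. b y * u y * \<bar>u y\<bar> powr (p - 1)) x)"

definition l0 :: "'a::euclidean_space set \<Rightarrow> real" where
  "l0 U = (diameter U)\<^sup>2 / (2 * (real DIM('a) - 2))"

definition tau :: "'a::euclidean_space set \<Rightarrow> ('a \<Rightarrow>\<^sub>C real) \<Rightarrow> ('a set \<Rightarrow> real) \<Rightarrow> real" where
  "tau U f \<mu> = l0 U * norm f * tv_norm U \<mu>"

definition Kconst :: "'a::euclidean_space set \<Rightarrow> real \<Rightarrow> ('a \<Rightarrow> real) \<Rightarrow> real" where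
  "Kconst U p b = l0 U * p * Linf_norm U b"

definition existence_conditions ::
  "'a::euclidean_space set \<Rightarrow> real \<Rightarrow> ('a \<Rightarrow>\<^sub>C real) \<Rightarrow> ('a \<Rightarrow> real) \<Rightarrow> ('a \<Rightarrow> real)
     \<Rightarrow> real \<Rightarrow> ('a set \<Rightarrow> real) \<Rightarrow> bool" where
  "existence_conditions U p f b g \<epsilon> \<mu> \<longleftrightarrow>
     \<epsilon> > 0 \<and> 0 \<le> tau U f \<mu> \<and> tau U f \<mu> < 1 \<and>
     2 powr p * Kconst U p b * \<epsilon> powr (p - 1) / (1 - tau U f \<mu>) powr (p - 1) + tau U f \<mu> < 1 \<and>
     Linf_norm U g \<le> \<epsilon> / l0 U"

definition admissible_set ::
  "'w measure \<Rightarrow> 'a::euclidean_space set \<Rightarrow> real \<Rightarrow> ('a \<Rightarrow>\<^sub>C real) \<Rightarrow> ('a \<Rightarrow> real) \<Rightarrow> ('a \<Rightarrow> real)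
     \<Rightarrow> real \<Rightarrow> ('w \<Rightarrow> 'a set \<Rightarrow> real) \<Rightarrow> 'w set" where
  "admissible_set M U p f b g \<epsilon> X = {\<omega> \<in> space M. existence_conditions U p f b g \<epsilon> (X \<omega>)}"

text \<open>
  Under the existence conditions there is, up to equality almost everywhere, exactly one \<open>u\<close>
  with this property.
\<close>

definition small_solution ::
  "'a::euclidean_space set \<Rightarrow> real \<Rightarrow> ('a \<Rightarrow>\<^sub>C real) \<Rightarrow> ('a \<Rightarrow> real) \<Rightarrow> ('a \<Rightarrow> real)
     \<Rightarrow> real \<Rightarrow> ('a set \<Rightarrow> real) \<Rightarrow> ('a \<Rightarrow> real) \<Rightarrow> bool" where
  "small_solution U p f b g \<epsilon> \<mu> u \<longleftrightarrow>
     integral_solution U p f b g \<mu> u \<and> Linf_norm U u \<le> 2 * \<epsilon> / (1 - tau U f \<mu>)"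

end

theory Submission
  imports Defs
begin

text \<open>
  Only the potentials of the measures matter. On the bounded set \<open>U\<close> they form a uniformly bounded,
  equicontinuous family, and the solution depends on the potential in a Lipschitz way: the choice
  of \<open>\<epsilon>0\<close> turns admissibility into \<open>tau < c0\<close>, so that the integral equation is a contraction
  uniformly in the measure. Hence every \<open>u j\<close> is a uniform limit of simple functions of \<open>\<omega>\<close>, and
  its Bochner integral exists.

  An almost sure limit of uncorrelated bounded variables is almost surely constant. Applied to the
  values of the potentials on a countable dense set, this gives one \<open>\<omega>0\<close> such that
  \<open>u j \<omega> - u j \<omega>0\<close> tends to \<open>0\<close> in the norm of $L^\infty(U)$ for almost all \<open>\<omega>\<close>, and then in mean by
  boundedness. The averages in question are bounded by Cesaro means whose expectations are at most
  twice those of these differences, so they tend to \<open>0\<close> in mean, hence in probability.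

  The contraction estimate needs the bounds $0\le G(x,y)\le\Gamma(x-y)$ for the Green function, where
  $\Gamma$ is the fundamental solution; they follow from a maximum principle for the functions
  competing in the Perron supremum.
\<close>

subsection \<open>The seminorm of $L^\infty$\<close>

abbreviation Linf_dist :: "'a::euclidean_space set \<Rightarrow> ('a \<Rightarrow> real) \<Rightarrow> ('a \<Rightarrow> real) \<Rightarrow> real" where
  "Linf_dist U \<phi> \<psi> \<equiv> Linf_norm U (\<lambda>x. \<phi> x - \<psi> x)"

lemma Linf_measurable: "\<phi> \<in> Linf U \<Longrightarrow> \<phi> \<in> borel_measurable (lebesgue_on U)"
  by (simp add: Linf_def)

lemma Linf_norm_nonneg: "0 \<le> Linf_norm U \<phi>"
proof (cases "(\<lambda>x. ereal \<bar>\<phi> x\<bar>) \<in> borel_measurable (lebesgue_on U)")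
  case measurable: True
  show ?thesis
  proof (cases "emeasure (lebesgue_on U) (space (lebesgue_on U)) = 0")
    case True
    then show ?thesis
      using measurable by (simp add: Linf_norm_def esssup_zero_space)
  next
    case False
    have "esssup (lebesgue_on U) (\<lambda>x. 0) \<le> esssup (lebesgue_on U) (\<lambda>x. ereal \<bar>\<phi> x\<bar>)"
      by (rule esssup_mono) auto
    then show ?thesis
      using esssup_const[OF False, of "0::ereal"] by (simp add: Linf_norm_def real_of_ereal_pos)
  qed
next
  case False
  then show ?thesis
    by (simp add: Linf_norm_def esssup_non_measurable top_ereal_def)
qed

lemma AE_abs_le_Linf_norm:
  assumes "\<phi> \<in> Linf U"
  shows "AE x in lebesgue_on U. \<bar>\<phi> x\<bar> \<le> Linf_norm U \<phi>"
proof -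
  have finite: "esssup (lebesgue_on U) (\<lambda>x. ereal \<bar>\<phi> x\<bar>) < \<infinity>"
    using assms by (simp add: Linf_def)
  show ?thesis
    using esssup_AE[of "\<lambda>x. ereal \<bar>\<phi> x\<bar>" "lebesgue_on U"]
  proof eventually_elim
    case (elim x)
    then show ?case
      using finite unfolding Linf_norm_def
      by (cases "esssup (lebesgue_on U) (\<lambda>x. ereal \<bar>\<phi> x\<bar>)") simp_all
  qed
qed

lemma esssup_abs_le:
  assumes "\<phi> \<in> borel_measurable M" "AE x in M. \<bar>\<phi> x\<bar> \<le> C"
  shows "esssup M (\<lambda>x. ereal \<bar>\<phi> x\<bar>) \<le> ereal C"
  using assms by (intro esssup_I) auto

lemma LinfI:
  assumes "\<phi> \<in> borel_measurable (lebesgue_on U)" "AE x in lebesgue_on U. \<bar>\<phi> x\<bar> \<le> C"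
  shows "\<phi> \<in> Linf U"
  using esssup_abs_le[OF assms] assms(1) by (auto simp: Linf_def)

lemma Linf_norm_le:
  assumes "\<phi> \<in> borel_measurable (lebesgue_on U)" "AE x in lebesgue_on U. \<bar>\<phi> x\<bar> \<le> C" "0 \<le> C"
  shows "Linf_norm U \<phi> \<le> C"
  using esssup_abs_le[OF assms(1,2)] assms(3) unfolding Linf_norm_def
  by (cases "esssup (lebesgue_on U) (\<lambda>x. ereal \<bar>\<phi> x\<bar>)") simp_all

lemma
  assumes "\<phi> \<in> Linf U" "\<psi> \<in> Linf U"
  shows Linf_add: "(\<lambda>x. \<phi> x + \<psi> x) \<in> Linf U"
    and Linf_norm_add_le: "Linf_norm U (\<lambda>x. \<phi> x + \<psi> x) \<le> Linf_norm U \<phi> + Linf_norm U \<psi>"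
proof -
  have measurable: "(\<lambda>x. \<phi> x + \<psi> x) \<in> borel_measurable (lebesgue_on U)"
    by (intro borel_measurable_add Linf_measurable assms)
  have bound: "AE x in lebesgue_on U. \<bar>\<phi> x + \<psi> x\<bar> \<le> Linf_norm U \<phi> + Linf_norm U \<psi>"
    using assms[THEN AE_abs_le_Linf_norm] by eventually_elim auto
  show "(\<lambda>x. \<phi> x + \<psi> x) \<in> Linf U" by (rule LinfI[OF measurable bound])
  show "Linf_norm U (\<lambda>x. \<phi> x + \<psi> x) \<le> Linf_norm U \<phi> + Linf_norm U \<psi>"
    by (rule Linf_norm_le[OF measurable bound]) (simp add: Linf_norm_nonneg)
qed

lemma
  assumes "\<phi> \<in> Linf U" "\<psi> \<in> Linf U"
  shows Linf_mult: "(\<lambda>x. \<phi> x * \<psi> x) \<in> Linf U"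
    and Linf_norm_mult_le: "Linf_norm U (\<lambda>x. \<phi> x * \<psi> x) \<le> Linf_norm U \<phi> * Linf_norm U \<psi>"
proof -
  have measurable: "(\<lambda>x. \<phi> x * \<psi> x) \<in> borel_measurable (lebesgue_on U)"
    by (intro borel_measurable_times Linf_measurable assms)
  have bound: "AE x in lebesgue_on U. \<bar>\<phi> x * \<psi> x\<bar> \<le> Linf_norm U \<phi> * Linf_norm U \<psi>"
    using assms[THEN AE_abs_le_Linf_norm]
    by eventually_elim (auto simp: abs_mult intro: mult_mono Linf_norm_nonneg)
  show "(\<lambda>x. \<phi> x * \<psi> x) \<in> Linf U" by (rule LinfI[OF measurable bound])
  show "Linf_norm U (\<lambda>x. \<phi> x * \<psi> x) \<le> Linf_norm U \<phi> * Linf_norm U \<psi>"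
    by (rule Linf_norm_le[OF measurable bound]) (simp add: Linf_norm_nonneg)
qed

lemma
  assumes "\<phi> \<in> Linf U"
  shows Linf_cmult: "(\<lambda>x. c * \<phi> x) \<in> Linf U"
    and Linf_norm_cmult_le: "Linf_norm U (\<lambda>x. c * \<phi> x) \<le> \<bar>c\<bar> * Linf_norm U \<phi>"
proof -
  have const: "(\<lambda>_. c) \<in> Linf U" by (rule LinfI[where C="\<bar>c\<bar>"]) auto
  then show "(\<lambda>x. c * \<phi> x) \<in> Linf U" using assms by (rule Linf_mult)
  have "Linf_norm U (\<lambda>x. c * \<phi> x) \<le> Linf_norm U (\<lambda>_. c) * Linf_norm U \<phi>"
    using const assms by (rule Linf_norm_mult_le)
  also have "\<dots> \<le> \<bar>c\<bar> * Linf_norm U \<phi>"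
    by (intro mult_right_mono Linf_norm_le Linf_norm_nonneg) auto
  finally show "Linf_norm U (\<lambda>x. c * \<phi> x) \<le> \<bar>c\<bar> * Linf_norm U \<phi>" .
qed

lemma Linf_diff: "\<phi> \<in> Linf U \<Longrightarrow> \<psi> \<in> Linf U \<Longrightarrow> (\<lambda>x. \<phi> x - \<psi> x) \<in> Linf U"
  using Linf_add[of \<phi> U "\<lambda>x. -1 * \<psi> x"] Linf_cmult[of \<psi> U "-1"] by simp

lemma Linf_dist_commute: "Linf_dist U \<phi> \<psi> = Linf_dist U \<psi> \<phi>"
  by (simp add: Linf_norm_def abs_minus_commute)

lemma Linf_dist_triangle:
  assumes "\<phi> \<in> Linf U" "\<psi> \<in> Linf U" "\<eta> \<in> Linf U"
  shows "Linf_dist U \<phi> \<eta> \<le> Linf_dist U \<phi> \<psi> + Linf_dist U \<psi> \<eta>"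
  using Linf_norm_add_le[OF Linf_diff[OF assms(1,2)] Linf_diff[OF assms(2,3)]] by simp

lemma abs_Linf_norm_diff_le:
  assumes "\<phi> \<in> Linf U" "\<psi> \<in> Linf U"
  shows "\<bar>Linf_norm U \<phi> - Linf_norm U \<psi>\<bar> \<le> Linf_dist U \<phi> \<psi>"
  using Linf_norm_add_le[OF Linf_diff[OF assms] assms(2)]
    Linf_norm_add_le[OF Linf_diff[OF assms(2,1)] assms(1)]
  by (simp add: Linf_dist_commute[of U \<psi> \<phi>])

lemma Linf_zero: "(\<lambda>_. 0) \<in> Linf U"
  by (rule LinfI[where C=0]) auto

lemma Linf_norm_zero: "Linf_norm U (\<lambda>_. 0) = 0"
  using Linf_norm_le[of "\<lambda>_. 0" U 0] Linf_norm_nonneg[of U "\<lambda>_. 0"] by simp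

lemma Linf_dist_le_add_norms:
  assumes "\<phi> \<in> Linf U" "\<psi> \<in> Linf U"
  shows "Linf_dist U \<phi> \<psi> \<le> Linf_norm U \<phi> + Linf_norm U \<psi>"
  using Linf_dist_triangle[OF assms(1) Linf_zero assms(2)] Linf_dist_commute[of U "\<lambda>_. 0" \<psi>]
  by simp

lemma Linf_sum:
  "finite J \<Longrightarrow> (\<And>j. j \<in> J \<Longrightarrow> \<phi> j \<in> Linf U) \<Longrightarrow> (\<lambda>x. \<Sum>j\<in>J. \<phi> j x) \<in> Linf U"
  by (induction J rule: finite_induct) (auto intro: Linf_zero Linf_add)

lemma Linf_norm_sum_le:
  "finite J \<Longrightarrow> (\<And>j. j \<in> J \<Longrightarrow> \<phi> j \<in> Linf U) \<Longrightarrow>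
    Linf_norm U (\<lambda>x. \<Sum>j\<in>J. \<phi> j x) \<le> (\<Sum>j\<in>J. Linf_norm U (\<phi> j))"
proof (induction J rule: finite_induct)
  case (insert j J)
  then show ?case
    using Linf_norm_add_le[of "\<phi> j" U "\<lambda>x. \<Sum>j\<in>J. \<phi> j x"] Linf_sum[of J \<phi> U] by fastforce
qed (simp add: Linf_norm_zero)

lemma dist_lim_le_of_Cauchy_rate:
  fixes a :: "nat \<Rightarrow> 'a::complete_space"
  assumes rate: "\<And>i k. dist (a i) (a k) \<le> e i + e k" and e: "e \<longlonglongrightarrow> 0"
  shows "dist (a i) (lim a) \<le> e i"
proof -
  have "Cauchy a"
  proof (rule metric_CauchyI)
    fix r :: real assume "0 < r"
    then obtain n where n: "\<And>i. i \<ge> n \<Longrightarrow> e i < r / 2"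
      using order_tendstoD(2)[OF e, of "r / 2"] by (auto simp: eventually_sequentially)
    have "dist (a i) (a k) < r" if "n \<le> i" "n \<le> k" for i k
      using n[OF that(1)] n[OF that(2)] rate[of i k] by linarith
    then show "\<exists>n. \<forall>i\<ge>n. \<forall>k\<ge>n. dist (a i) (a k) < r" by blast
  qed
  then have "a \<longlonglongrightarrow> lim a"
    by (simp add: Cauchy_convergent_iff convergent_LIMSEQ_iff)
  then have "(\<lambda>k. dist (a i) (a k)) \<longlonglongrightarrow> dist (a i) (lim a)"
    by (intro tendsto_dist tendsto_const)
  moreover have "(\<lambda>k. e i + e k) \<longlonglongrightarrow> e i + 0"
    by (intro tendsto_add tendsto_const e)
  ultimately have "dist (a i) (lim a) \<le> e i + 0"
    using rate by (intro LIMSEQ_le) auto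
  then show ?thesis by simp
qed

lemma Linf_complete:
  fixes \<phi> :: "nat \<Rightarrow> 'a::euclidean_space \<Rightarrow> real"
  assumes \<phi>: "\<And>i. \<phi> i \<in> Linf U" and e: "e \<longlonglongrightarrow> 0"
    and rate: "\<And>i k. Linf_dist U (\<phi> i) (\<phi> k) \<le> e i + e k"
  obtains v where "v \<in> Linf U" "\<And>i. Linf_dist U (\<phi> i) v \<le> e i"
proof -
  define v where "v x = lim (\<lambda>i. \<phi> i x)" for x
  have e_nonneg: "0 \<le> e i" for i
    using rate[of i i] Linf_norm_nonneg[of U "\<lambda>x. \<phi> i x - \<phi> i x"] by simp
  have "v \<in> borel_measurable (lebesgue_on U)"
    unfolding v_def[abs_def] using \<phi> by (intro borel_measurable_lim_metric Linf_measurable)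
  then have measurable: "(\<lambda>x. \<phi> i x - v x) \<in> borel_measurable (lebesgue_on U)" for i
    by (rule borel_measurable_diff[OF Linf_measurable[OF \<phi>]])
  have "AE x in lebesgue_on U. \<bar>\<phi> i x - \<phi> k x\<bar> \<le> e i + e k" for i k
    using AE_abs_le_Linf_norm[OF Linf_diff[OF \<phi>[of i] \<phi>[of k]]]
    by eventually_elim (use rate[of i k] in linarith)
  then have "AE x in lebesgue_on U. \<forall>i k. dist (\<phi> i x) (\<phi> k x) \<le> e i + e k"
    by (simp add: AE_all_countable dist_real_def)
  then have bound: "AE x in lebesgue_on U. \<bar>\<phi> i x - v x\<bar> \<le> e i" for i
  proof eventually_elim
    case (elim x)
    then have "dist (\<phi> i x) (v x) \<le> e i"
      unfolding v_def by (intro dist_lim_le_of_Cauchy_rate e) blast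
    then show ?case by (simp add: dist_real_def)
  qed
  have "(\<lambda>x. \<phi> 0 x - v x) \<in> Linf U"
    by (rule LinfI[OF measurable bound])
  from Linf_diff[OF \<phi>[of 0] this] have "v \<in> Linf U" by simp
  then show ?thesis
    using that Linf_norm_le[OF measurable bound e_nonneg] by blast
qed

subsection \<open>Bochner integrals of uniform limits of simple functions\<close>

definition Linf_simple :: "'w measure \<Rightarrow> 'a::euclidean_space set \<Rightarrow> ('w \<Rightarrow> 'a \<Rightarrow> real) \<Rightarrow> bool" where
  "Linf_simple M U s \<longleftrightarrow> simple_function M s \<and> (\<forall>\<omega>\<in>space M. s \<omega> \<in> Linf U)"

text \<open>
  Uniform approximability by simple functions, i.e. measurability with totally bounded range,
  stands in for strong measurability here.
\<close>

definition Linf_approximable :: "'w measure \<Rightarrow> 'a::euclidean_space set \<Rightarrow> ('w \<Rightarrow> 'a \<Rightarrow> real) \<Rightarrow> bool" where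
  "Linf_approximable M U Y \<longleftrightarrow> (\<forall>\<omega>\<in>space M. Y \<omega> \<in> Linf U) \<and>
     (\<forall>e>0. \<exists>s. Linf_simple M U s \<and> (\<forall>\<omega>\<in>space M. Linf_dist U (Y \<omega>) (s \<omega>) \<le> e))"

lemma Linf_simple_simple_function: "Linf_simple M U s \<Longrightarrow> simple_function M s"
  by (simp add: Linf_simple_def)

lemma Linf_simple_in_Linf: "Linf_simple M U s \<Longrightarrow> \<omega> \<in> space M \<Longrightarrow> s \<omega> \<in> Linf U"
  by (simp add: Linf_simple_def)

lemma Linf_simple_add:
  "Linf_simple M U s \<Longrightarrow> Linf_simple M U t \<Longrightarrow> Linf_simple M U (\<lambda>\<omega> x. s \<omega> x + t \<omega> x)"
  unfolding Linf_simple_def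
  by (auto intro: Linf_add simple_function_compose2[of M s t "\<lambda>\<phi> \<psi> x. \<phi> x + \<psi> x"])

lemma Linf_simple_cmult: "Linf_simple M U s \<Longrightarrow> Linf_simple M U (\<lambda>\<omega> x. c * s \<omega> x)"
  unfolding Linf_simple_def
  by (auto intro: Linf_cmult simple_function_compose1[of M s "\<lambda>\<phi> x. c * \<phi> x"])

lemma Linf_simple_diff:
  "Linf_simple M U s \<Longrightarrow> Linf_simple M U t \<Longrightarrow> Linf_simple M U (\<lambda>\<omega> x. s \<omega> x - t \<omega> x)"
  using Linf_simple_add[of M U s "\<lambda>\<omega> x. -1 * t \<omega> x"] Linf_simple_cmult[of M U t "-1"] by simp

lemma Linf_approximable_in_Linf: "Linf_approximable M U Y \<Longrightarrow> \<omega> \<in> space M \<Longrightarrow> Y \<omega> \<in> Linf U"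
  by (simp add: Linf_approximable_def)

lemma Linf_approximableE:
  assumes "Linf_approximable M U Y" "0 < e"
  obtains s where "Linf_simple M U s" "\<And>\<omega>. \<omega> \<in> space M \<Longrightarrow> Linf_dist U (Y \<omega>) (s \<omega>) \<le> e"
  using assms unfolding Linf_approximable_def by blast

lemma Linf_simple_approximable: "Linf_simple M U s \<Longrightarrow> Linf_approximable M U s"
  unfolding Linf_approximable_def
  by (auto simp: Linf_simple_def Linf_norm_zero intro!: exI[of _ s])

lemma Linf_approximable_const: "c \<in> Linf U \<Longrightarrow> Linf_approximable M U (\<lambda>_. c)"
  by (rule Linf_simple_approximable) (simp add: Linf_simple_def)

lemma Linf_approximable_add:
  assumes Y: "Linf_approximable M U Y" and Z: "Linf_approximable M U Z"
  shows "Linf_approximable M U (\<lambda>\<omega> x. Y \<omega> x + Z \<omega> x)"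
  unfolding Linf_approximable_def
proof (intro conjI ballI allI impI)
  show "(\<lambda>x. Y \<omega> x + Z \<omega> x) \<in> Linf U" if "\<omega> \<in> space M" for \<omega>
    using that by (intro Linf_add Linf_approximable_in_Linf[OF Y] Linf_approximable_in_Linf[OF Z])
  fix e :: real assume "0 < e"
  then have "0 < e / 2" by simp
  obtain s where s: "Linf_simple M U s" "\<And>\<omega>. \<omega> \<in> space M \<Longrightarrow> Linf_dist U (Y \<omega>) (s \<omega>) \<le> e / 2"
    using Linf_approximableE[OF Y \<open>0 < e / 2\<close>] by blast
  obtain t where t: "Linf_simple M U t" "\<And>\<omega>. \<omega> \<in> space M \<Longrightarrow> Linf_dist U (Z \<omega>) (t \<omega>) \<le> e / 2"
    using Linf_approximableE[OF Z \<open>0 < e / 2\<close>] by blast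
  have "Linf_dist U (\<lambda>x. Y \<omega> x + Z \<omega> x) (\<lambda>x. s \<omega> x + t \<omega> x) \<le> e" if \<omega>: "\<omega> \<in> space M" for \<omega>
  proof -
    have "Linf_norm U (\<lambda>x. (Y \<omega> x - s \<omega> x) + (Z \<omega> x - t \<omega> x))
        \<le> Linf_dist U (Y \<omega>) (s \<omega>) + Linf_dist U (Z \<omega>) (t \<omega>)"
      using \<omega> by (intro Linf_norm_add_le Linf_diff Linf_approximable_in_Linf[OF Y]
          Linf_approximable_in_Linf[OF Z] Linf_simple_in_Linf[OF s(1)] Linf_simple_in_Linf[OF t(1)])
    also have "\<dots> \<le> e" using s(2)[OF \<omega>] t(2)[OF \<omega>] by simp
    finally show ?thesis by (simp add: algebra_simps)
  qed
  then show "\<exists>r. Linf_simple M U r \<and> (\<forall>\<omega>\<in>space M. Linf_dist U (\<lambda>x. Y \<omega> x + Z \<omega> x) (r \<omega>) \<le> e)"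
    using Linf_simple_add[OF s(1) t(1)] by blast
qed

lemma simple_function_representative:
  assumes T: "simple_function M T"
  obtains \<rho> where "simple_function M \<rho>" "\<And>\<omega>. \<omega> \<in> space M \<Longrightarrow> \<rho> \<omega> \<in> space M"
    "\<And>\<omega>. \<omega> \<in> space M \<Longrightarrow> T (\<rho> \<omega>) = T \<omega>"
proof
  define rep where "rep z = (SOME \<omega>. \<omega> \<in> space M \<and> T \<omega> = z)" for z
  show "simple_function M (\<lambda>\<omega>. rep (T \<omega>))"
    by (rule simple_function_compose1[OF T])
  fix \<omega> assume "\<omega> \<in> space M"
  then show "rep (T \<omega>) \<in> space M" "T (rep (T \<omega>)) = T \<omega>"
    using someI[of "\<lambda>\<omega>'. \<omega>' \<in> space M \<and> T \<omega>' = T \<omega>" \<omega>] by (auto simp: rep_def)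
qed

lemma Linf_approximable_of_level_sets:
  assumes Y: "\<And>\<omega>. \<omega> \<in> space M \<Longrightarrow> Y \<omega> \<in> Linf U"
    and T: "\<And>e. 0 < e \<Longrightarrow> simple_function M (T e)"
    and close: "\<And>e \<omega> \<omega>'. 0 < e \<Longrightarrow> \<omega> \<in> space M \<Longrightarrow> \<omega>' \<in> space M \<Longrightarrow> T e \<omega> = T e \<omega>' \<Longrightarrow>
      Linf_dist U (Y \<omega>) (Y \<omega>') \<le> e"
  shows "Linf_approximable M U Y"
  unfolding Linf_approximable_def
proof (intro conjI ballI allI impI Y)
  fix e :: real assume e: "0 < e"
  obtain \<rho> where \<rho>: "simple_function M \<rho>" "\<And>\<omega>. \<omega> \<in> space M \<Longrightarrow> \<rho> \<omega> \<in> space M"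
    "\<And>\<omega>. \<omega> \<in> space M \<Longrightarrow> T e (\<rho> \<omega>) = T e \<omega>"
    using simple_function_representative[OF T[OF e]] by blast
  have "Linf_simple M U (\<lambda>\<omega>. Y (\<rho> \<omega>))"
    unfolding Linf_simple_def using simple_function_compose1[OF \<rho>(1), of Y] \<rho>(2) Y by blast
  then show "\<exists>s. Linf_simple M U s \<and> (\<forall>\<omega>\<in>space M. Linf_dist U (Y \<omega>) (s \<omega>) \<le> e)"
    using close[OF e] \<rho>(2,3) by metis
qed

lemma Linf_approximable_Lipschitz_image:
  assumes V: "Linf_approximable M U V" and Y: "\<And>\<omega>. \<omega> \<in> space M \<Longrightarrow> Y \<omega> \<in> Linf U"
    and Lipschitz: "\<And>\<omega> \<omega>'. \<omega> \<in> space M \<Longrightarrow> \<omega>' \<in> space M \<Longrightarrow>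
      Linf_dist U (Y \<omega>) (Y \<omega>') \<le> C * Linf_dist U (V \<omega>) (V \<omega>')"
    and C: "0 \<le> C"
  shows "Linf_approximable M U Y"
proof -
  define \<eta> where "\<eta> e = e / (2 * (C + 1))" for e
  have "\<exists>s. Linf_simple M U s \<and> (\<forall>\<omega>\<in>space M. Linf_dist U (V \<omega>) (s \<omega>) \<le> \<eta> e)" if "0 < e" for e
    using V that C unfolding Linf_approximable_def by (simp add: \<eta>_def)
  then obtain s where s: "\<And>e. 0 < e \<Longrightarrow> Linf_simple M U (s e)"
    "\<And>e \<omega>. 0 < e \<Longrightarrow> \<omega> \<in> space M \<Longrightarrow> Linf_dist U (V \<omega>) (s e \<omega>) \<le> \<eta> e"
    by metis
  show ?thesis
  proof (rule Linf_approximable_of_level_sets[where T=s])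
    fix e :: real and \<omega> \<omega>'
    assume e: "0 < e" and \<omega>: "\<omega> \<in> space M" "\<omega>' \<in> space M" and eq: "s e \<omega> = s e \<omega>'"
    have "Linf_dist U (V \<omega>) (V \<omega>') \<le> Linf_dist U (V \<omega>) (s e \<omega>) + Linf_dist U (s e \<omega>) (V \<omega>')"
      by (intro Linf_dist_triangle Linf_approximable_in_Linf[OF V] Linf_simple_in_Linf[OF s(1)] e \<omega>)
    also have "\<dots> \<le> 2 * \<eta> e"
      using s(2)[OF e \<omega>(1)] s(2)[OF e \<omega>(2)] by (simp add: eq Linf_dist_commute[of U "s e \<omega>'"])
    finally have "C * Linf_dist U (V \<omega>) (V \<omega>') \<le> (C + 1) * (2 * \<eta> e)"
      using C by (intro mult_mono) (auto simp: Linf_norm_nonneg)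
    also have "\<dots> = e" using C by (simp add: \<eta>_def field_simps)
    finally show "Linf_dist U (Y \<omega>) (Y \<omega>') \<le> e" using Lipschitz[OF \<omega>] by linarith
  qed (use s(1) Y in \<open>auto simp: Linf_simple_def\<close>)
qed

lemma Linf_approximable_cmult:
  assumes "Linf_approximable M U Y"
  shows "Linf_approximable M U (\<lambda>\<omega> x. c * Y \<omega> x)"
proof (rule Linf_approximable_Lipschitz_image[OF assms, where C="\<bar>c\<bar>"])
  fix \<omega> \<omega>' assume "\<omega> \<in> space M" "\<omega>' \<in> space M"
  then have "(\<lambda>x. Y \<omega> x - Y \<omega>' x) \<in> Linf U"
    by (intro Linf_diff Linf_approximable_in_Linf[OF assms])
  from Linf_norm_cmult_le[OF this, of c]
  show "Linf_dist U (\<lambda>x. c * Y \<omega> x) (\<lambda>x. c * Y \<omega>' x) \<le> \<bar>c\<bar> * Linf_dist U (Y \<omega>) (Y \<omega>')"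
    by (simp only: right_diff_distrib)
qed (use assms in \<open>auto intro: Linf_cmult Linf_approximable_in_Linf\<close>)

lemma Linf_approximable_diff:
  assumes "Linf_approximable M U Y" "Linf_approximable M U Z"
  shows "Linf_approximable M U (\<lambda>\<omega> x. Y \<omega> x - Z \<omega> x)"
  using Linf_approximable_add[OF assms(1) Linf_approximable_cmult[OF assms(2), of "-1"]] by simp

lemma Linf_approximable_sum:
  "finite J \<Longrightarrow> (\<And>j. j \<in> J \<Longrightarrow> Linf_approximable M U (Y j)) \<Longrightarrow>
    Linf_approximable M U (\<lambda>\<omega> x. \<Sum>j\<in>J. Y j \<omega> x)"
  by (induction J rule: finite_induct)
    (auto intro: Linf_approximable_const Linf_zero Linf_approximable_add)

lemma Linf_approximable_sequence:
  assumes "Linf_approximable M U Y"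
  obtains s where "\<And>i. Linf_simple M U (s i)"
    "\<And>i \<omega>. \<omega> \<in> space M \<Longrightarrow> Linf_dist U (Y \<omega>) (s i \<omega>) \<le> 1 / real (Suc i)"
proof -
  have "\<forall>i. \<exists>s. Linf_simple M U s \<and> (\<forall>\<omega>\<in>space M. Linf_dist U (Y \<omega>) (s \<omega>) \<le> 1 / real (Suc i))"
    using assms unfolding Linf_approximable_def by simp
  then show ?thesis using that by metis
qed

lemma Linf_approximable_norm_measurable:
  assumes Y: "Linf_approximable M U Y"
  shows "(\<lambda>\<omega>. Linf_norm U (Y \<omega>)) \<in> borel_measurable M"
proof -
  obtain s where s: "\<And>i. Linf_simple M U (s i)"
    "\<And>i \<omega>. \<omega> \<in> space M \<Longrightarrow> Linf_dist U (Y \<omega>) (s i \<omega>) \<le> 1 / real (Suc i)"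
    using Linf_approximable_sequence[OF Y] by blast
  show ?thesis
  proof (rule borel_measurable_LIMSEQ_real)
    show "(\<lambda>\<omega>. Linf_norm U (s i \<omega>)) \<in> borel_measurable M" for i
      using Linf_simple_simple_function[OF s(1)]
      by (intro borel_measurable_simple_function simple_function_compose1[of M "s i" "Linf_norm U"])
    fix \<omega> assume \<omega>: "\<omega> \<in> space M"
    have "\<bar>Linf_norm U (s i \<omega>) - Linf_norm U (Y \<omega>)\<bar> \<le> 1 / real (Suc i)" for i
      using abs_Linf_norm_diff_le[OF Linf_approximable_in_Linf[OF Y \<omega>] Linf_simple_in_Linf[OF s(1) \<omega>]]
        s(2)[OF \<omega>, of i] by (subst abs_minus_commute) (rule order_trans)
    then have "(\<lambda>i. Linf_norm U (s i \<omega>) - Linf_norm U (Y \<omega>)) \<longlonglongrightarrow> 0"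
      by (intro Lim_null_comparison[OF always_eventually LIMSEQ_Suc[OF lim_1_over_n]]) auto
    then show "(\<lambda>i. Linf_norm U (s i \<omega>)) \<longlonglongrightarrow> Linf_norm U (Y \<omega>)"
      by (simp add: LIM_zero_iff)
  qed
qed

lemma Linf_approximable_norm_bounded:
  assumes Y: "Linf_approximable M U Y"
  obtains B where "\<And>\<omega>. \<omega> \<in> space M \<Longrightarrow> Linf_norm U (Y \<omega>) \<le> B"
proof -
  obtain s where s: "Linf_simple M U s" "\<And>\<omega>. \<omega> \<in> space M \<Longrightarrow> Linf_dist U (Y \<omega>) (s \<omega>) \<le> 1"
    using Linf_approximableE[OF Y zero_less_one] by blast
  have finite: "finite ((\<lambda>\<omega>. Linf_norm U (s \<omega>)) ` space M)"
    using s(1) by (metis Linf_simple_def simple_functionD(1) finite_imageI image_image)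
  show ?thesis
  proof (rule that)
    fix \<omega> assume \<omega>: "\<omega> \<in> space M"
    have "Linf_norm U (Y \<omega>) \<le> Linf_norm U (s \<omega>) + 1"
      using abs_Linf_norm_diff_le[OF Linf_approximable_in_Linf[OF Y \<omega>] Linf_simple_in_Linf[OF s(1) \<omega>]]
        s(2)[OF \<omega>] by linarith
    also have "\<dots> \<le> Max ((\<lambda>\<omega>. Linf_norm U (s \<omega>)) ` space M) + 1"
      using finite \<omega> by simp
    finally show "Linf_norm U (Y \<omega>) \<le> Max ((\<lambda>\<omega>. Linf_norm U (s \<omega>)) ` space M) + 1" .
  qed
qed

context finite_measure
begin

lemma Linf_approximable_norm_integrable:
  assumes "Linf_approximable M U Y"
  shows "integrable M (\<lambda>\<omega>. Linf_norm U (Y \<omega>))"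
proof -
  obtain B where "\<And>\<omega>. \<omega> \<in> space M \<Longrightarrow> Linf_norm U (Y \<omega>) \<le> B"
    using Linf_approximable_norm_bounded[OF assms] by blast
  then show ?thesis
    using Linf_approximable_norm_measurable[OF assms]
    by (intro integrable_const_bound[where B=B]) (auto simp: Linf_norm_nonneg)
qed

lemma
  fixes F :: "'b \<Rightarrow> real"
  assumes "simple_function M s"
  shows integrable_compose_simple_function: "integrable M (\<lambda>\<omega>. F (s \<omega>))"
    and integral_compose_simple_function:
      "(\<integral>\<omega>. F (s \<omega>) \<partial>M) = (\<Sum>z\<in>s ` space M. measure M (s -` {z} \<inter> space M) * F z)"
proof -
  have finite: "finite (s ` space M)" and level: "\<And>z. s -` {z} \<inter> space M \<in> sets M"
    using assms by (auto intro: simple_functionD)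
  have eq: "F (s \<omega>) = (\<Sum>z\<in>s ` space M. indicat_real (s -` {z} \<inter> space M) \<omega> * F z)"
    if "\<omega> \<in> space M" for \<omega>
  proof -
    have "(\<Sum>z\<in>s ` space M. indicat_real (s -` {z} \<inter> space M) \<omega> * F z)
        = (\<Sum>z\<in>s ` space M. if z = s \<omega> then F z else 0)"
      using that by (intro sum.cong) auto
    then show ?thesis using that finite by simp
  qed
  have int: "integrable M (\<lambda>\<omega>. indicat_real (s -` {z} \<inter> space M) \<omega> * F z)" for z
    using level[of z] by (intro integrable_mult_left) (auto simp: less_top[symmetric])
  show "integrable M (\<lambda>\<omega>. F (s \<omega>))"
    using int by (subst Bochner_Integration.integrable_cong[OF refl eq]) auto
  show "(\<integral>\<omega>. F (s \<omega>) \<partial>M) = (\<Sum>z\<in>s ` space M. measure M (s -` {z} \<inter> space M) * F z)"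
  proof (subst Bochner_Integration.integral_cong[OF refl eq])
    show "(\<integral>\<omega>. (\<Sum>z\<in>s ` space M. indicat_real (s -` {z} \<inter> space M) \<omega> * F z) \<partial>M)
        = (\<Sum>z\<in>s ` space M. measure M (s -` {z} \<inter> space M) * F z)"
      using level by (subst Bochner_Integration.integral_sum[OF int]) simp
  qed
qed

lemma
  fixes s :: "'a \<Rightarrow> 'b::euclidean_space \<Rightarrow> real"
  assumes s: "Linf_simple M U s"
  shows Linf_simple_integral_in_Linf: "(\<lambda>x. \<integral>\<omega>. s \<omega> x \<partial>M) \<in> Linf U"
    and Linf_norm_simple_integral_le:
      "Linf_norm U (\<lambda>x. \<integral>\<omega>. s \<omega> x \<partial>M) \<le> (\<integral>\<omega>. Linf_norm U (s \<omega>) \<partial>M)"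
proof -
  note sf = Linf_simple_simple_function[OF s]
  note int = Linf_approximable_norm_integrable[OF Linf_simple_approximable[OF s]]
  have "(\<lambda>x. \<Sum>\<phi>\<in>s ` space M. measure M (s -` {\<phi>} \<inter> space M) * \<phi> x) \<in> Linf U"
    using Linf_simple_in_Linf[OF s] simple_functionD(1)[OF sf] by (intro Linf_sum Linf_cmult) auto
  then show in_Linf: "(\<lambda>x. \<integral>\<omega>. s \<omega> x \<partial>M) \<in> Linf U"
    by (simp add: integral_compose_simple_function[OF sf, of "\<lambda>\<phi>. \<phi> _"])
  have "AE x in lebesgue_on U. \<forall>\<phi>\<in>s ` space M. \<bar>\<phi> x\<bar> \<le> Linf_norm U \<phi>"
    using Linf_simple_in_Linf[OF s] simple_functionD(1)[OF sf]
    by (intro AE_finite_allI AE_abs_le_Linf_norm) auto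
  then have "AE x in lebesgue_on U. \<bar>\<integral>\<omega>. s \<omega> x \<partial>M\<bar> \<le> (\<integral>\<omega>. Linf_norm U (s \<omega>) \<partial>M)"
  proof eventually_elim
    case (elim x)
    then have "(\<integral>\<omega>. \<bar>s \<omega> x\<bar> \<partial>M) \<le> (\<integral>\<omega>. Linf_norm U (s \<omega>) \<partial>M)"
      using integrable_compose_simple_function[OF sf, of "\<lambda>\<phi>. \<phi> x"] int
      by (intro integral_mono) auto
    then show ?case
      using integral_abs_bound[of M "\<lambda>\<omega>. s \<omega> x"] by linarith
  qed
  then show "Linf_norm U (\<lambda>x. \<integral>\<omega>. s \<omega> x \<partial>M) \<le> (\<integral>\<omega>. Linf_norm U (s \<omega>) \<partial>M)"
    using in_Linf by (intro Linf_norm_le) (auto intro: Linf_measurable simp: Linf_norm_nonneg)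
qed

lemma Linf_dist_simple_integral_le:
  fixes s t :: "'a \<Rightarrow> 'b::euclidean_space \<Rightarrow> real"
  assumes s: "Linf_simple M U s" and t: "Linf_simple M U t"
  shows "Linf_dist U (\<lambda>x. \<integral>\<omega>. s \<omega> x \<partial>M) (\<lambda>x. \<integral>\<omega>. t \<omega> x \<partial>M) \<le> (\<integral>\<omega>. Linf_dist U (s \<omega>) (t \<omega>) \<partial>M)"
  using Linf_norm_simple_integral_le[OF Linf_simple_diff[OF s t]]
    integrable_compose_simple_function[OF Linf_simple_simple_function[OF s], of "\<lambda>\<phi>. \<phi> _"]
    integrable_compose_simple_function[OF Linf_simple_simple_function[OF t], of "\<lambda>\<phi>. \<phi> _"]
  by simp

end

context prob_space
begin

lemma has_Linf_bochner_integral_uniform_limit: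
  assumes Y: "\<And>\<omega>. \<omega> \<in> space M \<Longrightarrow> Y \<omega> \<in> Linf U" and v: "v \<in> Linf U"
    and s: "\<And>i. Linf_simple M U (s i)"
    and uniform: "\<And>i \<omega>. \<omega> \<in> space M \<Longrightarrow> Linf_dist U (Y \<omega>) (s i \<omega>) \<le> e i" and e: "e \<longlonglongrightarrow> 0"
    and limit: "(\<lambda>i. Linf_dist U (\<lambda>x. \<integral>\<omega>. s i \<omega> x \<partial>M) v) \<longlonglongrightarrow> 0"
  shows "has_Linf_bochner_integral M U Y v"
  unfolding has_Linf_bochner_integral_def
proof (intro conjI ballI exI[of _ s] allI v Y AE_I2)
  note sf = Linf_simple_simple_function[OF s]
  show "simple_function M (s i)" "\<And>\<omega>. \<omega> \<in> space M \<Longrightarrow> s i \<omega> \<in> Linf U" for i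
    using s[of i] by (simp_all add: Linf_simple_def)
  show "(\<lambda>i. Linf_dist U (Y \<omega>) (s i \<omega>)) \<longlonglongrightarrow> 0" if "\<omega> \<in> space M" for \<omega>
    by (rule Lim_null_comparison[OF always_eventually e])
      (use uniform[OF that] in \<open>simp add: Linf_norm_nonneg\<close>)
  have "(\<integral>\<^sup>+\<omega>. ennreal (Linf_dist U (Y \<omega>) (s i \<omega>)) \<partial>M) \<le> (\<integral>\<^sup>+\<omega>. ennreal (e i) \<partial>M)" for i
    using uniform by (intro nn_integral_mono ennreal_leI)
  then have bound: "(\<integral>\<^sup>+\<omega>. ennreal (Linf_dist U (Y \<omega>) (s i \<omega>)) \<partial>M) \<le> ennreal (e i)" for i
    by (simp add: emeasure_space_1)
  show "(\<lambda>i. \<integral>\<^sup>+\<omega>. ennreal (Linf_dist U (Y \<omega>) (s i \<omega>)) \<partial>M) \<longlonglongrightarrow> 0"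
  proof (rule tendsto_sandwich[where f="\<lambda>_. 0" and h="\<lambda>i. ennreal (e i)"])
    show "(\<lambda>i. ennreal (e i)) \<longlonglongrightarrow> 0" using tendsto_ennrealI[OF e] by simp
  qed (use bound in auto)
  show "(\<lambda>i. Linf_norm U (\<lambda>x. (\<Sum>\<phi>\<in>s i ` space M. measure M (s i -` {\<phi>} \<inter> space M) * \<phi> x) - v x))
      \<longlonglongrightarrow> 0"
    using limit by (simp add: integral_compose_simple_function[OF sf, of "\<lambda>\<phi>. \<phi> _"])
qed

lemma has_Linf_bochner_integral_exists:
  assumes Y: "Linf_approximable M U Y"
  shows "\<exists>v. has_Linf_bochner_integral M U Y v"
proof -
  obtain s where s: "\<And>i. Linf_simple M U (s i)"
    and uniform: "\<And>i \<omega>. \<omega> \<in> space M \<Longrightarrow> Linf_dist U (Y \<omega>) (s i \<omega>) \<le> 1 / real (Suc i)"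
    using Linf_approximable_sequence[OF Y] by blast
  note null = LIMSEQ_Suc[OF lim_1_over_n]
  have rate: "Linf_dist U (\<lambda>x. \<integral>\<omega>. s i \<omega> x \<partial>M) (\<lambda>x. \<integral>\<omega>. s k \<omega> x \<partial>M)
      \<le> 1 / real (Suc i) + 1 / real (Suc k)" for i k
  proof -
    have "(\<integral>\<omega>. Linf_dist U (s i \<omega>) (s k \<omega>) \<partial>M) \<le> (\<integral>\<omega>. 1 / real (Suc i) + 1 / real (Suc k) \<partial>M)"
    proof (rule integral_mono)
      show "integrable M (\<lambda>\<omega>. Linf_dist U (s i \<omega>) (s k \<omega>))"
        by (intro Linf_approximable_norm_integrable Linf_simple_approximable Linf_simple_diff s)
      fix \<omega> assume \<omega>: "\<omega> \<in> space M"
      have "Linf_dist U (s i \<omega>) (s k \<omega>) \<le> Linf_dist U (s i \<omega>) (Y \<omega>) + Linf_dist U (Y \<omega>) (s k \<omega>)"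
        by (intro Linf_dist_triangle Linf_simple_in_Linf[OF s] Linf_approximable_in_Linf[OF Y] \<omega>)
      then show "Linf_dist U (s i \<omega>) (s k \<omega>) \<le> 1 / real (Suc i) + 1 / real (Suc k)"
        using uniform[OF \<omega>, of i] uniform[OF \<omega>, of k] Linf_dist_commute[of U "s i \<omega>" "Y \<omega>"] by linarith
    qed simp
    also have "\<dots> = 1 / real (Suc i) + 1 / real (Suc k)" by (simp add: prob_space)
    finally show ?thesis using Linf_dist_simple_integral_le[OF s s] order_trans by blast
  qed
  obtain v where v: "v \<in> Linf U" "\<And>i. Linf_dist U (\<lambda>x. \<integral>\<omega>. s i \<omega> x \<partial>M) v \<le> 1 / real (Suc i)"
    using Linf_complete[OF Linf_simple_integral_in_Linf[OF s] null rate] by blast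
  have "(\<lambda>i. Linf_dist U (\<lambda>x. \<integral>\<omega>. s i \<omega> x \<partial>M) v) \<longlonglongrightarrow> 0"
    by (rule Lim_null_comparison[OF always_eventually null])
      (use v(2) in \<open>simp add: Linf_norm_nonneg\<close>)
  from has_Linf_bochner_integral_uniform_limit[OF
      Linf_approximable_in_Linf[OF Y] v(1) s uniform null this]
  show ?thesis by blast
qed

lemma Linf_dist_simple_integral_const_le:
  assumes s: "Linf_simple M U s" and Y: "Linf_approximable M U Y" and c: "c \<in> Linf U"
  shows "Linf_dist U (\<lambda>x. \<integral>\<omega>. s \<omega> x \<partial>M) c
    \<le> (\<integral>\<omega>. Linf_dist U (Y \<omega>) (s \<omega>) \<partial>M) + (\<integral>\<omega>. Linf_dist U (Y \<omega>) c \<partial>M)"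
proof -
  have simple_c: "Linf_simple M U (\<lambda>_. c)" by (simp add: Linf_simple_def c)
  note int = Linf_approximable_norm_integrable[OF Linf_approximable_diff]
    Linf_simple_approximable[OF s] Linf_approximable_const[OF c] Y
  have "Linf_dist U (\<lambda>x. \<integral>\<omega>. s \<omega> x \<partial>M) c \<le> (\<integral>\<omega>. Linf_dist U (s \<omega>) c \<partial>M)"
    using Linf_dist_simple_integral_le[OF s simple_c] by (simp add: prob_space)
  also have "\<dots> \<le> (\<integral>\<omega>. Linf_dist U (Y \<omega>) (s \<omega>) + Linf_dist U (Y \<omega>) c \<partial>M)"
  proof (rule integral_mono)
    fix \<omega> assume \<omega>: "\<omega> \<in> space M"
    show "Linf_dist U (s \<omega>) c \<le> Linf_dist U (Y \<omega>) (s \<omega>) + Linf_dist U (Y \<omega>) c"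
      using Linf_dist_triangle[OF Linf_simple_in_Linf[OF s \<omega>] Linf_approximable_in_Linf[OF Y \<omega>] c]
        Linf_dist_commute[of U "s \<omega>" "Y \<omega>"] by simp
  qed (intro Bochner_Integration.integrable_add int)+
  also have "\<dots> = (\<integral>\<omega>. Linf_dist U (Y \<omega>) (s \<omega>) \<partial>M) + (\<integral>\<omega>. Linf_dist U (Y \<omega>) c \<partial>M)"
    by (intro Bochner_Integration.integral_add int)
  finally show ?thesis .
qed

lemma has_Linf_bochner_integral_dist_le:
  assumes Y: "Linf_approximable M U Y" and v: "has_Linf_bochner_integral M U Y v" and c: "c \<in> Linf U"
  shows "Linf_dist U v c \<le> (\<integral>\<omega>. Linf_dist U (Y \<omega>) c \<partial>M)"
proof -
  obtain s where vU: "v \<in> Linf U" and s: "\<And>i. Linf_simple M U (s i)"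
    and mean: "(\<lambda>i. \<integral>\<^sup>+\<omega>. ennreal (Linf_dist U (Y \<omega>) (s i \<omega>)) \<partial>M) \<longlonglongrightarrow> 0"
    and sum: "(\<lambda>i. Linf_norm U (\<lambda>x.
      (\<Sum>\<phi>\<in>s i ` space M. measure M (s i -` {\<phi>} \<inter> space M) * \<phi> x) - v x)) \<longlonglongrightarrow> 0"
    using v unfolding has_Linf_bochner_integral_def Linf_simple_def by blast
  have "integrable M (\<lambda>\<omega>. Linf_dist U (Y \<omega>) (s i \<omega>))" for i
    by (intro Linf_approximable_norm_integrable Linf_approximable_diff Y Linf_simple_approximable s)
  then have "(\<lambda>i. ennreal (\<integral>\<omega>. Linf_dist U (Y \<omega>) (s i \<omega>) \<partial>M)) \<longlonglongrightarrow> ennreal 0"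
    using mean by (simp add: nn_integral_eq_integral Linf_norm_nonneg)
  then have mean_integral: "(\<lambda>i. \<integral>\<omega>. Linf_dist U (Y \<omega>) (s i \<omega>) \<partial>M) \<longlonglongrightarrow> 0"
    by (subst (asm) tendsto_ennreal_iff)
      (auto intro!: always_eventually integral_nonneg simp: Linf_norm_nonneg)
  have limit: "(\<lambda>i. Linf_dist U (\<lambda>x. \<integral>\<omega>. s i \<omega> x \<partial>M) v) \<longlonglongrightarrow> 0"
    using sum
    by (simp add: integral_compose_simple_function[OF Linf_simple_simple_function[OF s], of "\<lambda>\<phi>. \<phi> _"])
  have bound: "Linf_dist U v c \<le> Linf_dist U (\<lambda>x. \<integral>\<omega>. s i \<omega> x \<partial>M) v
      + ((\<integral>\<omega>. Linf_dist U (Y \<omega>) (s i \<omega>) \<partial>M) + (\<integral>\<omega>. Linf_dist U (Y \<omega>) c \<partial>M))" for i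
    using Linf_dist_triangle[OF vU Linf_simple_integral_in_Linf[OF s[of i]] c]
      Linf_dist_simple_integral_const_le[OF s[of i] Y c]
      Linf_dist_commute[of U v "\<lambda>x. \<integral>\<omega>. s i \<omega> x \<partial>M"] by linarith
  have "(\<lambda>i. Linf_dist U (\<lambda>x. \<integral>\<omega>. s i \<omega> x \<partial>M) v
      + ((\<integral>\<omega>. Linf_dist U (Y \<omega>) (s i \<omega>) \<partial>M) + (\<integral>\<omega>. Linf_dist U (Y \<omega>) c \<partial>M)))
      \<longlonglongrightarrow> 0 + (0 + (\<integral>\<omega>. Linf_dist U (Y \<omega>) c \<partial>M))"
    by (intro tendsto_intros mean_integral limit)
  from LIMSEQ_le_const[OF this] bound show ?thesis by auto
qed

lemma has_Linf_bochner_integral_expectation: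
  assumes "Linf_approximable M U Y"
  shows "has_Linf_bochner_integral M U Y (Linf_expectation M U Y)"
  unfolding Linf_expectation_def by (rule someI_ex[OF has_Linf_bochner_integral_exists[OF assms]])

lemma Linf_expectation_in_Linf:
  "Linf_approximable M U Y \<Longrightarrow> Linf_expectation M U Y \<in> Linf U"
  using has_Linf_bochner_integral_expectation by (auto simp: has_Linf_bochner_integral_def)

lemma Linf_dist_expectation_le:
  "Linf_approximable M U Y \<Longrightarrow> c \<in> Linf U \<Longrightarrow>
    Linf_dist U (Linf_expectation M U Y) c \<le> (\<integral>\<omega>. Linf_dist U (Y \<omega>) c \<partial>M)"
  by (intro has_Linf_bochner_integral_dist_le has_Linf_bochner_integral_expectation)

end

subsection \<open>Signed measures of bounded variation\<close>

lemma sets_restrict_space_borel: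
  assumes "U \<in> sets borel"
  shows "sets (restrict_space borel U) = {A \<in> sets borel. A \<subseteq> U}"
  using assms by (auto simp: sets_restrict_space image_iff intro: sets.Int)

lemma borel_partitions_nonempty:
  assumes "A \<in> sets borel"
  shows "borel_partitions A \<noteq> {}"
proof -
  have "{A} - {{}} \<in> borel_partitions A"
    using assms by (auto simp: borel_partitions_def partition_on_def disjoint_def)
  then show ?thesis by blast
qed

lemma borel_partition_of_disjoint_family:
  assumes A: "A \<in> sets borel" and I: "finite I"
    and B: "\<And>i. i \<in> I \<Longrightarrow> B i \<in> sets borel" "\<And>i. i \<in> I \<Longrightarrow> B i \<subseteq> A" "disjoint_family_on B I"
  shows "insert (A - (\<Union>i\<in>I. B i)) (B ` I) - {{}} \<in> borel_partitions A" (is "?P \<in> _")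
  unfolding borel_partitions_def mem_Collect_eq
proof (intro conjI)
  let ?R = "A - (\<Union>i\<in>I. B i)"
  show "finite ?P" using I by simp
  show "?P \<subseteq> sets borel"
    using A B(1) I by (auto intro!: sets.Diff sets.finite_UN)
  show "partition_on A ?P"
  proof (rule partition_onI)
    have "\<Union>?P = ?R \<union> (\<Union>i\<in>I. B i)" by blast
    also have "\<dots> = A" using B(2) by blast
    finally show "\<Union>?P = A" .
    have disjnt_B: "disjnt (B i) (B j)" if "i \<in> I" "j \<in> I" "B i \<noteq> B j" for i j
      using disjoint_family_onD[OF B(3), of i j] that by (auto simp: disjnt_def)
    have disjnt_R: "disjnt ?R (B i)" if "i \<in> I" for i
      using that by (auto simp: disjnt_def)
    fix p q assume "p \<in> ?P" "q \<in> ?P" "p \<noteq> q"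
    then consider "p \<in> B ` I" "q \<in> B ` I" | "p = ?R" "q \<in> B ` I" | "p \<in> B ` I" "q = ?R"
      by blast
    then show "disjnt p q"
    proof cases
      case 1
      then show ?thesis using \<open>p \<noteq> q\<close> disjnt_B by auto
    next
      case 2
      then show ?thesis using disjnt_R by auto
    next
      case 3
      then show ?thesis using disjnt_R by (auto intro: disjnt_sym)
    qed
  qed simp
qed

lemma borel_partition_dominating_sum:
  fixes \<mu> :: "'a::topological_space set \<Rightarrow> real"
  assumes empty: "\<mu> {} = 0" and A: "A \<in> sets borel" and I: "finite I"
    and B: "\<And>i. i \<in> I \<Longrightarrow> B i \<in> sets borel" "\<And>i. i \<in> I \<Longrightarrow> B i \<subseteq> A" "disjoint_family_on B I"
  obtains P where "P \<in> borel_partitions A" "(\<Sum>i\<in>I. \<bar>\<mu> (B i)\<bar>) \<le> (\<Sum>C\<in>P. \<bar>\<mu> C\<bar>)"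
proof
  let ?P = "insert (A - (\<Union>i\<in>I. B i)) (B ` I) - {{}}"
  show "?P \<in> borel_partitions A"
    by (rule borel_partition_of_disjoint_family[OF A I B])
  have "(\<Sum>i\<in>I. \<bar>\<mu> (B i)\<bar>) = (\<Sum>C\<in>B ` I. \<bar>\<mu> C\<bar>)"
  proof (rule sum.reindex_nontrivial[OF I, symmetric, unfolded o_def])
    fix i j assume "i \<in> I" "j \<in> I" "i \<noteq> j" "B i = B j"
    then have "B i = {}" using B(3) by (auto simp: disjoint_family_on_def)
    then show "\<bar>\<mu> (B i)\<bar> = 0" using empty by simp
  qed
  also have "\<dots> = (\<Sum>C\<in>B ` I - {{}}. \<bar>\<mu> C\<bar>)"
    using I empty by (intro sum.mono_neutral_right) auto
  also have "\<dots> \<le> (\<Sum>C\<in>?P. \<bar>\<mu> C\<bar>)"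
    using I by (intro sum_mono2) auto
  finally show "(\<Sum>i\<in>I. \<bar>\<mu> (B i)\<bar>) \<le> (\<Sum>C\<in>?P. \<bar>\<mu> C\<bar>)" .
qed

text \<open>Without inner regularity, closedness under differences is immediate.\<close>

locale finite_signed_measure =
  fixes U :: "'a::topological_space set" and \<mu> :: "'a set \<Rightarrow> real"
  assumes U_borel: "U \<in> sets borel"
    and countably_additive: "\<And>A :: nat \<Rightarrow> 'a set. (\<And>i. A i \<in> sets borel) \<Longrightarrow> (\<And>i. A i \<subseteq> U) \<Longrightarrow>
      disjoint_family A \<Longrightarrow> (\<lambda>i. \<mu> (A i)) sums \<mu> (\<Union>i. A i)"
    and bounded_variation: "bdd_above ((\<lambda>P. \<Sum>B\<in>P. \<bar>\<mu> B\<bar>) ` borel_partitions U)"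
begin

lemma empty: "\<mu> {} = 0"
  using sums_summable[OF countably_additive[of "\<lambda>_. {}"]]
  by (simp add: disjoint_family_on_def summable_const_iff)

lemma bounded_variation_subset:
  assumes "A \<in> sets borel" "A \<subseteq> U"
  shows "bdd_above ((\<lambda>P. \<Sum>B\<in>P. \<bar>\<mu> B\<bar>) ` borel_partitions A)"
proof (rule bdd_aboveI2)
  fix P assume "P \<in> borel_partitions A"
  then have P: "finite P" "\<And>B. B \<in> P \<Longrightarrow> B \<in> sets borel" "\<And>B. B \<in> P \<Longrightarrow> B \<subseteq> U"
    "disjoint_family_on (\<lambda>B. B) P"
    using assms by (auto simp: borel_partitions_def partition_on_def disjoint_family_on_def disjoint_def)
  obtain Q where "Q \<in> borel_partitions U" "(\<Sum>B\<in>P. \<bar>\<mu> B\<bar>) \<le> (\<Sum>C\<in>Q. \<bar>\<mu> C\<bar>)"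
    using borel_partition_dominating_sum[of \<mu> U P "\<lambda>B. B"] empty U_borel P by blast
  then show "(\<Sum>B\<in>P. \<bar>\<mu> B\<bar>) \<le> total_variation \<mu> U"
    unfolding total_variation_def using cSUP_upper[OF _ bounded_variation] order_trans by blast
qed

lemma sum_abs_le_total_variation:
  assumes "A \<in> sets borel" "A \<subseteq> U" "finite I" "\<And>i. i \<in> I \<Longrightarrow> B i \<in> sets borel"
    "\<And>i. i \<in> I \<Longrightarrow> B i \<subseteq> A" "disjoint_family_on B I"
  shows "(\<Sum>i\<in>I. \<bar>\<mu> (B i)\<bar>) \<le> total_variation \<mu> A"
proof -
  obtain P where "P \<in> borel_partitions A" "(\<Sum>i\<in>I. \<bar>\<mu> (B i)\<bar>) \<le> (\<Sum>C\<in>P. \<bar>\<mu> C\<bar>)"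
    using borel_partition_dominating_sum[of \<mu> A I B] empty assms by blast
  then show ?thesis
    unfolding total_variation_def
    using cSUP_upper[OF _ bounded_variation_subset[OF assms(1,2)]] order_trans by blast
qed

lemma abs_le_total_variation: "A \<in> sets borel \<Longrightarrow> A \<subseteq> U \<Longrightarrow> \<bar>\<mu> A\<bar> \<le> total_variation \<mu> A"
  using sum_abs_le_total_variation[of A "{()}" "\<lambda>_. A"] by (auto simp: disjoint_family_on_def)

lemma total_variation_nonneg: "A \<in> sets borel \<Longrightarrow> A \<subseteq> U \<Longrightarrow> 0 \<le> total_variation \<mu> A"
  using abs_le_total_variation[of A] by linarith

lemma total_variation_superadditive:
  assumes A: "A \<in> sets borel" "A \<subseteq> U" and B: "B \<in> sets borel" "B \<subseteq> U" and disj: "A \<inter> B = {}"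
  shows "total_variation \<mu> A + total_variation \<mu> B \<le> total_variation \<mu> (A \<union> B)"
proof -
  have sum_le: "(\<Sum>C\<in>P. \<bar>\<mu> C\<bar>) + (\<Sum>C\<in>Q. \<bar>\<mu> C\<bar>) \<le> total_variation \<mu> (A \<union> B)"
    if P: "P \<in> borel_partitions A" and Q: "Q \<in> borel_partitions B" for P Q
  proof -
    have "C \<noteq> {} \<and> C \<subseteq> A \<inter> B" if "C \<in> P \<inter> Q" for C
      using that P Q by (auto simp: borel_partitions_def partition_on_def)
    then have "P \<inter> Q = {}" using disj by blast
    then have "(\<Sum>C\<in>P. \<bar>\<mu> C\<bar>) + (\<Sum>C\<in>Q. \<bar>\<mu> C\<bar>) = (\<Sum>C\<in>P \<union> Q. \<bar>\<mu> C\<bar>)"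
      using P Q by (simp add: sum.union_disjoint borel_partitions_def)
    also have "disjoint (P \<union> Q)"
      using P Q disj unfolding borel_partitions_def partition_on_def by (intro disjoint_union) auto
    then have "(\<Sum>C\<in>P \<union> Q. \<bar>\<mu> C\<bar>) \<le> total_variation \<mu> (A \<union> B)"
      using P Q A B by (intro sum_abs_le_total_variation)
        (auto simp: borel_partitions_def partition_on_def disjoint_family_on_def disjoint_def)
    finally show ?thesis .
  qed
  have "total_variation \<mu> B \<le> total_variation \<mu> (A \<union> B) - (\<Sum>C\<in>P. \<bar>\<mu> C\<bar>)"
    if "P \<in> borel_partitions A" for P
    unfolding total_variation_def[of \<mu> B]
    by (rule cSUP_least[OF borel_partitions_nonempty[OF B(1)]]) (use sum_le[OF that] in force)
  then have "total_variation \<mu> A \<le> total_variation \<mu> (A \<union> B) - total_variation \<mu> B"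
    unfolding total_variation_def[of \<mu> A]
    by (intro cSUP_least[OF borel_partitions_nonempty[OF A(1)]]) force
  then show ?thesis by simp
qed

lemma total_variation_mono:
  assumes "A \<in> sets borel" "B \<in> sets borel" "A \<subseteq> B" "B \<subseteq> U"
  shows "total_variation \<mu> A \<le> total_variation \<mu> B"
proof -
  have "total_variation \<mu> A + total_variation \<mu> (B - A) \<le> total_variation \<mu> (A \<union> (B - A))"
    using assms by (intro total_variation_superadditive) auto
  moreover have "0 \<le> total_variation \<mu> (B - A)"
    using assms by (intro total_variation_nonneg) auto
  moreover have "A \<union> (B - A) = B" using assms by auto
  ultimately show ?thesis by simp
qed

lemma total_variation_empty: "total_variation \<mu> {} = 0"
  using total_variation_superadditive[of "{}" "{}"] total_variation_nonneg[of "{}"] by simp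

context
  fixes A :: "nat \<Rightarrow> 'a set"
  assumes A_borel: "\<And>i. A i \<in> sets borel" and A_subset: "\<And>i. A i \<subseteq> U"
    and A_disjoint: "disjoint_family A"
begin

lemma sum_total_variation_le: "(\<Sum>i<n. total_variation \<mu> (A i)) \<le> total_variation \<mu> (\<Union>i. A i)"
proof -
  have "(\<Sum>i<n. total_variation \<mu> (A i)) \<le> total_variation \<mu> (\<Union>i<n. A i)"
  proof (induction n)
    case (Suc n)
    have "A i \<inter> A n = {}" if "i < n" for i
      using that by (intro disjoint_family_onD[OF A_disjoint]) auto
    then have "total_variation \<mu> (\<Union>i<n. A i) + total_variation \<mu> (A n)
        \<le> total_variation \<mu> ((\<Union>i<n. A i) \<union> A n)"
      using A_borel A_subset
      by (intro total_variation_superadditive sets.finite_UN UN_least) auto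
    moreover have "(\<Union>i<n. A i) \<union> A n = (\<Union>i<Suc n. A i)"
      by (auto simp: less_Suc_eq)
    ultimately show ?case using Suc by simp
  qed (simp add: total_variation_empty)
  also have "\<dots> \<le> total_variation \<mu> (\<Union>i. A i)"
    using A_borel A_subset by (intro total_variation_mono) auto
  finally show ?thesis .
qed

lemma summable_total_variation: "summable (\<lambda>i. total_variation \<mu> (A i))"
  using total_variation_nonneg[OF A_borel A_subset] sum_total_variation_le
  by (rule summableI_nonneg_bounded)

lemma sum_abs_partition_le_suminf_total_variation:
  assumes P: "P \<in> borel_partitions (\<Union>i. A i)"
  shows "(\<Sum>B\<in>P. \<bar>\<mu> B\<bar>) \<le> (\<Sum>i. total_variation \<mu> (A i))"
proof -
  have P_finite: "finite P" and P_borel: "\<And>B. B \<in> P \<Longrightarrow> B \<in> sets borel"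
    and P_Union: "\<Union>P = (\<Union>i. A i)" and P_disjoint: "disjoint P"
    using P by (auto simp: borel_partitions_def partition_on_def)
  have trace_sum_le: "(\<Sum>B\<in>P. \<bar>\<mu> (B \<inter> A i)\<bar>) \<le> total_variation \<mu> (A i)" for i
  proof (rule sum_abs_le_total_variation)
    show "disjoint_family_on (\<lambda>B. B \<inter> A i) P"
      using P_disjoint unfolding disjoint_family_on_def disjoint_def by blast
  qed (use A_borel A_subset P_finite P_borel in auto)
  have trace_summable: "summable (\<lambda>i. \<bar>\<mu> (B \<inter> A i)\<bar>)" if "B \<in> P" for B
  proof (rule summable_comparison_test'[OF summable_total_variation])
    fix i
    have "\<bar>\<mu> (B \<inter> A i)\<bar> \<le> (\<Sum>B\<in>P. \<bar>\<mu> (B \<inter> A i)\<bar>)"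
      using P_finite that by (intro member_le_sum) auto
    then show "norm \<bar>\<mu> (B \<inter> A i)\<bar> \<le> total_variation \<mu> (A i)"
      using trace_sum_le[of i] by simp
  qed
  have "\<bar>\<mu> B\<bar> \<le> (\<Sum>i. \<bar>\<mu> (B \<inter> A i)\<bar>)" if "B \<in> P" for B
  proof -
    have "(\<lambda>i. \<mu> (B \<inter> A i)) sums \<mu> (\<Union>i. B \<inter> A i)"
    proof (rule countably_additive)
      show "disjoint_family (\<lambda>i. B \<inter> A i)"
        using A_disjoint unfolding disjoint_family_on_def by blast
    qed (use A_borel A_subset P_borel[OF that] in auto)
    moreover have "(\<Union>i. B \<inter> A i) = B" using that P_Union by blast
    ultimately have "\<mu> B = (\<Sum>i. \<mu> (B \<inter> A i))" by (simp add: sums_iff)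
    then show ?thesis using summable_rabs[OF trace_summable[OF that]] by simp
  qed
  then have "(\<Sum>B\<in>P. \<bar>\<mu> B\<bar>) \<le> (\<Sum>B\<in>P. \<Sum>i. \<bar>\<mu> (B \<inter> A i)\<bar>)"
    by (intro sum_mono)
  also have "\<dots> = (\<Sum>i. \<Sum>B\<in>P. \<bar>\<mu> (B \<inter> A i)\<bar>)"
    using trace_summable by (intro suminf_sum[symmetric])
  also have "\<dots> \<le> (\<Sum>i. total_variation \<mu> (A i))"
    using trace_summable summable_total_variation trace_sum_le
    by (intro suminf_le summable_sum) auto
  finally show ?thesis .
qed

lemma total_variation_sums: "(\<lambda>i. total_variation \<mu> (A i)) sums total_variation \<mu> (\<Union>i. A i)"
proof -
  have "(\<Sum>i. total_variation \<mu> (A i)) \<le> total_variation \<mu> (\<Union>i. A i)"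
    by (rule suminf_le_const[OF summable_total_variation sum_total_variation_le])
  moreover have "total_variation \<mu> (\<Union>i. A i) \<le> (\<Sum>i. total_variation \<mu> (A i))"
    unfolding total_variation_def[of \<mu> "\<Union>i. A i"] using A_borel
    by (intro cSUP_least borel_partitions_nonempty sum_abs_partition_le_suminf_total_variation) auto
  ultimately show ?thesis using summable_total_variation by (simp add: sums_iff)
qed

end

end

definition Jordan_part :: "real \<Rightarrow> 'a::topological_space set \<Rightarrow> ('a set \<Rightarrow> real) \<Rightarrow> 'a measure" where
  "Jordan_part \<sigma> U \<mu> = measure_of U (sets (restrict_space borel U))
                          (\<lambda>A. ennreal ((total_variation \<mu> A + \<sigma> * \<mu> A) / 2))"

lemma sets_Jordan_part: "sets (Jordan_part \<sigma> U \<mu>) = sets (restrict_space borel U)"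
  and space_Jordan_part: "space (Jordan_part \<sigma> U \<mu>) = U"
proof -
  have space: "space (restrict_space borel U) = U" by (simp add: space_restrict_space)
  show "sets (Jordan_part \<sigma> U \<mu>) = sets (restrict_space borel U)"
    using sets.sigma_algebra_axioms[of "restrict_space borel U"]
    by (simp add: Jordan_part_def space sigma_algebra.sets_measure_of_eq)
  show "space (Jordan_part \<sigma> U \<mu>) = U"
    using sets.space_closed[of "restrict_space borel U"] by (simp add: Jordan_part_def space)
qed

lemma signed_integral_Jordan:
  "signed_integral U \<mu> \<phi> = (\<integral>y. \<phi> y \<partial>Jordan_part 1 U \<mu>) - (\<integral>y. \<phi> y \<partial>Jordan_part (-1) U \<mu>)"
  by (simp add: signed_integral_def pos_part_def neg_part_def Jordan_part_def)

context finite_signed_measure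
begin

lemma total_variation_add_scaled_nonneg:
  assumes "\<bar>\<sigma>\<bar> \<le> 1" "A \<in> sets borel" "A \<subseteq> U"
  shows "0 \<le> total_variation \<mu> A + \<sigma> * \<mu> A"
proof -
  have "\<bar>\<sigma> * \<mu> A\<bar> \<le> 1 * total_variation \<mu> A"
    unfolding abs_mult using assms by (intro mult_mono abs_le_total_variation) auto
  then show ?thesis by simp
qed

lemma emeasure_Jordan_part:
  assumes \<sigma>: "\<bar>\<sigma>\<bar> \<le> 1" and A: "A \<in> sets borel" "A \<subseteq> U"
  shows "emeasure (Jordan_part \<sigma> U \<mu>) A = ennreal ((total_variation \<mu> A + \<sigma> * \<mu> A) / 2)"
proof -
  let ?S = "sets (restrict_space borel U)"
  let ?w = "\<lambda>A. (total_variation \<mu> A + \<sigma> * \<mu> A) / 2"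
  note sets = sets_restrict_space_borel[OF U_borel]
  have algebra: "sigma_algebra U ?S"
    using sets.sigma_algebra_axioms[of "restrict_space borel U"] by (simp add: space_restrict_space)
  have "countably_additive ?S (\<lambda>A. ennreal (?w A))"
  proof (rule countably_additiveI)
    fix B :: "nat \<Rightarrow> 'a set"
    assume "range B \<subseteq> ?S" "disjoint_family B"
    then have B: "\<And>i. B i \<in> sets borel" "\<And>i. B i \<subseteq> U" "disjoint_family B"
      by (auto simp: sets)
    have "(\<lambda>i. ?w (B i)) sums ?w (\<Union>i. B i)"
      by (intro sums_divide sums_add sums_mult total_variation_sums countably_additive B)
    then show "(\<Sum>i. ennreal (?w (B i))) = ennreal (?w (\<Union>i. B i))"
      using total_variation_add_scaled_nonneg[OF \<sigma> B(1,2)] by (intro suminf_ennreal_eq) auto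
  qed
  moreover have "positive ?S (\<lambda>A. ennreal (?w A))"
    by (simp add: positive_def total_variation_empty empty)
  moreover have "A \<in> ?S" using A by (simp add: sets)
  ultimately show ?thesis
    unfolding Jordan_part_def by (intro emeasure_measure_of_sigma[OF algebra])
qed

lemma measure_Jordan_part:
  assumes "\<bar>\<sigma>\<bar> \<le> 1" "A \<in> sets borel" "A \<subseteq> U"
  shows "measure (Jordan_part \<sigma> U \<mu>) A = (total_variation \<mu> A + \<sigma> * \<mu> A) / 2"
  using emeasure_Jordan_part[OF assms] total_variation_add_scaled_nonneg[OF assms]
  by (simp add: measure_def)

lemma finite_measure_Jordan_part: "\<bar>\<sigma>\<bar> \<le> 1 \<Longrightarrow> finite_measure (Jordan_part \<sigma> U \<mu>)"
  using emeasure_Jordan_part[of \<sigma> U] U_borel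
  by (intro finite_measureI) (simp add: space_Jordan_part)

context
  fixes \<sigma> :: real and \<phi> :: "'a \<Rightarrow> real" and B :: real
  assumes \<sigma>: "\<bar>\<sigma>\<bar> \<le> 1" and measurable: "\<phi> \<in> borel_measurable (restrict_space borel U)"
    and bounded: "\<And>y. y \<in> U \<Longrightarrow> \<bar>\<phi> y\<bar> \<le> B"
begin

lemma integrable_Jordan_part: "integrable (Jordan_part \<sigma> U \<mu>) \<phi>"
proof -
  have "\<phi> \<in> borel_measurable (Jordan_part \<sigma> U \<mu>)"
    using measurable by (simp only: measurable_cong_sets[OF sets_Jordan_part refl])
  then show ?thesis
    using bounded
    by (auto intro!: finite_measure.integrable_const_bound[OF finite_measure_Jordan_part[OF \<sigma>], where B=B]
        simp: space_Jordan_part)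
qed

lemma abs_integral_Jordan_part_le:
  "\<bar>\<integral>y. \<phi> y \<partial>Jordan_part \<sigma> U \<mu>\<bar> \<le> B * ((tv_norm U \<mu> + \<sigma> * \<mu> U) / 2)"
proof -
  interpret Jordan: finite_measure "Jordan_part \<sigma> U \<mu>" by (rule finite_measure_Jordan_part[OF \<sigma>])
  have "\<bar>\<integral>y. \<phi> y \<partial>Jordan_part \<sigma> U \<mu>\<bar> \<le> (\<integral>y. \<bar>\<phi> y\<bar> \<partial>Jordan_part \<sigma> U \<mu>)"
    by (rule integral_abs_bound)
  also have "\<dots> \<le> (\<integral>y. B \<partial>Jordan_part \<sigma> U \<mu>)"
    using integrable_Jordan_part bounded by (intro integral_mono) (auto simp: space_Jordan_part)
  finally show ?thesis
    by (simp add: space_Jordan_part measure_Jordan_part[OF \<sigma> U_borel] mult.commute)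
qed

end

lemma abs_signed_integral_le:
  assumes "\<phi> \<in> borel_measurable (restrict_space borel U)" "\<And>y. y \<in> U \<Longrightarrow> \<bar>\<phi> y\<bar> \<le> B"
  shows "\<bar>signed_integral U \<mu> \<phi>\<bar> \<le> B * tv_norm U \<mu>"
proof -
  have "\<bar>signed_integral U \<mu> \<phi>\<bar>
      \<le> B * ((tv_norm U \<mu> + 1 * \<mu> U) / 2) + B * ((tv_norm U \<mu> + -1 * \<mu> U) / 2)"
    unfolding signed_integral_Jordan
    using abs_integral_Jordan_part_le[where \<sigma>=1] abs_integral_Jordan_part_le[where \<sigma>="-1"] assms
    by (intro order_trans[OF abs_triangle_ineq4] add_mono) auto
  also have "\<dots> = B * tv_norm U \<mu>" by (simp add: field_simps)
  finally show ?thesis .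
qed

lemma signed_integral_diff:
  assumes "\<phi> \<in> borel_measurable (restrict_space borel U)" "\<And>y. y \<in> U \<Longrightarrow> \<bar>\<phi> y\<bar> \<le> B"
    and "\<psi> \<in> borel_measurable (restrict_space borel U)" "\<And>y. y \<in> U \<Longrightarrow> \<bar>\<psi> y\<bar> \<le> C"
  shows "signed_integral U \<mu> (\<lambda>y. \<phi> y - \<psi> y) = signed_integral U \<mu> \<phi> - signed_integral U \<mu> \<psi>"
  using integrable_Jordan_part[OF _ assms(1,2)] integrable_Jordan_part[OF _ assms(3,4)]
  by (simp add: signed_integral_Jordan)

lemma signed_integral_simple_function:
  fixes s :: "'a \<Rightarrow> real"
  assumes s: "simple_function (restrict_space borel U) s"
  shows "signed_integral U \<mu> s = (\<Sum>c\<in>s ` U. \<mu> (s -` {c} \<inter> U) * c)"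
proof -
  have Jordan: "(\<integral>y. s y \<partial>Jordan_part \<sigma> U \<mu>)
      = (\<Sum>c\<in>s ` U. (total_variation \<mu> (s -` {c} \<inter> U) + \<sigma> * \<mu> (s -` {c} \<inter> U)) / 2 * c)"
    if \<sigma>: "\<bar>\<sigma>\<bar> \<le> 1" for \<sigma>
  proof -
    interpret Jordan: finite_measure "Jordan_part \<sigma> U \<mu>" by (rule finite_measure_Jordan_part[OF \<sigma>])
    have "simple_function (Jordan_part \<sigma> U \<mu>) s"
      using s by (simp add: simple_function_def sets_Jordan_part space_Jordan_part space_restrict_space)
    then have "(\<integral>y. s y \<partial>Jordan_part \<sigma> U \<mu>)
        = (\<Sum>c\<in>s ` U. measure (Jordan_part \<sigma> U \<mu>) (s -` {c} \<inter> U) * c)"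
      using Jordan.integral_compose_simple_function[of s "\<lambda>c. c"] by (simp add: space_Jordan_part)
    moreover have "s -` {c} \<inter> U \<in> sets borel" for c
      using simple_functionD(2)[OF s, of "{c}"]
      by (simp add: space_restrict_space sets_restrict_space_borel[OF U_borel])
    ultimately show ?thesis
      by (simp add: measure_Jordan_part[OF \<sigma>])
  qed
  show ?thesis
    unfolding signed_integral_Jordan Jordan[of 1, simplified] Jordan[of "-1", simplified]
      sum_subtractf[symmetric]
    by (intro sum.cong refl) (simp add: field_simps)
qed

lemma signed_integral_uniform_limit:
  assumes \<phi>: "\<phi> \<in> borel_measurable (restrict_space borel U)" "\<And>y. y \<in> U \<Longrightarrow> \<bar>\<phi> y\<bar> \<le> B"
    and s: "\<And>i. s i \<in> borel_measurable (restrict_space borel U)"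
    and uniform: "\<And>i y. y \<in> U \<Longrightarrow> \<bar>\<phi> y - s i y\<bar> \<le> e i" and e: "e \<longlonglongrightarrow> 0"
  shows "(\<lambda>i. signed_integral U \<mu> (s i)) \<longlonglongrightarrow> signed_integral U \<mu> \<phi>"
proof -
  have "\<bar>signed_integral U \<mu> (s i) - signed_integral U \<mu> \<phi>\<bar> \<le> e i * tv_norm U \<mu>" for i
  proof -
    have s_bounded: "\<bar>s i y\<bar> \<le> B + e i" if "y \<in> U" for y
      using \<phi>(2)[OF that] uniform[OF that, of i] by linarith
    have "signed_integral U \<mu> (\<lambda>y. s i y - \<phi> y) = signed_integral U \<mu> (s i) - signed_integral U \<mu> \<phi>"
      by (rule signed_integral_diff[OF s s_bounded \<phi>])
    moreover have "\<bar>signed_integral U \<mu> (\<lambda>y. s i y - \<phi> y)\<bar> \<le> e i * tv_norm U \<mu>"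
      using uniform
      by (intro abs_signed_integral_le borel_measurable_diff s \<phi>) (simp add: abs_minus_commute)
    ultimately show ?thesis by simp
  qed
  then have "(\<lambda>i. signed_integral U \<mu> (s i) - signed_integral U \<mu> \<phi>) \<longlonglongrightarrow> 0"
    by (intro Lim_null_comparison[OF _ tendsto_mult_left_zero[OF e, of "tv_norm U \<mu>"]]) simp
  then show ?thesis by (simp add: LIM_zero_iff)
qed

end

lemma simple_function_floor_divide:
  fixes \<phi> :: "'a \<Rightarrow> real"
  assumes [measurable]: "\<phi> \<in> borel_measurable M" and bounded: "\<And>y. y \<in> space M \<Longrightarrow> \<bar>\<phi> y\<bar> \<le> B"
    and e: "0 < e"
  shows "simple_function M (\<lambda>y. \<lfloor>\<phi> y / e\<rfloor>)"
proof -
  have "\<lfloor>\<phi> y / e\<rfloor> \<in> {\<lfloor>- B / e\<rfloor>..\<lfloor>B / e\<rfloor>}" if "y \<in> space M" for y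
  proof -
    have "- B / e \<le> \<phi> y / e" "\<phi> y / e \<le> B / e"
      using bounded[OF that] e by (intro divide_right_mono; simp)+
    then show ?thesis by (auto intro: floor_mono)
  qed
  then have "finite ((\<lambda>y. \<lfloor>\<phi> y / e\<rfloor>) ` space M)"
    by (intro finite_subset[OF image_subsetI finite_atLeastAtMost_int])
  moreover have "(\<lambda>y. \<lfloor>\<phi> y / e\<rfloor>) \<in> M \<rightarrow>\<^sub>M count_space UNIV" by measurable
  ultimately show ?thesis by (simp add: simple_function_eq_measurable)
qed

lemma uniform_simple_approximation:
  fixes \<phi> :: "'a \<Rightarrow> real"
  assumes \<phi>: "\<phi> \<in> borel_measurable M" "\<And>y. y \<in> space M \<Longrightarrow> \<bar>\<phi> y\<bar> \<le> B"
  obtains s where "\<And>i. simple_function M (s i)" "\<And>i y. \<bar>\<phi> y - s i y\<bar> \<le> 1 / real (Suc i)"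
proof
  define s where "s i y = of_int \<lfloor>\<phi> y / (1 / real (Suc i))\<rfloor> / real (Suc i)" for i y
  show "simple_function M (s i)" for i
    unfolding s_def by (rule simple_function_compose1[OF simple_function_floor_divide[OF \<phi>]]) simp_all
  show "\<bar>\<phi> y - s i y\<bar> \<le> 1 / real (Suc i)" for i y
  proof -
    have "\<phi> y - s i y = (\<phi> y * real (Suc i) - of_int \<lfloor>\<phi> y * real (Suc i)\<rfloor>) / real (Suc i)"
      by (simp add: s_def field_simps)
    also have "\<bar>\<dots>\<bar> \<le> 1 / real (Suc i)"
      unfolding abs_divide by (intro frac_le) linarith+
    finally show ?thesis .
  qed
qed

lemma finite_signed_measure_diff:
  assumes "finite_signed_measure U \<mu>" "finite_signed_measure U \<nu>"
  shows "finite_signed_measure U (\<lambda>A. \<mu> A - \<nu> A)"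
proof -
  interpret \<mu>: finite_signed_measure U \<mu> by fact
  interpret \<nu>: finite_signed_measure U \<nu> by fact
  show ?thesis
  proof
    show "(\<lambda>i. \<mu> (A i) - \<nu> (A i)) sums (\<mu> (\<Union>i. A i) - \<nu> (\<Union>i. A i))"
      if "\<And>i. A i \<in> sets borel" "\<And>i. A i \<subseteq> U" "disjoint_family A" for A :: "nat \<Rightarrow> 'a set"
      by (intro sums_diff \<mu>.countably_additive \<nu>.countably_additive that)
    show "bdd_above ((\<lambda>P. \<Sum>B\<in>P. \<bar>\<mu> B - \<nu> B\<bar>) ` borel_partitions U)"
    proof (rule bdd_aboveI2)
      fix P assume P: "P \<in> borel_partitions U"
      have "(\<Sum>B\<in>P. \<bar>\<mu> B - \<nu> B\<bar>) \<le> (\<Sum>B\<in>P. \<bar>\<mu> B\<bar> + \<bar>\<nu> B\<bar>)"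
        by (intro sum_mono abs_triangle_ineq4)
      also have "\<dots> = (\<Sum>B\<in>P. \<bar>\<mu> B\<bar>) + (\<Sum>B\<in>P. \<bar>\<nu> B\<bar>)"
        by (rule sum.distrib)
      also have "\<dots> \<le> tv_norm U \<mu> + tv_norm U \<nu>"
        unfolding total_variation_def
        by (intro add_mono cSUP_upper[OF P] \<mu>.bounded_variation \<nu>.bounded_variation)
      finally show "(\<Sum>B\<in>P. \<bar>\<mu> B - \<nu> B\<bar>) \<le> tv_norm U \<mu> + tv_norm U \<nu>" .
    qed
  qed (rule \<mu>.U_borel)
qed

context
  fixes U :: "'a::topological_space set" and \<mu> \<nu> :: "'a set \<Rightarrow> real" and \<phi> :: "'a \<Rightarrow> real" and B :: real
  assumes \<mu>: "finite_signed_measure U \<mu>" and \<nu>: "finite_signed_measure U \<nu>"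
    and measurable: "\<phi> \<in> borel_measurable (restrict_space borel U)"
    and bounded: "\<And>y. y \<in> U \<Longrightarrow> \<bar>\<phi> y\<bar> \<le> B"
begin

lemma signed_integral_measure_diff:
  "signed_integral U (\<lambda>A. \<mu> A - \<nu> A) \<phi> = signed_integral U \<mu> \<phi> - signed_integral U \<nu> \<phi>"
proof -
  note diff = finite_signed_measure_diff[OF \<mu> \<nu>]
  have "\<bar>\<phi> y\<bar> \<le> B" if "y \<in> space (restrict_space borel U)" for y
    using that bounded by (simp add: space_restrict_space)
  from uniform_simple_approximation[OF measurable this]
  obtain s where s: "\<And>i. simple_function (restrict_space borel U) (s i)"
    and close: "\<And>i y. \<bar>\<phi> y - s i y\<bar> \<le> 1 / real (Suc i)"
    by blast
  have limit: "(\<lambda>i. signed_integral U \<kappa> (s i)) \<longlonglongrightarrow> signed_integral U \<kappa> \<phi>"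
    if "finite_signed_measure U \<kappa>" for \<kappa>
    using finite_signed_measure.signed_integral_uniform_limit[OF that measurable bounded
        borel_measurable_simple_function[OF s] close LIMSEQ_Suc[OF lim_1_over_n]] .
  have "signed_integral U (\<lambda>A. \<mu> A - \<nu> A) (s i)
      = signed_integral U \<mu> (s i) - signed_integral U \<nu> (s i)" for i
    by (simp add: finite_signed_measure.signed_integral_simple_function[OF _ s] \<mu> \<nu> diff
        sum_subtractf[symmetric] left_diff_distrib)
  then have "(\<lambda>i. signed_integral U (\<lambda>A. \<mu> A - \<nu> A) (s i))
      \<longlonglongrightarrow> signed_integral U \<mu> \<phi> - signed_integral U \<nu> \<phi>"
    using tendsto_diff[OF limit[OF \<mu>] limit[OF \<nu>]] by simp
  then show ?thesis
    using limit[OF diff] LIMSEQ_unique by blast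
qed

lemma abs_signed_integral_measure_diff_le:
  "\<bar>signed_integral U \<mu> \<phi> - signed_integral U \<nu> \<phi>\<bar> \<le> B * tv_dist U \<mu> \<nu>"
  unfolding signed_integral_measure_diff[symmetric]
  by (rule finite_signed_measure.abs_signed_integral_le[OF
        finite_signed_measure_diff[OF \<mu> \<nu>] measurable bounded])

end

lemma radon_measures_imp_finite_signed_measure:
  assumes U: "U \<in> sets borel" and \<mu>: "\<mu> \<in> radon_measures U"
  shows "finite_signed_measure U \<mu>"
proof
  show "bdd_above ((\<lambda>P. \<Sum>B\<in>P. \<bar>\<mu> B\<bar>) ` borel_partitions U)"
    using \<mu> by (simp add: radon_measures_def)
  show "(\<lambda>i. \<mu> (A i)) sums \<mu> (\<Union>i. A i)"
    if "\<And>i. A i \<in> sets borel" "\<And>i. A i \<subseteq> U" "disjoint_family A" for A :: "nat \<Rightarrow> 'a set"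
    using \<mu> that unfolding radon_measures_def sets_restrict_space_borel[OF U] by blast
qed (rule U)

lemma space_radon_borel: "space (radon_borel U) = radon_measures U"
  unfolding radon_borel_def by (rule space_measure_of) (auto simp: tv_open_def)

lemma tv_open_in_sets_radon_borel: "tv_open U \<O> \<Longrightarrow> \<O> \<in> sets (radon_borel U)"
  unfolding radon_borel_def by (subst sets_measure_of) (auto simp: tv_open_def)

lemma Lipschitz_radon_borel_measurable:
  fixes F :: "('a::topological_space set \<Rightarrow> real) \<Rightarrow> real"
  assumes Lipschitz: "\<And>\<mu> \<nu>. \<mu> \<in> radon_measures U \<Longrightarrow> \<nu> \<in> radon_measures U \<Longrightarrow>
      \<bar>F \<mu> - F \<nu>\<bar> \<le> C * tv_dist U \<mu> \<nu>"
    and C: "0 \<le> C"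
  shows "F \<in> borel_measurable (radon_borel U)"
proof (rule borel_measurableI)
  fix S :: "real set" assume S: "open S"
  have "\<exists>r>0. \<forall>\<nu>\<in>radon_measures U. tv_dist U \<mu> \<nu> < r \<longrightarrow> F \<nu> \<in> S"
    if \<mu>: "\<mu> \<in> radon_measures U" "F \<mu> \<in> S" for \<mu>
  proof -
    obtain e where e: "e > 0" "\<And>z. \<bar>z - F \<mu>\<bar> < e \<Longrightarrow> z \<in> S"
      using S \<mu>(2) unfolding open_real by blast
    have "F \<nu> \<in> S" if \<nu>: "\<nu> \<in> radon_measures U" "tv_dist U \<mu> \<nu> < e / (C + 1)" for \<nu>
    proof (rule e(2))
      have "C * tv_dist U \<mu> \<nu> \<le> C * (e / (C + 1))"
        using \<nu>(2) C by (intro mult_left_mono) auto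
      also have "\<dots> < e" using e(1) C by (simp add: field_simps)
      finally show "\<bar>F \<nu> - F \<mu>\<bar> < e"
        using Lipschitz[OF \<mu>(1) \<nu>(1)] by (simp add: abs_minus_commute)
    qed
    then show ?thesis using e(1) C by (intro exI[of _ "e / (C + 1)"]) auto
  qed
  then have "tv_open U {\<mu> \<in> radon_measures U. F \<mu> \<in> S}"
    unfolding tv_open_def by auto
  moreover have "F -` S \<inter> space (radon_borel U) = {\<mu> \<in> radon_measures U. F \<mu> \<in> S}"
    by (auto simp: space_radon_borel)
  ultimately show "F -` S \<inter> space (radon_borel U) \<in> sets (radon_borel U)"
    by (simp add: tv_open_in_sets_radon_borel)
qed

subsection \<open>Potentials\<close>

definition uniformly_equicontinuous_on ::
  "'a::metric_space set \<Rightarrow> ('a \<Rightarrow> 'b::metric_space) set \<Rightarrow> bool" where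
  "uniformly_equicontinuous_on S F \<longleftrightarrow>
     (\<forall>e>0. \<exists>d>0. \<forall>\<phi>\<in>F. \<forall>x\<in>S. \<forall>y\<in>S. dist x y < d \<longrightarrow> dist (\<phi> x) (\<phi> y) < e)"

lemma uniformly_equicontinuous_onE:
  assumes "uniformly_equicontinuous_on S F" "0 < e"
  obtains d where "0 < d"
    "\<And>\<phi> x y. \<phi> \<in> F \<Longrightarrow> x \<in> S \<Longrightarrow> y \<in> S \<Longrightarrow> dist x y < d \<Longrightarrow> dist (\<phi> x) (\<phi> y) < e"
  using assms unfolding uniformly_equicontinuous_on_def by meson

lemma uniformly_equicontinuous_on_subset:
  "uniformly_equicontinuous_on S F \<Longrightarrow> G \<subseteq> F \<Longrightarrow> uniformly_equicontinuous_on S G"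
  unfolding uniformly_equicontinuous_on_def by (meson subsetD)

lemma uniformly_equicontinuous_on_imp_continuous_on:
  "uniformly_equicontinuous_on S F \<Longrightarrow> \<phi> \<in> F \<Longrightarrow> continuous_on S \<phi>"
  unfolding uniformly_equicontinuous_on_def continuous_on_iff by meson

context
  fixes U :: "'a::euclidean_space set" and f :: "'a \<Rightarrow>\<^sub>C real"
begin

lemma kernel_measurable: "(\<lambda>y. apply_bcontfun f (x - y)) \<in> borel_measurable (restrict_space borel U)"
  by (intro measurable_restrict_space1 borel_measurable_continuous_onI continuous_intros
      continuous_on_compose2[OF continuous_on_apply_bcontfun[of UNIV]]) auto

lemma abs_apply_bcontfun_le: "\<bar>apply_bcontfun f z\<bar> \<le> norm f"
  using norm_bounded[of f z] by simp

lemma abs_potential_le: "finite_signed_measure U \<mu> \<Longrightarrow> \<bar>potential U f \<mu> x\<bar> \<le> norm f * tv_norm U \<mu>"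
  unfolding potential_def
  by (intro finite_signed_measure.abs_signed_integral_le kernel_measurable abs_apply_bcontfun_le)

lemma abs_potential_measure_diff_le:
  "finite_signed_measure U \<mu> \<Longrightarrow> finite_signed_measure U \<nu> \<Longrightarrow>
    \<bar>potential U f \<mu> x - potential U f \<nu> x\<bar> \<le> norm f * tv_dist U \<mu> \<nu>"
  unfolding potential_def
  by (intro abs_signed_integral_measure_diff_le kernel_measurable abs_apply_bcontfun_le)

lemma abs_potential_point_diff_le:
  assumes \<mu>: "finite_signed_measure U \<mu>"
    and close: "\<And>y. y \<in> U \<Longrightarrow> \<bar>apply_bcontfun f (x - y) - apply_bcontfun f (x' - y)\<bar> \<le> \<eta>"
  shows "\<bar>potential U f \<mu> x - potential U f \<mu> x'\<bar> \<le> \<eta> * tv_norm U \<mu>"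
proof -
  interpret finite_signed_measure U \<mu> by (rule \<mu>)
  have "\<bar>signed_integral U \<mu> (\<lambda>y. apply_bcontfun f (x - y) - apply_bcontfun f (x' - y))\<bar> \<le> \<eta> * tv_norm U \<mu>"
    by (intro abs_signed_integral_le borel_measurable_diff kernel_measurable close)
  then show ?thesis
    unfolding potential_def
    by (simp add: signed_integral_diff[OF kernel_measurable abs_apply_bcontfun_le
          kernel_measurable abs_apply_bcontfun_le])
qed

lemma potential_measurable:
  assumes "U \<in> sets borel"
  shows "(\<lambda>\<mu>. potential U f \<mu> x) \<in> borel_measurable (radon_borel U)"
  by (rule Lipschitz_radon_borel_measurable[where C="norm f"])
    (auto intro: abs_potential_measure_diff_le radon_measures_imp_finite_signed_measure[OF assms])

lemma uniformly_equicontinuous_on_potentials: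
  assumes U: "bounded U"
  shows "uniformly_equicontinuous_on U (potential U f ` {\<mu>. finite_signed_measure U \<mu> \<and> tv_norm U \<mu> \<le> m})"
  unfolding uniformly_equicontinuous_on_def
proof (intro allI impI)
  fix e :: real assume "0 < e"
  define \<eta> where "\<eta> = e / (\<bar>m\<bar> + 1)"
  have \<eta>: "0 < \<eta>" using \<open>0 < e\<close> by (simp add: \<eta>_def add_nonneg_pos)
  obtain R where R: "\<And>x. x \<in> U \<Longrightarrow> norm x \<le> R"
    using U by (auto simp: bounded_iff)
  have diff_in_ball: "x - y \<in> cball 0 (2 * R)" if "x \<in> U" "y \<in> U" for x y
    using R[OF that(1)] R[OF that(2)] norm_triangle_ineq4[of x y] by simp
  have "uniformly_continuous_on (cball 0 (2 * R)) (apply_bcontfun f)"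
    by (intro compact_uniformly_continuous continuous_on_apply_bcontfun) auto
  then obtain d where d: "d > 0" "\<And>z z'. z \<in> cball 0 (2 * R) \<Longrightarrow> z' \<in> cball 0 (2 * R) \<Longrightarrow> dist z' z < d \<Longrightarrow>
      dist (apply_bcontfun f z') (apply_bcontfun f z) < \<eta>"
    unfolding uniformly_continuous_on_def using \<eta> by meson
  have "dist (potential U f \<mu> x) (potential U f \<mu> x') < e"
    if \<mu>: "finite_signed_measure U \<mu>" "tv_norm U \<mu> \<le> m" and x: "x \<in> U" "x' \<in> U" "dist x x' < d" for \<mu> x x'
  proof -
    have "\<bar>apply_bcontfun f (x - y) - apply_bcontfun f (x' - y)\<bar> \<le> \<eta>" if y: "y \<in> U" for y
      using d(2)[OF diff_in_ball[OF x(2) y] diff_in_ball[OF x(1) y]] x(3) by (simp add: dist_norm)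
    then have "dist (potential U f \<mu> x) (potential U f \<mu> x') \<le> \<eta> * tv_norm U \<mu>"
      unfolding dist_real_def by (rule abs_potential_point_diff_le[OF \<mu>(1)])
    also have "\<dots> \<le> \<eta> * \<bar>m\<bar>" using \<mu>(2) \<eta> by (intro mult_left_mono) auto
    also have "\<dots> < e" using \<open>0 < e\<close> by (simp add: \<eta>_def field_simps)
    finally show ?thesis .
  qed
  then show "\<exists>d>0. \<forall>\<phi>\<in>potential U f ` {\<mu>. finite_signed_measure U \<mu> \<and> tv_norm U \<mu> \<le> m}.
      \<forall>x\<in>U. \<forall>x'\<in>U. dist x x' < d \<longrightarrow> dist (\<phi> x) (\<phi> x') < e"
    using d(1) by blast
qed

lemma
  assumes "bounded U" and \<mu>: "finite_signed_measure U \<mu>"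
  shows potential_in_Linf: "potential U f \<mu> \<in> Linf U"
    and Linf_norm_potential_le: "Linf_norm U (potential U f \<mu>) \<le> norm f * tv_norm U \<mu>"
proof -
  interpret finite_signed_measure U \<mu> by (rule \<mu>)
  have "continuous_on U (potential U f \<mu>)"
    by (rule uniformly_equicontinuous_on_imp_continuous_on[OF
          uniformly_equicontinuous_on_potentials[OF assms(1), of "tv_norm U \<mu>"]]) (use \<mu> in simp)
  then have measurable: "potential U f \<mu> \<in> borel_measurable (lebesgue_on U)"
    using U_borel by (intro continuous_imp_measurable_on_sets_lebesgue) auto
  have bound: "AE x in lebesgue_on U. \<bar>potential U f \<mu> x\<bar> \<le> norm f * tv_norm U \<mu>"
    by (rule AE_I2) (rule abs_potential_le[OF \<mu>])
  show "potential U f \<mu> \<in> Linf U" by (rule LinfI[OF measurable bound])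
  show "Linf_norm U (potential U f \<mu>) \<le> norm f * tv_norm U \<mu>"
    using total_variation_nonneg[OF U_borel] by (intro Linf_norm_le[OF measurable bound]) simp
qed

end

subsection \<open>Harmonic and subharmonic functions\<close>

lemma harmonic_onI:
  assumes "\<And>x. x \<in> S \<Longrightarrow> (h has_derivative (\<lambda>v. D x \<bullet> v)) (at x)"
    and "\<And>x. x \<in> S \<Longrightarrow> (D has_derivative H x) (at x)"
    and "\<And>v. continuous_on S (\<lambda>x. H x v)"
    and "\<And>x. x \<in> S \<Longrightarrow> (\<Sum>i\<in>Basis. H x i \<bullet> i) = 0"
  shows "harmonic_on h S"
  unfolding harmonic_on_def by (intro exI[of _ D] exI[of _ H] conjI ballI allI assms)

lemma harmonic_onE:
  assumes "harmonic_on h S"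
  obtains D H where "\<And>x. x \<in> S \<Longrightarrow> (h has_derivative (\<lambda>v. D x \<bullet> v)) (at x)"
    and "\<And>x. x \<in> S \<Longrightarrow> (D has_derivative H x) (at x)"
    and "\<And>v. continuous_on S (\<lambda>x. H x v)"
    and "\<And>x. x \<in> S \<Longrightarrow> (\<Sum>i\<in>Basis. H x i \<bullet> i) = 0"
  using assms unfolding harmonic_on_def by blast

lemma harmonic_on_subset:
  assumes "harmonic_on h S" "T \<subseteq> S"
  shows "harmonic_on h T"
  using assms(1)
proof (rule harmonic_onE)
  fix D H
  assume "\<And>x. x \<in> S \<Longrightarrow> (h has_derivative (\<lambda>v. D x \<bullet> v)) (at x)"
    "\<And>x. x \<in> S \<Longrightarrow> (D has_derivative H x) (at x)"
    "\<And>v. continuous_on S (\<lambda>x. H x v)" "\<And>x. x \<in> S \<Longrightarrow> (\<Sum>i\<in>Basis. H x i \<bullet> i) = 0"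
  then show ?thesis
    using assms(2) by (intro harmonic_onI[of T h D H]) (auto intro: continuous_on_subset)
qed

lemma harmonic_on_add:
  assumes "harmonic_on h S" "harmonic_on k S"
  shows "harmonic_on (\<lambda>x. h x + k x) S"
proof -
  obtain D H where D: "\<And>x. x \<in> S \<Longrightarrow> (h has_derivative (\<lambda>v. D x \<bullet> v)) (at x)"
    "\<And>x. x \<in> S \<Longrightarrow> (D has_derivative H x) (at x)" "\<And>v. continuous_on S (\<lambda>x. H x v)"
    "\<And>x. x \<in> S \<Longrightarrow> (\<Sum>i\<in>Basis. H x i \<bullet> i) = 0"
    using harmonic_onE[OF assms(1)] by blast
  obtain E K where E: "\<And>x. x \<in> S \<Longrightarrow> (k has_derivative (\<lambda>v. E x \<bullet> v)) (at x)"
    "\<And>x. x \<in> S \<Longrightarrow> (E has_derivative K x) (at x)" "\<And>v. continuous_on S (\<lambda>x. K x v)"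
    "\<And>x. x \<in> S \<Longrightarrow> (\<Sum>i\<in>Basis. K x i \<bullet> i) = 0"
    using harmonic_onE[OF assms(2)] by blast
  show ?thesis
  proof (rule harmonic_onI)
    show "((\<lambda>x. h x + k x) has_derivative (\<lambda>v. (D x + E x) \<bullet> v)) (at x)" if "x \<in> S" for x
      unfolding inner_add_left by (intro has_derivative_add D(1) E(1) that)
    show "((\<lambda>x. D x + E x) has_derivative (\<lambda>v. H x v + K x v)) (at x)" if "x \<in> S" for x
      by (intro has_derivative_add D(2) E(2) that)
  qed (use D(3,4) E(3,4) in \<open>auto simp: inner_add_left sum.distrib intro: continuous_on_add\<close>)
qed

lemma harmonic_on_cmult:
  assumes "harmonic_on h S"
  shows "harmonic_on (\<lambda>x. c * h x) S"
proof -
  obtain D H where D: "\<And>x. x \<in> S \<Longrightarrow> (h has_derivative (\<lambda>v. D x \<bullet> v)) (at x)"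
    "\<And>x. x \<in> S \<Longrightarrow> (D has_derivative H x) (at x)" "\<And>v. continuous_on S (\<lambda>x. H x v)"
    "\<And>x. x \<in> S \<Longrightarrow> (\<Sum>i\<in>Basis. H x i \<bullet> i) = 0"
    using harmonic_onE[OF assms] by blast
  show ?thesis
  proof (rule harmonic_onI)
    show "((\<lambda>x. c * h x) has_derivative (\<lambda>v. (c *\<^sub>R D x) \<bullet> v)) (at x)" if "x \<in> S" for x
      unfolding inner_scaleR_left by (intro has_derivative_mult_right D(1) that)
    show "((\<lambda>x. c *\<^sub>R D x) has_derivative (\<lambda>v. c *\<^sub>R H x v)) (at x)" if "x \<in> S" for x
      by (intro has_derivative_scaleR_right D(2) that)
  qed (use D(3,4) in \<open>auto simp: sum_distrib_left[symmetric] intro: continuous_intros\<close>)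
qed

lemma harmonic_on_affine: "harmonic_on (\<lambda>y. c + l \<bullet> y) S"
  by (rule harmonic_onI[where D="\<lambda>_. l" and H="\<lambda>_ _. 0"]) (auto intro!: derivative_eq_intros)

lemma has_derivative_sqnorm_powr:
  fixes x y :: "'a::real_inner"
  assumes "y \<noteq> x"
  shows "((\<lambda>y. ((y - x) \<bullet> (y - x)) powr a) has_derivative
    (\<lambda>v. 2 * a * ((y - x) \<bullet> (y - x)) powr (a - 1) * ((y - x) \<bullet> v))) (at y)"
proof -
  have "0 < (y - x) \<bullet> (y - x)" using assms by simp
  then show ?thesis
    by (auto intro!: derivative_eq_intros simp: powr_diff fun_eq_iff inner_commute)
qed

context
  fixes x :: "'a::euclidean_space" and a :: real
begin

abbreviation "sqnorm_powr_gradient y \<equiv> (2 * a * ((y - x) \<bullet> (y - x)) powr (a - 1)) *\<^sub>R (y - x)"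

abbreviation "sqnorm_powr_Hessian y v \<equiv> (2 * a * ((y - x) \<bullet> (y - x)) powr (a - 1)) *\<^sub>R v
  + (2 * a * (2 * (a - 1) * ((y - x) \<bullet> (y - x)) powr (a - 2) * ((y - x) \<bullet> v))) *\<^sub>R (y - x)"

lemma has_derivative_sqnorm_powr_gradient:
  assumes "y \<noteq> x"
  shows "((\<lambda>y. sqnorm_powr_gradient y) has_derivative (\<lambda>v. sqnorm_powr_Hessian y v)) (at y)"
proof -
  have "((\<lambda>y. sqnorm_powr_gradient y) has_derivative
      (\<lambda>v. (2 * a * ((y - x) \<bullet> (y - x)) powr (a - 1)) *\<^sub>R (v - 0)
        + (2 * a * (2 * (a - 1) * ((y - x) \<bullet> (y - x)) powr (a - 1 - 1) * ((y - x) \<bullet> v))) *\<^sub>R (y - x))) (at y)"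
    by (intro has_derivative_scaleR has_derivative_mult_right has_derivative_sqnorm_powr[OF assms]
        has_derivative_diff has_derivative_ident has_derivative_const)
  moreover have "a - 1 - 1 = a - 2" by simp
  ultimately show ?thesis by simp
qed

lemma Laplacian_sqnorm_powr:
  assumes "y \<noteq> x"
  shows "(\<Sum>i\<in>Basis. sqnorm_powr_Hessian y i \<bullet> i)
    = 2 * a * ((y - x) \<bullet> (y - x)) powr (a - 1) * (real DIM('a) + 2 * (a - 1))"
proof -
  define q where "q = (y - x) \<bullet> (y - x)"
  have q: "0 < q" using assms by (simp add: q_def)
  have "(\<Sum>i\<in>Basis. sqnorm_powr_Hessian y i \<bullet> i) = (\<Sum>i\<in>Basis. 2 * a * q powr (a - 1)
      + 4 * a * (a - 1) * q powr (a - 2) * (((y - x) \<bullet> i) * ((y - x) \<bullet> i)))"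
    by (intro sum.cong) (auto simp: q_def inner_add_left inner_Basis algebra_simps)
  also have "\<dots> = real DIM('a) * (2 * a * q powr (a - 1)) + 4 * a * (a - 1) * q powr (a - 2) * q"
    by (simp add: sum.distrib sum_distrib_left[symmetric] q_def euclidean_inner[of "y - x" "y - x"])
  also have "q powr (a - 2) = q powr (a - 1) / q"
    using q powr_diff[of q "a - 1" 1] by simp
  also have "real DIM('a) * (2 * a * q powr (a - 1)) + 4 * a * (a - 1) * (q powr (a - 1) / q) * q
      = 2 * a * q powr (a - 1) * (real DIM('a) + 2 * (a - 1))"
    using q by (simp add: field_simps)
  finally show ?thesis by (simp only: q_def)
qed

end

lemma harmonic_on_sqnorm_powr:
  fixes x :: "'a::euclidean_space"
  assumes x: "x \<notin> S"
  shows "harmonic_on (\<lambda>y. ((y - x) \<bullet> (y - x)) powr (1 - real DIM('a) / 2)) S"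
proof -
  define a where "a = 1 - real DIM('a) / 2"
  have neq: "y \<noteq> x" if "y \<in> S" for y using x that by blast
  show ?thesis
    unfolding a_def[symmetric]
  proof (rule harmonic_onI)
    fix y assume y: "y \<in> S"
    show "((\<lambda>y. ((y - x) \<bullet> (y - x)) powr a) has_derivative (\<lambda>v. sqnorm_powr_gradient x a y \<bullet> v)) (at y)"
      using has_derivative_sqnorm_powr[OF neq[OF y], of a] by simp
    show "((\<lambda>y. sqnorm_powr_gradient x a y) has_derivative (\<lambda>v. sqnorm_powr_Hessian x a y v)) (at y)"
      by (rule has_derivative_sqnorm_powr_gradient[OF neq[OF y]])
    show "(\<Sum>i\<in>Basis. sqnorm_powr_Hessian x a y i \<bullet> i) = 0"
      unfolding Laplacian_sqnorm_powr[OF neq[OF y]] by (simp add: a_def)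
  next
    fix v
    have continuous_powr: "continuous_on S (\<lambda>y. ((y - x) \<bullet> (y - x)) powr b)" for b
      using neq by (intro continuous_on_powr continuous_intros) auto
    show "continuous_on S (\<lambda>y. sqnorm_powr_Hessian x a y v)"
      by (intro continuous_intros continuous_powr)
  qed
qed

lemma second_derivative_nonneg_at_min:
  fixes k :: "real \<Rightarrow> real"
  assumes d: "0 < d" and k: "\<And>t. \<bar>t\<bar> < d \<Longrightarrow> (k has_real_derivative k' t) (at t)"
    and k': "(k' has_real_derivative c) (at 0)" and min: "\<And>t. \<bar>t\<bar> < d \<Longrightarrow> k 0 \<le> k t"
  shows "0 \<le> c"
proof (rule ccontr)
  assume "\<not> 0 \<le> c"
  then obtain e where e: "e > 0" "\<And>t. 0 < t \<Longrightarrow> t < e \<Longrightarrow> k' t < k' 0"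
    using DERIV_neg_dec_right[OF k'] by auto
  have "k' 0 = 0"
    using min d by (intro DERIV_local_min[OF k d]) auto
  define t where "t = min d e / 2"
  have t: "0 < t" "t < d" "t < e" using d e by (auto simp: t_def)
  have "k t < k 0"
  proof (rule DERIV_neg_imp_decreasing_open[OF t(1)])
    show "\<exists>y. (k has_real_derivative y) (at s) \<and> y < 0" if "0 < s" "s < t" for s
      using k[of s] e(2)[of s] that t \<open>k' 0 = 0\<close> by auto
    show "continuous_on {0..t} k"
      using t k by (intro continuous_at_imp_continuous_on ballI DERIV_isCont[OF k]) auto
  qed
  then show False using min[of t] t by simp
qed

lemma Hessian_nonneg_at_min:
  fixes k :: "'a::real_inner \<Rightarrow> real"
  assumes d: "0 < d" and D: "\<And>y. y \<in> ball a d \<Longrightarrow> (k has_derivative (\<lambda>v. D y \<bullet> v)) (at y)"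
    and H: "(D has_derivative H) (at a)" and min: "\<And>y. y \<in> ball a d \<Longrightarrow> k a \<le> k y"
  shows "0 \<le> H v \<bullet> v"
proof (cases "v = 0")
  case False
  have in_ball: "a + t *\<^sub>R v \<in> ball a d" if "\<bar>t\<bar> < d / norm v" for t
    using that False by (simp add: dist_norm pos_less_divide_eq)
  have line: "((\<lambda>t. a + t *\<^sub>R v) has_derivative (\<lambda>s. s *\<^sub>R v)) (at t)" for t
    by (auto intro!: derivative_eq_intros)
  show ?thesis
  proof (rule second_derivative_nonneg_at_min[of "d / norm v"])
    show "0 < d / norm v" using d False by simp
    fix t assume t: "\<bar>t\<bar> < d / norm v"
    have "((\<lambda>t. k (a + t *\<^sub>R v)) has_derivative (\<lambda>s. D (a + t *\<^sub>R v) \<bullet> (s *\<^sub>R v))) (at t)"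
      by (rule has_derivative_compose[OF line D[OF in_ball[OF t]]])
    then show "((\<lambda>t. k (a + t *\<^sub>R v)) has_real_derivative D (a + t *\<^sub>R v) \<bullet> v) (at t)"
      by (simp add: has_field_derivative_def mult_commute_abs)
    show "k (a + 0 *\<^sub>R v) \<le> k (a + t *\<^sub>R v)"
      using min[OF in_ball[OF t]] by simp
  next
    interpret linear H by (rule has_derivative_linear[OF H])
    have "((\<lambda>t. D (a + t *\<^sub>R v)) has_derivative (\<lambda>s. H (s *\<^sub>R v))) (at 0)"
      by (rule has_derivative_compose[OF line]) (use H in simp)
    then have "((\<lambda>t. D (a + t *\<^sub>R v) \<bullet> v) has_derivative (\<lambda>s. H (s *\<^sub>R v) \<bullet> v)) (at 0)"
      by (rule has_derivative_inner_left)
    then show "((\<lambda>t. D (a + t *\<^sub>R v) \<bullet> v) has_real_derivative H v \<bullet> v) (at 0)"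
      by (simp add: has_field_derivative_def scale mult_commute_abs)
  qed
qed simp

lemma harmonic_on_minus_sqnorm_no_min:
  fixes h :: "'a::euclidean_space \<Rightarrow> real"
  assumes S: "open S" and h: "harmonic_on h S" and e: "0 < e" and x: "x \<in> S"
  shows "\<exists>y\<in>S. h y - e * ((y - a) \<bullet> (y - a)) < h x - e * ((x - a) \<bullet> (x - a))"
proof (rule ccontr)
  define k where "k y = h y - e * ((y - a) \<bullet> (y - a))" for y
  assume "\<not> ?thesis"
  then have min: "k x \<le> k y" if "y \<in> S" for y
    using that by (auto simp: k_def not_less)
  obtain D H where D: "\<And>y. y \<in> S \<Longrightarrow> (h has_derivative (\<lambda>v. D y \<bullet> v)) (at y)"
    "\<And>y. y \<in> S \<Longrightarrow> (D has_derivative H y) (at y)" "\<And>y. y \<in> S \<Longrightarrow> (\<Sum>i\<in>Basis. H y i \<bullet> i) = 0"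
    using h unfolding harmonic_on_def by blast
  obtain d where d: "0 < d" "ball x d \<subseteq> S"
    using openE[OF S x] by blast
  have Hessian: "0 \<le> (H x i - (2 * e) *\<^sub>R i) \<bullet> i" for i
  proof (rule Hessian_nonneg_at_min[OF d(1), where k=k and D="\<lambda>y. D y - (2 * e) *\<^sub>R (y - a)"])
    fix y assume "y \<in> ball x d"
    then have y: "y \<in> S" using d(2) by blast
    show "(k has_derivative (\<lambda>v. (D y - (2 * e) *\<^sub>R (y - a)) \<bullet> v)) (at y)"
      unfolding k_def[abs_def]
      by (auto intro!: derivative_eq_intros D(1)[OF y] simp: inner_diff_left inner_commute algebra_simps)
    show "k x \<le> k y" by (rule min[OF y])
  next
    show "((\<lambda>y. D y - (2 * e) *\<^sub>R (y - a)) has_derivative (\<lambda>i. H x i - (2 * e) *\<^sub>R i)) (at x)"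
      by (auto intro!: derivative_eq_intros D(2)[OF x])
  qed
  have "2 * e \<le> H x i \<bullet> i" if "i \<in> Basis" for i
    using Hessian[of i] that by (simp add: inner_diff_left)
  then have "(\<Sum>i\<in>(Basis::'a set). 2 * e) \<le> (\<Sum>i\<in>Basis. H x i \<bullet> i)"
    by (rule sum_mono)
  then have "real DIM('a) * (2 * e) \<le> 0"
    using D(3)[OF x] by simp
  then show False using e DIM_positive[where 'a='a] by (simp add: mult_le_0_iff)
qed

lemma harmonic_on_min_principle:
  fixes h :: "'a::euclidean_space \<Rightarrow> real"
  assumes r: "0 < r" and cont: "continuous_on (cball a r) h" and harm: "harmonic_on h (ball a r)"
    and sphere: "\<And>y. y \<in> sphere a r \<Longrightarrow> 0 \<le> h y" and y0: "y0 \<in> ball a r"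
  shows "0 \<le> h y0"
proof (rule ccontr)
  assume neg: "\<not> 0 \<le> h y0"
  define e where "e = - h y0 / (2 * r\<^sup>2)"
  have e: "0 < e" "e * r\<^sup>2 < - h y0"
    using neg r by (auto simp: e_def field_simps)
  define k where "k y = h y - e * ((y - a) \<bullet> (y - a))" for y
  have "continuous_on (cball a r) k"
    unfolding k_def[abs_def] by (intro continuous_intros cont)
  then obtain y1 where y1: "y1 \<in> cball a r" "\<And>y. y \<in> cball a r \<Longrightarrow> k y1 \<le> k y"
    using continuous_attains_inf[of "cball a r" k] r by auto
  have "k y1 \<le> k y0" using y1(2)[of y0] y0 by simp
  also have "k y0 \<le> h y0" using e(1) by (simp add: k_def)
  finally have "k y1 < - (e * r\<^sup>2)" using e(2) by simp
  moreover have "- (e * r\<^sup>2) \<le> k y" if "y \<in> sphere a r" for y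
  proof -
    have "(y - a) \<bullet> (y - a) = r\<^sup>2"
      using that by (simp add: dot_square_norm dist_norm norm_minus_commute)
    then show ?thesis using sphere[OF that] by (simp add: k_def)
  qed
  ultimately have "y1 \<notin> sphere a r" by force
  then have "y1 \<in> ball a r" using y1(1) by simp
  then obtain y where "y \<in> ball a r" "k y < k y1"
    using harmonic_on_minus_sqnorm_no_min[OF open_ball harm e(1)] unfolding k_def by blast
  then show False using y1(2)[of y] by simp
qed

lemma subharmonic_on_zero: "subharmonic_on (\<lambda>_. 0) (U :: 'a::euclidean_space set)"
  unfolding subharmonic_on_def
proof (intro conjI allI impI ballI continuous_on_const)
  fix a :: 'a and r h y
  assume "0 < r \<and> cball a r \<subseteq> U \<and> continuous_on (cball a r) h \<and> harmonic_on h (ball a r) \<and>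
      (\<forall>y\<in>sphere a r. 0 \<le> h y)" and y: "y \<in> ball a r"
  then show "0 \<le> h y"
    using harmonic_on_min_principle[OF _ _ _ _ y, of h] by simp
qed

lemma exists_maximizer_of_maximal_norm:
  fixes w :: "'a::real_normed_vector \<Rightarrow> real"
  assumes S: "compact S" "S \<noteq> {}" and cont: "continuous_on S w"
  obtains a where "a \<in> S" "\<And>y. y \<in> S \<Longrightarrow> w y \<le> w a" "\<And>y. y \<in> S \<Longrightarrow> w y = w a \<Longrightarrow> norm y \<le> norm a"
proof -
  obtain m where m: "m \<in> S" "\<And>y. y \<in> S \<Longrightarrow> w y \<le> w m"
    using continuous_attains_sup[OF S cont] by blast
  have "closedin (top_of_set S) (S \<inter> w -` {w m})"
    using cont by (rule continuous_closedin_preimage) simp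
  then have "compact (S \<inter> w -` {w m})"
    by (rule closedin_compact[OF S(1)])
  moreover have "S \<inter> w -` {w m} \<noteq> {}" using m(1) by blast
  ultimately obtain a where "a \<in> S \<inter> w -` {w m}" "\<And>y. y \<in> S \<inter> w -` {w m} \<Longrightarrow> norm y \<le> norm a"
    using continuous_attains_sup[of "S \<inter> w -` {w m}" norm] continuous_on_norm_id by blast
  then show ?thesis using that[of a] m(2) by auto
qed

lemma exists_strict_upper_bound_on_compact:
  fixes w :: "'a::topological_space \<Rightarrow> real"
  assumes T: "compact T" "continuous_on T w" and less: "\<And>y. y \<in> T \<Longrightarrow> w y < m"
  obtains m' where "m' < m" "\<And>y. y \<in> T \<Longrightarrow> w y \<le> m'"
proof (cases "T = {}")
  case True
  then show ?thesis using that[of "m - 1"] by auto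
next
  case False
  then show ?thesis using continuous_attains_sup[OF T(1) False T(2)] less that by blast
qed

lemma inner_le_of_sphere_norm_le:
  fixes a y :: "'a::real_inner"
  assumes "y \<in> sphere a r" "norm y \<le> norm a"
  shows "2 * (a \<bullet> (y - a)) \<le> - (r\<^sup>2)"
proof -
  have "(y - a) \<bullet> (y - a) = r\<^sup>2"
    using assms(1) by (simp add: dot_square_norm dist_norm norm_minus_commute)
  moreover have "y \<bullet> y \<le> a \<bullet> a" using assms(2) by (simp add: norm_le)
  ultimately show ?thesis
    by (simp add: inner_diff_left inner_diff_right inner_commute)
qed

context
  fixes w :: "'a::euclidean_space \<Rightarrow> real" and a :: 'a and r :: real
  assumes r: "0 < r" and cont: "continuous_on (sphere a r) w"
    and max: "\<And>y. y \<in> sphere a r \<Longrightarrow> w y \<le> w a"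
    and norm_max: "\<And>y. y \<in> sphere a r \<Longrightarrow> w y = w a \<Longrightarrow> norm y \<le> norm a"
begin

text \<open>
  The points of the sphere where \<open>w y = w a\<close> lie in the ball of radius \<open>norm a\<close> around the origin,
  so that a hyperplane separates them from \<open>a\<close>.
\<close>

lemma strict_upper_bound_beyond_hyperplane:
  obtains m where "m < w a" "\<And>y. y \<in> sphere a r \<Longrightarrow> - (r\<^sup>2 / 4) \<le> a \<bullet> (y - a) \<Longrightarrow> w y \<le> m"
proof -
  define T where "T = sphere a r \<inter> {y. - (r\<^sup>2 / 4) \<le> a \<bullet> (y - a)}"
  have "w y < w a" if "y \<in> T" for y
  proof (rule ccontr)
    have y: "y \<in> sphere a r" "- (r\<^sup>2 / 4) \<le> a \<bullet> (y - a)" using that by (auto simp: T_def)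
    assume "\<not> w y < w a"
    then have "norm y \<le> norm a" using max[OF y(1)] norm_max[OF y(1)] by linarith
    then have "2 * (a \<bullet> (y - a)) \<le> - (r\<^sup>2)" by (rule inner_le_of_sphere_norm_le[OF y(1)])
    moreover have "0 < r\<^sup>2" using r by simp
    ultimately show False using y(2) by linarith
  qed
  moreover have "closed {y. - (r\<^sup>2 / 4) \<le> a \<bullet> (y - a)}"
    by (intro closed_Collect_le continuous_intros)
  then have "compact T" unfolding T_def by (intro compact_Int_closed) auto
  moreover have "continuous_on T w"
    using cont by (rule continuous_on_subset) (simp add: T_def)
  ultimately obtain m where "m < w a" "\<And>y. y \<in> T \<Longrightarrow> w y \<le> m"
    using exists_strict_upper_bound_on_compact by metis
  then show ?thesis using that by (simp add: T_def)
qed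

lemma affine_majorant_on_sphere:
  obtains c l where "\<And>y. y \<in> sphere a r \<Longrightarrow> w y \<le> c + l \<bullet> y" "c + l \<bullet> a < w a"
proof -
  obtain m where m: "m < w a" "\<And>y. y \<in> sphere a r \<Longrightarrow> - (r\<^sup>2 / 4) \<le> a \<bullet> (y - a) \<Longrightarrow> w y \<le> m"
    using strict_upper_bound_beyond_hyperplane by blast
  define q where "q y = - (a \<bullet> (y - a)) - r\<^sup>2 / 4" for y
  define Q where "Q = norm a * r + r\<^sup>2 / 4"
  have Q: "0 < Q" using r by (simp add: Q_def add_nonneg_pos)
  have q_ge: "- Q \<le> q y" if "y \<in> sphere a r" for y
    using that Cauchy_Schwarz_ineq2[of a "y - a"]
    by (simp add: q_def Q_def dist_norm norm_minus_commute)
  define \<delta> where "\<delta> = (w a - m) / Q"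
  have \<delta>: "0 < \<delta>" "\<delta> * Q = w a - m" using m(1) Q by (auto simp: \<delta>_def)
  have affine: "(w a + \<delta> * (a \<bullet> a - r\<^sup>2 / 4)) + (- \<delta> *\<^sub>R a) \<bullet> y = w a + \<delta> * q y" for y
    by (simp add: q_def inner_diff_right algebra_simps)
  show ?thesis
  proof (rule that[of "w a + \<delta> * (a \<bullet> a - r\<^sup>2 / 4)" "- \<delta> *\<^sub>R a"])
    show "w y \<le> (w a + \<delta> * (a \<bullet> a - r\<^sup>2 / 4)) + (- \<delta> *\<^sub>R a) \<bullet> y" if y: "y \<in> sphere a r" for y
    proof (cases "q y \<le> 0")
      case True
      then have "w y \<le> m" by (intro m(2) y) (simp add: q_def)
      moreover have "\<delta> * (- Q) \<le> \<delta> * q y" using q_ge[OF y] \<delta>(1) by (intro mult_left_mono) auto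
      ultimately show ?thesis unfolding affine using \<delta>(2) by simp
    next
      case False
      then have "0 \<le> \<delta> * q y" using \<delta>(1) by simp
      then show ?thesis unfolding affine using max[OF y] by simp
    qed
    show "(w a + \<delta> * (a \<bullet> a - r\<^sup>2 / 4)) + (- \<delta> *\<^sub>R a) \<bullet> a < w a"
      unfolding affine using \<delta>(1) r by (simp add: q_def mult_pos_neg)
  qed
qed

end

lemma affine_maximum_principle:
  fixes w :: "'a::euclidean_space \<Rightarrow> real"
  assumes S: "open S" "bounded S" and cont: "continuous_on (closure S) w"
    and affine: "\<And>a r c l. 0 < r \<Longrightarrow> cball a r \<subseteq> S \<Longrightarrow> (\<And>y. y \<in> sphere a r \<Longrightarrow> w y \<le> c + l \<bullet> y) \<Longrightarrow>
      w a \<le> c + l \<bullet> a"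
    and frontier: "\<And>z. z \<in> frontier S \<Longrightarrow> w z \<le> 0" and y: "y \<in> S"
  shows "w y \<le> 0"
proof -
  have "compact (closure S)" "closure S \<noteq> {}"
    using S(2) y by (auto simp: compact_closure)
  then obtain a where a: "a \<in> closure S" "\<And>y. y \<in> closure S \<Longrightarrow> w y \<le> w a"
    "\<And>y. y \<in> closure S \<Longrightarrow> w y = w a \<Longrightarrow> norm y \<le> norm a"
    using exists_maximizer_of_maximal_norm[OF _ _ cont] by blast
  have "a \<notin> S"
  proof
    assume "a \<in> S"
    then obtain r where r: "0 < r" "cball a r \<subseteq> S"
      using S(1) open_contains_cball by blast
    have sphere: "sphere a r \<subseteq> closure S"
      using r(2) closure_subset[of S] by (force simp: subset_iff)
    then obtain c l where "\<And>y. y \<in> sphere a r \<Longrightarrow> w y \<le> c + l \<bullet> y" "c + l \<bullet> a < w a"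
      using affine_majorant_on_sphere[OF r(1) continuous_on_subset[OF cont sphere]] a(2,3)
      by blast
    then show False using affine[OF r, of c l] by fastforce
  qed
  then have "w a \<le> 0"
    using a(1) S(1) frontier by (simp add: frontier_def interior_open)
  then show ?thesis using a(2) y closure_subset by (meson order_trans subsetD)
qed

lemma subharmonic_le_harmonic:
  fixes v h :: "'a::euclidean_space \<Rightarrow> real"
  assumes S: "open S" "bounded S" and v: "continuous_on (closure S) v" "subharmonic_on v S"
    and h: "continuous_on (closure S) h" "harmonic_on h S"
    and frontier: "\<And>z. z \<in> frontier S \<Longrightarrow> v z \<le> h z" and y: "y \<in> S"
  shows "v y \<le> h y"
proof -
  have "v y - h y \<le> 0"
  proof (rule affine_maximum_principle[OF S _ _ _ y])
    show "continuous_on (closure S) (\<lambda>y. v y - h y)"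
      by (intro continuous_on_diff v h)
    show "v z - h z \<le> 0" if "z \<in> frontier S" for z using frontier[OF that] by simp
    fix a r c l
    assume r: "0 < r" "cball a r \<subseteq> S" and le: "\<And>y. y \<in> sphere a r \<Longrightarrow> v y - h y \<le> c + l \<bullet> y"
    have "continuous_on (cball a r) (\<lambda>y. h y + (c + l \<bullet> y))"
      using r(2) closure_subset by (intro continuous_intros continuous_on_subset[OF h(1)]) blast
    moreover have "harmonic_on (\<lambda>y. h y + (c + l \<bullet> y)) (ball a r)"
      using r(2) by (intro harmonic_on_add harmonic_on_affine harmonic_on_subset[OF h(2)]) auto
    moreover have "\<forall>y\<in>sphere a r. v y \<le> h y + (c + l \<bullet> y)"
      using le by (force simp del: mem_sphere)
    ultimately have "\<forall>y\<in>ball a r. v y \<le> h y + (c + l \<bullet> y)"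
      using v(2) r unfolding subharmonic_on_def by blast
    then have "v a \<le> h a + (c + l \<bullet> a)" using r(1) by simp
    then show "v a - h a \<le> c + l \<bullet> a" by simp
  qed
  then show ?thesis by simp
qed

subsection \<open>The Green function\<close>

definition fundamental_constant :: "'a::euclidean_space itself \<Rightarrow> real" where
  "fundamental_constant _ = 1 / (real DIM('a) * measure lborel (ball (0::'a) 1) * real (DIM('a) - 2))"

lemma fundamental_solution_eq:
  fixes z :: "'a::euclidean_space"
  shows "fundamental_solution z = fundamental_constant TYPE('a) * (1 / norm z ^ (DIM('a) - 2))"
  by (simp add: fundamental_solution_def fundamental_constant_def)

lemma fundamental_solution_nonneg: "0 \<le> fundamental_solution z"
  by (simp add: fundamental_solution_def)

lemma continuous_on_fundamental_solution:
  fixes x :: "'a::euclidean_space"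
  assumes "x \<notin> S"
  shows "continuous_on S (\<lambda>y. fundamental_solution (x - y))"
  unfolding fundamental_solution_def using assms by (intro continuous_intros) auto

lemma fundamental_constant_pos:
  assumes "3 \<le> DIM('a::euclidean_space)"
  shows "0 < fundamental_constant TYPE('a)"
  using assms content_ball_pos[of 1 "0::'a"] by (simp add: fundamental_constant_def)

lemma harmonic_on_fundamental_solution:
  fixes x :: "'a::euclidean_space"
  assumes dim: "3 \<le> DIM('a)" and x: "x \<notin> S"
  shows "harmonic_on (\<lambda>y. fundamental_solution (x - y)) S"
proof -
  have "1 / norm (x - y) ^ (DIM('a) - 2) = ((y - x) \<bullet> (y - x)) powr (1 - real DIM('a) / 2)" for y
  proof (cases "y = x")
    case True
    then show ?thesis using dim by (simp add: zero_power)
  next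
    case False
    then have pos: "0 < norm (y - x)" by simp
    have "((y - x) \<bullet> (y - x)) powr (1 - real DIM('a) / 2)
        = (norm (y - x) powr 2) powr (1 - real DIM('a) / 2)"
      using pos by (simp add: dot_square_norm)
    also have "\<dots> = norm (y - x) powr (- real (DIM('a) - 2))"
      unfolding powr_powr using dim by (simp add: of_nat_diff algebra_simps)
    also have "\<dots> = 1 / norm (x - y) ^ (DIM('a) - 2)"
      using pos by (simp add: powr_minus_divide powr_realpow norm_minus_commute)
    finally show ?thesis by simp
  qed
  then show ?thesis
    unfolding fundamental_solution_eq
    using harmonic_on_cmult[OF harmonic_on_sqnorm_powr[OF x]] by simp
qed

lemma fundamental_solution_large_near_zero:
  assumes dim: "3 \<le> DIM('a::euclidean_space)" and R: "0 < R"
  obtains \<rho> where "0 < \<rho>" "\<rho> < R" "\<And>z::'a. norm z = \<rho> \<Longrightarrow> B \<le> fundamental_solution z"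
proof -
  define C where "C = fundamental_constant TYPE('a)"
  have C: "0 < C" using fundamental_constant_pos[OF dim] by (simp add: C_def)
  define \<rho> where "\<rho> = min (min (R / 2) 1) (C / (\<bar>B\<bar> + 1))"
  have "0 < C / (\<bar>B\<bar> + 1)" using C by (simp add: add_nonneg_pos)
  then have \<rho>: "0 < \<rho>" "\<rho> < R" "\<rho> \<le> 1" "\<rho> \<le> C / (\<bar>B\<bar> + 1)"
    using R unfolding \<rho>_def by linarith+
  have "B \<le> fundamental_solution z" if z: "norm z = \<rho>" for z :: 'a
  proof -
    have power: "\<rho> ^ (DIM('a) - 2) \<le> \<rho> ^ 1"
      using \<rho> dim by (intro power_decreasing) auto
    have "\<bar>B\<bar> + 1 \<le> C * (1 / \<rho>)"
      using \<rho>(1,4) by (simp add: field_simps)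
    also have "C * (1 / \<rho>) \<le> fundamental_solution z"
      unfolding fundamental_solution_eq z C_def[symmetric]
      using C \<rho>(1) power by (intro mult_left_mono divide_left_mono) auto
    finally show ?thesis by simp
  qed
  then show ?thesis using that \<rho> by blast
qed

lemma nn_integral_lborel_norm_diff:
  fixes x :: "'a::euclidean_space" and g :: "real \<Rightarrow> ennreal"
  assumes [measurable]: "g \<in> borel_measurable borel"
  shows "(\<integral>\<^sup>+y. g (norm (x - y)) \<partial>lborel) = (\<integral>\<^sup>+z. g (norm z) \<partial>(lborel :: 'a measure))"
proof -
  have "(\<integral>\<^sup>+z. g (norm z) \<partial>(lborel :: 'a measure)) = (\<integral>\<^sup>+z. g (norm z) \<partial>distr lborel borel ((+) (- x)))"
    by (simp only: lborel_distr_plus)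
  also have "\<dots> = (\<integral>\<^sup>+y. g (norm (- x + y)) \<partial>lborel)"
    by (rule nn_integral_distr) auto
  finally show ?thesis by (simp add: norm_minus_commute)
qed

lemma inverse_power_eq_tail_integral:
  fixes s d :: real
  assumes "0 < s" "s \<le> d"
  shows "ennreal (1 / s ^ m) = ennreal (1 / d ^ m)
    + (\<integral>\<^sup>+r. ennreal (real m / r ^ (m + 1)) * indicator {s..d} r \<partial>lborel)"
proof -
  have "(\<integral>\<^sup>+r. ennreal (real m / r ^ (m + 1)) * indicator {s..d} r \<partial>lborel)
      = ennreal ((- 1 / d ^ m) - (- 1 / s ^ m))"
  proof (rule nn_integral_FTC_Icc[where F = "\<lambda>r. - 1 / r ^ m" and f = "\<lambda>r. real m / r ^ (m + 1)"])
    fix r assume "r \<in> {s..d}"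
    then have r: "s \<le> r" "r \<le> d" by auto
    then have "r \<noteq> 0" using assms by auto
    then have "((\<lambda>r. - 1 / r ^ m) has_real_derivative
        - (0 * r ^ m - 1 * (real m * r ^ (m - 1))) / (r ^ m * r ^ m) * 1) (at r)"
      by (auto intro!: derivative_eq_intros)
    moreover have "- (0 * r ^ m - 1 * (real m * r ^ (m - 1))) / (r ^ m * r ^ m) * 1 = real m / r ^ (m + 1)"
      using \<open>r \<noteq> 0\<close> by (cases m) (auto simp: field_simps)
    ultimately show "((\<lambda>r. - 1 / r ^ m) has_real_derivative real m / r ^ (m + 1)) (at r)"
      by simp
    show "0 \<le> real m / r ^ (m + 1)" using r assms by auto
  qed (use assms in auto)
  moreover have "1 / d ^ m \<le> 1 / s ^ m"
    using assms by (intro divide_left_mono power_mono) auto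
  ultimately show ?thesis
    using assms by (simp add: ennreal_plus[symmetric] del: ennreal_plus)
qed

lemma
  fixes w :: "real \<Rightarrow> ennreal"
  assumes [measurable]: "w \<in> borel_measurable borel"
  shows borel_measurable_norm_tail:
      "(\<lambda>z::'a::euclidean_space. \<integral>\<^sup>+r. w r * indicator {norm z..d} r \<partial>lborel) \<in> borel_measurable lborel"
    and nn_integral_norm_tail:
      "(\<integral>\<^sup>+z. (\<integral>\<^sup>+r. w r * indicator {norm z..d} r \<partial>lborel) \<partial>(lborel :: 'a measure))
        = (\<integral>\<^sup>+r. w r * emeasure lborel (cball (0::'a) r) * indicator {..d} r \<partial>lborel)"
proof -
  define k :: "'a \<Rightarrow> real \<Rightarrow> ennreal" where "k z r = (if norm z \<le> r \<and> r \<le> d then w r else 0)" for z r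
  have k_measurable: "(\<lambda>(z, r). k z r) \<in> borel_measurable (lborel \<Otimes>\<^sub>M lborel)"
    unfolding k_def by measurable
  have tail: "(\<integral>\<^sup>+r. w r * indicator {norm z..d} r \<partial>lborel) = (\<integral>\<^sup>+r. k z r \<partial>lborel)" for z
    by (intro nn_integral_cong) (auto simp: k_def indicator_def)
  show "(\<lambda>z::'a. \<integral>\<^sup>+r. w r * indicator {norm z..d} r \<partial>lborel) \<in> borel_measurable lborel"
    unfolding tail by (rule lborel.borel_measurable_nn_integral[OF k_measurable])
  have "(\<integral>\<^sup>+z. k z r \<partial>lborel) = w r * emeasure lborel (cball (0::'a) r) * indicator {..d} r" for r
  proof -
    have "(\<integral>\<^sup>+z. k z r \<partial>lborel) = (\<integral>\<^sup>+z. (w r * indicator {..d} r) * indicator (cball (0::'a) r) z \<partial>lborel)"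
      by (intro nn_integral_cong) (auto simp: k_def indicator_def)
    also have "\<dots> = (w r * indicator {..d} r) * emeasure lborel (cball (0::'a) r)"
      by (rule nn_integral_cmult_indicator) simp
    finally show ?thesis by (simp add: mult_ac)
  qed
  then show "(\<integral>\<^sup>+z. (\<integral>\<^sup>+r. w r * indicator {norm z..d} r \<partial>lborel) \<partial>(lborel :: 'a measure))
      = (\<integral>\<^sup>+r. w r * emeasure lborel (cball (0::'a) r) * indicator {..d} r \<partial>lborel)"
    unfolding tail using lborel_pair.Fubini'[OF k_measurable] by simp
qed

lemma nn_integral_power_volume:
  fixes d :: real
  assumes dim: "DIM('a::euclidean_space) = m + k" "0 < k" and d: "0 \<le> d"
  shows "(\<integral>\<^sup>+r. ennreal (real m / r ^ (m + 1)) * emeasure lborel (cball (0::'a) r) * indicator {..d} r \<partial>lborel)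
    = ennreal (real m * unit_ball_vol (real DIM('a)) * d ^ k / real k)"
proof -
  define \<alpha> where "\<alpha> = unit_ball_vol (real DIM('a))"
  have \<alpha>: "0 \<le> \<alpha>" by (simp add: \<alpha>_def)
  have "(\<integral>\<^sup>+r. ennreal (real m / r ^ (m + 1)) * emeasure lborel (cball (0::'a) r) * indicator {..d} r \<partial>lborel)
      = (\<integral>\<^sup>+r. ennreal (real m * \<alpha> * r ^ (k - 1)) * indicator {0..d} r \<partial>lborel)"
  proof (rule nn_integral_cong_AE, use AE_lborel_singleton[of "0::real"] in eventually_elim)
    case (elim r)
    show ?case
    proof (cases "0 < r \<and> r \<le> d")
      case True
      have "emeasure lborel (cball (0::'a) r) = ennreal (\<alpha> * r ^ (m + k))"
        using True by (simp add: emeasure_cball \<alpha>_def dim(1))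
      then have "ennreal (real m / r ^ (m + 1)) * emeasure lborel (cball (0::'a) r)
          = ennreal (real m / r ^ (m + 1) * (\<alpha> * r ^ (m + k)))"
        using True \<alpha> by (simp only:) (intro ennreal_mult[symmetric], auto)
      also have "real m / r ^ (m + 1) * (\<alpha> * r ^ (m + k)) = real m * \<alpha> * r ^ (k - 1)"
        using True dim(2) by (cases k) (auto simp: power_add field_simps)
      finally show ?thesis using True by simp
    next
      case False
      then show ?thesis using elim by (auto simp: indicator_def)
    qed
  qed
  also have "\<dots> = ennreal (real m * \<alpha> * d ^ k / real k - real m * \<alpha> * 0 ^ k / real k)"
    using d \<alpha> dim(2) by (intro nn_integral_FTC_Icc[where F = "\<lambda>r. real m * \<alpha> * r ^ k / real k"])
      (auto intro!: derivative_eq_intros)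
  finally show ?thesis using dim(2) by (simp only: \<alpha>_def zero_power) simp
qed

lemma nn_integral_inverse_power_norm_cball:
  fixes d :: real
  assumes dim: "m < DIM('a::euclidean_space)" and d: "0 < d"
  shows "(\<integral>\<^sup>+z\<in>cball (0::'a) d. ennreal (1 / norm z ^ m) \<partial>lborel)
    = ennreal (real DIM('a) * unit_ball_vol (real DIM('a)) * d ^ (DIM('a) - m) / real (DIM('a) - m))"
proof -
  define k where "k = DIM('a) - m"
  have k: "DIM('a) = m + k" "0 < k" using dim by (auto simp: k_def)
  define \<alpha> where "\<alpha> = unit_ball_vol (real DIM('a))"
  have \<alpha>: "0 \<le> \<alpha>" by (simp add: \<alpha>_def)
  have [measurable]: "cball (0::'a) d \<in> sets borel" by simp
  let ?tail = "\<lambda>z::'a. \<integral>\<^sup>+r. ennreal (real m / r ^ (m + 1)) * indicator {norm z..d} r \<partial>lborel"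
  have "(\<integral>\<^sup>+z\<in>cball (0::'a) d. ennreal (1 / norm z ^ m) \<partial>lborel)
      = (\<integral>\<^sup>+z. ennreal (1 / d ^ m) * indicator (cball 0 d) z + ?tail z \<partial>lborel)"
  proof (rule nn_integral_cong_AE, use AE_lborel_singleton[of "0::'a"] in eventually_elim)
    case (elim z)
    then show ?case
      using inverse_power_eq_tail_integral[of "norm z" d m] by (cases "norm z \<le> d") auto
  qed
  also have "\<dots> = ennreal (1 / d ^ m) * emeasure lborel (cball (0::'a) d) + (\<integral>\<^sup>+z. ?tail z \<partial>lborel)"
    by (subst nn_integral_add[OF _ borel_measurable_norm_tail]) (auto simp: nn_integral_cmult_indicator)
  also have "(\<integral>\<^sup>+z. ?tail z \<partial>lborel) = ennreal (real m * \<alpha> * d ^ k / real k)"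
    using nn_integral_norm_tail[of "\<lambda>r. ennreal (real m / r ^ (m + 1))" d, where 'a='a]
      nn_integral_power_volume[OF k, of d] d by (simp add: \<alpha>_def)
  also have "ennreal (1 / d ^ m) * emeasure lborel (cball (0::'a) d) = ennreal (\<alpha> * d ^ k)"
    using d \<alpha> by (simp add: emeasure_cball \<alpha>_def k(1) ennreal_mult[symmetric] power_add)
  also have "ennreal (\<alpha> * d ^ k) + ennreal (real m * \<alpha> * d ^ k / real k)
      = ennreal (\<alpha> * d ^ k + real m * \<alpha> * d ^ k / real k)"
    using \<alpha> d by (intro ennreal_plus[symmetric]) auto
  also have "\<alpha> * d ^ k + real m * \<alpha> * d ^ k / real k = real DIM('a) * \<alpha> * d ^ k / real k"
    using k by (simp add: field_simps)
  finally show ?thesis by (simp only: \<alpha>_def k_def)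
qed

lemma borel_measurable_cSUP_continuous:
  fixes F :: "('a::topological_space \<Rightarrow> real) set"
  assumes S: "open S" and F: "F \<noteq> {}" "\<And>v. v \<in> F \<Longrightarrow> continuous_on S v"
    and bdd: "\<And>y. y \<in> S \<Longrightarrow> bdd_above ((\<lambda>v. v y) ` F)"
  shows "(\<lambda>y. SUP v\<in>F. v y) \<in> borel_measurable (restrict_space borel S)"
proof (rule borel_measurable_iff_greater[THEN iffD2], rule allI)
  fix t :: real
  have "{y \<in> S. t < (SUP v\<in>F. v y)} = (\<Union>v\<in>F. S \<inter> v -` {t<..})"
    using less_cSUP_iff[OF F(1) bdd] by auto
  moreover have "open (\<Union>v\<in>F. S \<inter> v -` {t<..})"
    using S F(2) by (intro open_UN ballI continuous_open_preimage) auto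
  ultimately show "{y \<in> space (restrict_space borel S). t < (SUP v\<in>F. v y)} \<in> sets (restrict_space borel S)"
    using S by (auto simp: sets_restrict_space_iff space_restrict_space)
qed

lemma borel_measurable_restrict_imp_lebesgue_on:
  assumes "f \<in> borel_measurable (restrict_space borel U)"
  shows "f \<in> borel_measurable (lebesgue_on U)"
proof -
  have "sets borel \<subseteq> sets (lebesgue :: 'a measure)"
    by (auto intro: sets_completionI_sets)
  then have "sets (restrict_space borel U) \<subseteq> sets (lebesgue_on U)"
    unfolding sets_restrict_space by (rule image_mono)
  then have "borel_measurable (restrict_space borel U) \<subseteq> borel_measurable (lebesgue_on U)"
    by (intro measurable_mono) (simp_all add: space_restrict_space)
  then show ?thesis using assms by blast
qed

definition perron_class :: "'a::euclidean_space set \<Rightarrow> ('a \<Rightarrow> real) \<Rightarrow> ('a \<Rightarrow> real) set" where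
  "perron_class U \<phi> = {v. continuous_on (closure U) v \<and> subharmonic_on v U \<and> (\<forall>z\<in>frontier U. v z \<le> \<phi> z)}"

lemma perron_solution_eq_SUP: "perron_solution U \<phi> y = (SUP v\<in>perron_class U \<phi>. v y)"
  unfolding perron_solution_def perron_class_def by (simp only: setcompr_eq_image)

lemma zero_in_perron_class: "(\<And>z. z \<in> frontier U \<Longrightarrow> 0 \<le> \<phi> z) \<Longrightarrow> (\<lambda>_. 0) \<in> perron_class U \<phi>"
  by (simp add: perron_class_def subharmonic_on_zero)

locale dirichlet_domain =
  fixes U :: "'a::euclidean_space set"
  assumes dim: "3 \<le> DIM('a)" and open_U: "open U" and bounded_U: "bounded U"
begin

lemma perron_class_le_fundamental_solution:
  assumes v: "v \<in> perron_class U (\<lambda>z. fundamental_solution (x - z))" and y: "y \<in> U" "y \<noteq> x"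
  shows "v y \<le> fundamental_solution (x - y)"
proof -
  have v: "continuous_on (closure U) v" "subharmonic_on v U"
    "\<And>z. z \<in> frontier U \<Longrightarrow> v z \<le> fundamental_solution (x - z)"
    using v by (auto simp: perron_class_def)
  have "compact (closure U)" using bounded_U by (simp add: compact_closure)
  then obtain B where B: "\<And>z. z \<in> closure U \<Longrightarrow> v z \<le> B"
    using continuous_attains_sup[OF _ _ v(1)] y(1) closure_subset by blast
  obtain \<rho> where \<rho>: "0 < \<rho>" "\<rho> < dist x y" "\<And>z::'a. norm z = \<rho> \<Longrightarrow> B \<le> fundamental_solution z"
    using fundamental_solution_large_near_zero[OF dim, of "dist x y"] y(2) by auto
  define S where "S = U - cball x \<rho>"
  have openS: "open S" using open_U by (simp add: S_def open_Diff)
  have "closure S \<subseteq> closure U" unfolding S_def by (intro closure_mono) auto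
  moreover have "closure S \<subseteq> - ball x \<rho>" by (rule closure_minimal) (auto simp: S_def)
  ultimately have closureS: "closure S \<subseteq> closure U - ball x \<rho>" by blast
  then have xS: "x \<notin> closure S" using \<rho>(1) by auto
  show ?thesis
  proof (rule subharmonic_le_harmonic[where v=v and h="\<lambda>y. fundamental_solution (x - y)", OF openS])
    show "bounded S" using bounded_U by (rule bounded_subset) (auto simp: S_def)
    show "continuous_on (closure S) v" using closureS by (intro continuous_on_subset[OF v(1)]) blast
    show "subharmonic_on v S"
      using v(2) continuous_on_subset[of U v S] unfolding subharmonic_on_def S_def by blast
    show "continuous_on (closure S) (\<lambda>y. fundamental_solution (x - y))"
      by (rule continuous_on_fundamental_solution[OF xS])
    show "harmonic_on (\<lambda>y. fundamental_solution (x - y)) S"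
      using xS closure_subset[of S] by (intro harmonic_on_fundamental_solution dim) blast
    show "y \<in> S" using y \<rho>(2) by (simp add: S_def)
    show "v z \<le> fundamental_solution (x - z)" if z: "z \<in> frontier S" for z
    proof (cases "z \<in> U")
      case True
      then have "norm (x - z) = \<rho>"
        using z closureS openS by (auto simp: frontier_def interior_open S_def dist_norm)
      then show ?thesis using \<rho>(3) B[of z] True closure_subset by fastforce
    next
      case False
      then have "z \<in> frontier U"
        using z closureS open_U by (auto simp: frontier_def interior_open)
      then show ?thesis by (rule v(3))
    qed
  qed
qed

lemma zero_in_fundamental_perron_class: "(\<lambda>_. 0) \<in> perron_class U (\<lambda>z. fundamental_solution (x - z))"
  by (intro zero_in_perron_class fundamental_solution_nonneg)

lemma bdd_above_perron_class:
  "y \<in> U \<Longrightarrow> y \<noteq> x \<Longrightarrow> bdd_above ((\<lambda>v. v y) ` perron_class U (\<lambda>z. fundamental_solution (x - z)))"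
  using perron_class_le_fundamental_solution
  by (intro bdd_aboveI2[where M="fundamental_solution (x - y)"])

lemma green_nonneg:
  assumes "y \<in> U" "y \<noteq> x"
  shows "0 \<le> green U x y"
proof -
  have "(SUP v\<in>perron_class U (\<lambda>z. fundamental_solution (x - z)). v y) \<le> fundamental_solution (x - y)"
    using zero_in_fundamental_perron_class perron_class_le_fundamental_solution[OF _ assms]
    by (intro cSUP_least) auto
  then show ?thesis by (simp add: green_def perron_solution_eq_SUP)
qed

lemma green_le_fundamental_solution:
  assumes "y \<in> U" "y \<noteq> x"
  shows "green U x y \<le> fundamental_solution (x - y)"
proof -
  have "(\<lambda>_. 0) y \<le> (SUP v\<in>perron_class U (\<lambda>z. fundamental_solution (x - z)). v y)"
    by (rule cSUP_upper[OF zero_in_fundamental_perron_class bdd_above_perron_class[OF assms]])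
  then show ?thesis by (simp add: green_def perron_solution_eq_SUP)
qed

lemma green_measurable: "green U x \<in> borel_measurable (lebesgue_on U)"
proof (rule borel_measurable_restrict_imp_lebesgue_on)
  let ?F = "perron_class U (\<lambda>z. fundamental_solution (x - z))"
  have "(\<lambda>y. SUP v\<in>?F. v y) \<in> borel_measurable (restrict_space borel (U - {x}))"
  proof (rule borel_measurable_cSUP_continuous)
    show "?F \<noteq> {}" using zero_in_fundamental_perron_class by blast
    show "continuous_on (U - {x}) v" if "v \<in> ?F" for v
      using that closure_subset[of U] by (auto simp: perron_class_def intro: continuous_on_subset)
  qed (use open_U bdd_above_perron_class in auto)
  moreover have "(\<lambda>y. fundamental_solution (x - y)) \<in> borel_measurable (restrict_space borel (U - {x}))"
    by (rule measurable_restrict_space1) (simp add: fundamental_solution_def)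
  ultimately have "green U x \<in> borel_measurable (restrict_space borel (U - {x}))"
    unfolding green_def[abs_def] perron_solution_eq_SUP by (intro borel_measurable_diff)
  moreover have "restrict_space (restrict_space borel U) (- {x}) = restrict_space borel (U - {x})"
    using open_U by (subst restrict_restrict_space) (auto simp: Diff_eq)
  ultimately have off_x: "green U x \<in> borel_measurable (restrict_space (restrict_space borel U) (- {x}))"
    by simp
  show "green U x \<in> borel_measurable (restrict_space borel U)"
  proof (cases "x \<in> U")
    case True
    show ?thesis
    proof (rule measurable_restrict_countable[of "{x}", OF _ _ _ off_x])
      show "{z} \<in> sets (restrict_space borel U)" if "z \<in> {x}" for z
        using that True open_U by (simp add: sets_restrict_space_iff)
    qed simp_all
  next
    case False
    then show ?thesis using \<open>green U x \<in> borel_measurable (restrict_space borel (U - {x}))\<close> by simp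
  qed
qed

lemma AE_in_punctured_domain: "AE y in lebesgue_on U. y \<in> U \<and> y \<noteq> x"
proof -
  have "AE y in lebesgue. y \<noteq> x"
    by (rule AE_completion) (rule AE_lborel_singleton)
  then show ?thesis using open_U by (auto simp: AE_restrict_space_iff)
qed

lemma AE_green_nonneg: "AE y in lebesgue_on U. 0 \<le> green U x y"
  using AE_in_punctured_domain by eventually_elim (auto intro: green_nonneg)

lemma AE_abs_green_mult_le:
  assumes "\<phi> \<in> Linf U"
  shows "AE y in lebesgue_on U. \<bar>green U x y * \<phi> y\<bar> \<le> green U x y * Linf_norm U \<phi>"
  using AE_green_nonneg[of x] AE_abs_le_Linf_norm[OF assms]
  by eventually_elim (auto simp: abs_mult intro: mult_left_mono)

context
  fixes x assumes x: "x \<in> U"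
begin

lemma diameter_pos: "0 < diameter U"
proof -
  obtain r where r: "0 < r" "cball x r \<subseteq> U"
    using open_U x open_contains_cball by blast
  then have "diameter (cball x r) \<le> diameter U"
    using bounded_U by (intro diameter_subset)
  then show ?thesis using r(1) by simp
qed

lemma l0_pos: "0 < l0 U"
  using diameter_pos dim by (simp add: l0_def)

lemma nn_integral_fundamental_solution_le:
  "(\<integral>\<^sup>+y. ennreal (fundamental_solution (x - y)) \<partial>lebesgue_on U) \<le> ennreal (l0 U)"
proof -
  define C where "C = fundamental_constant TYPE('a)"
  have C: "0 < C" using fundamental_constant_pos[OF dim] by (simp add: C_def)
  define d where "d = diameter U"
  define \<alpha> where "\<alpha> = measure lborel (ball (0::'a) 1)"
  define g where "g t = ennreal (1 / t ^ (DIM('a) - 2)) * indicator {..d} t" for t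
  have [measurable]: "g \<in> borel_measurable borel" unfolding g_def by measurable
  have \<alpha>: "\<alpha> = unit_ball_vol (real DIM('a))" "0 < \<alpha>"
    by (auto simp: \<alpha>_def content_ball content_ball_pos)
  have "(\<integral>\<^sup>+y. ennreal (fundamental_solution (x - y)) \<partial>lebesgue_on U)
      = (\<integral>\<^sup>+y. ennreal (fundamental_solution (x - y)) * indicator U y \<partial>lborel)"
    using open_U by (simp add: nn_integral_restrict_space nn_integral_completion)
  also have "\<dots> \<le> (\<integral>\<^sup>+y. ennreal C * g (norm (x - y)) \<partial>lborel)"
  proof (rule nn_integral_mono)
    fix y
    have "y \<in> U \<Longrightarrow> norm (x - y) \<le> d"
      using diameter_bounded_bound[OF bounded_U x] by (simp add: d_def dist_norm)
    then show "ennreal (fundamental_solution (x - y)) * indicator U y \<le> ennreal C * g (norm (x - y))"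
      using C by (auto simp: fundamental_solution_eq C_def[symmetric] g_def ennreal_mult[symmetric]
          indicator_def)
  qed
  also have "\<dots> = ennreal C * (\<integral>\<^sup>+z. g (norm z) \<partial>(lborel :: 'a measure))"
    by (simp add: nn_integral_cmult nn_integral_lborel_norm_diff)
  also have "(\<integral>\<^sup>+z. g (norm z) \<partial>(lborel :: 'a measure))
      = (\<integral>\<^sup>+z\<in>cball (0::'a) d. ennreal (1 / norm z ^ (DIM('a) - 2)) \<partial>lborel)"
    by (intro nn_integral_cong) (simp add: g_def indicator_def)
  also have "\<dots> = ennreal (real DIM('a) * \<alpha> * d\<^sup>2 / 2)"
    using nn_integral_inverse_power_norm_cball[of "DIM('a) - 2" d, where 'a='a] dim diameter_pos
    by (simp add: \<alpha> d_def)
  also have "ennreal C * \<dots> = ennreal (C * (real DIM('a) * \<alpha> * d\<^sup>2 / 2))"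
    using C \<alpha>(2) by (intro ennreal_mult[symmetric]) auto
  also have "C * (real DIM('a) * \<alpha> * d\<^sup>2 / 2) = l0 U"
    using \<alpha>(2) dim
    by (simp add: C_def fundamental_constant_def \<alpha>_def[symmetric] l0_def d_def of_nat_diff field_simps)
  finally show ?thesis .
qed

lemma nn_integral_green_le: "(\<integral>\<^sup>+y. ennreal (green U x y) \<partial>lebesgue_on U) \<le> ennreal (l0 U)"
proof -
  have "AE y in lebesgue_on U. ennreal (green U x y) \<le> ennreal (fundamental_solution (x - y))"
    using AE_in_punctured_domain
    by eventually_elim (auto intro: ennreal_leI green_le_fundamental_solution)
  then show ?thesis
    by (rule order_trans[OF nn_integral_mono_AE nn_integral_fundamental_solution_le])
qed

lemma green_integrable: "integrable (lebesgue_on U) (green U x)"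
  using green_measurable AE_green_nonneg nn_integral_green_le
  by (intro integrableI_nonneg) (auto intro: le_less_trans)

lemma green_integral_le: "(\<integral>y. green U x y \<partial>lebesgue_on U) \<le> l0 U"
  using green_measurable AE_green_nonneg nn_integral_green_le l0_pos
  by (intro integral_real_bounded) auto

context
  fixes \<phi> assumes \<phi>: "\<phi> \<in> Linf U"
begin

lemma green_mult_integrable: "integrable (lebesgue_on U) (\<lambda>y. green U x y * \<phi> y)"
proof (rule Bochner_Integration.integrable_bound)
  show "integrable (lebesgue_on U) (\<lambda>y. green U x y * Linf_norm U \<phi>)"
    using green_integrable by simp
  show "(\<lambda>y. green U x y * \<phi> y) \<in> borel_measurable (lebesgue_on U)"
    by (intro borel_measurable_times green_measurable Linf_measurable \<phi>)
  show "AE y in lebesgue_on U. norm (green U x y * \<phi> y) \<le> norm (green U x y * Linf_norm U \<phi>)"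
    using AE_abs_green_mult_le[OF \<phi>, of x] by eventually_elim simp
qed

lemma abs_green_op_le: "\<bar>green_op U \<phi> x\<bar> \<le> l0 U * Linf_norm U \<phi>"
proof -
  have "\<bar>green_op U \<phi> x\<bar> \<le> (\<integral>y. \<bar>green U x y * \<phi> y\<bar> \<partial>lebesgue_on U)"
    unfolding green_op_def by (rule integral_abs_bound)
  also have "\<dots> \<le> (\<integral>y. green U x y * Linf_norm U \<phi> \<partial>lebesgue_on U)"
    using green_mult_integrable green_integrable AE_abs_green_mult_le[OF \<phi>, of x]
    by (intro integral_mono_AE) auto
  also have "\<dots> \<le> l0 U * Linf_norm U \<phi>"
    using mult_right_mono[OF green_integral_le Linf_norm_nonneg] by simp
  finally show ?thesis .
qed

end

lemma abs_green_op_diff_le: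
  assumes "\<phi> \<in> Linf U" "\<psi> \<in> Linf U"
  shows "\<bar>green_op U \<phi> x - green_op U \<psi> x\<bar> \<le> l0 U * Linf_dist U \<phi> \<psi>"
proof -
  have "green_op U \<phi> x - green_op U \<psi> x = green_op U (\<lambda>y. \<phi> y - \<psi> y) x"
    unfolding green_op_def using assms[THEN green_mult_integrable] by (simp add: right_diff_distrib)
  then show ?thesis using abs_green_op_le[OF Linf_diff[OF assms]] by simp
qed

end

end

subsection \<open>Stability of the integral equation\<close>

definition signed_powr :: "real \<Rightarrow> real \<Rightarrow> real" where
  "signed_powr p t = t * \<bar>t\<bar> powr (p - 1)"

lemma signed_powr_of_pos: "0 < t \<Longrightarrow> signed_powr p t = t powr p"
  using powr_add[of t "p - 1" 1] by (simp add: signed_powr_def mult.commute)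

lemma signed_powr_minus: "signed_powr p (- t) = - signed_powr p t"
  by (simp add: signed_powr_def)

lemma has_real_derivative_signed_powr:
  assumes p: "1 < p"
  shows "(signed_powr p has_real_derivative p * \<bar>t\<bar> powr (p - 1)) (at t)"
proof -
  have pos: "(signed_powr p has_real_derivative p * \<bar>t\<bar> powr (p - 1)) (at t)" if t: "0 < t" for t
  proof (rule has_field_derivative_transform_within_open)
    show "((\<lambda>t. t powr p) has_real_derivative p * \<bar>t\<bar> powr (p - 1)) (at t)"
      using t by (auto intro!: derivative_eq_intros)
    show "t powr p = signed_powr p t" if "t \<in> {0<..}" for t
      using that by (simp add: signed_powr_of_pos)
  qed (use t in auto)
  consider "0 < t" | "t = 0" | "t < 0" by linarith
  then show ?thesis
  proof cases
    case 1
    then show ?thesis by (rule pos)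
  next
    case 2
    have "(\<lambda>h. \<bar>h\<bar> powr (p - 1)) \<midarrow>0\<rightarrow> 0"
      using p by (intro tendsto_zero_powrI[where b="p - 1"] tendsto_rabs_zero tendsto_intros) auto
    then have "(\<lambda>h. signed_powr p h / h) \<midarrow>0\<rightarrow> 0"
      by (rule Lim_transform_eventually) (auto simp: signed_powr_def eventually_at_filter)
    then show ?thesis using p 2 by (simp add: DERIV_def signed_powr_def)
  next
    case 3
    then have "((\<lambda>t. - signed_powr p (- t)) has_real_derivative - (p * \<bar>- t\<bar> powr (p - 1) * - 1)) (at t)"
      by (intro DERIV_minus DERIV_chain2[OF pos] derivative_eq_intros) auto
    then show ?thesis by (simp add: signed_powr_minus)
  qed
qed

lemma signed_powr_Lipschitz:
  assumes p: "1 < p" and s: "\<bar>s\<bar> \<le> R" and t: "\<bar>t\<bar> \<le> R"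
  shows "\<bar>signed_powr p s - signed_powr p t\<bar> \<le> p * R powr (p - 1) * \<bar>s - t\<bar>"
proof -
  have "norm (signed_powr p s - signed_powr p t) \<le> p * R powr (p - 1) * norm (s - t)"
  proof (rule field_differentiable_bound[of "{- R..R}"])
    show "(signed_powr p has_real_derivative p * \<bar>z\<bar> powr (p - 1)) (at z within {- R..R})" for z
      by (rule has_field_derivative_at_within[OF has_real_derivative_signed_powr[OF p]])
    show "norm (p * \<bar>z\<bar> powr (p - 1)) \<le> p * R powr (p - 1)" if "z \<in> {- R..R}" for z
      using that p by (auto simp: abs_mult intro!: mult_left_mono powr_mono2)
  qed (use s t in auto)
  then show ?thesis by simp
qed

lemma
  fixes F :: "real \<Rightarrow> real"
  assumes F: "F \<in> borel_measurable borel" and C: "0 \<le> C"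
    and Lipschitz: "\<And>s t. \<bar>s\<bar> \<le> R \<Longrightarrow> \<bar>t\<bar> \<le> R \<Longrightarrow> \<bar>F s - F t\<bar> \<le> C * \<bar>s - t\<bar>"
    and u: "u \<in> Linf U" "Linf_norm U u \<le> R"
  shows Linf_Lipschitz_compose: "(\<lambda>x. F (u x)) \<in> Linf U"
    and Linf_dist_Lipschitz_compose_le: "v \<in> Linf U \<Longrightarrow> Linf_norm U v \<le> R \<Longrightarrow>
      Linf_dist U (\<lambda>x. F (u x)) (\<lambda>x. F (v x)) \<le> C * Linf_dist U u v"
proof -
  have R: "0 \<le> R" using u(2) Linf_norm_nonneg[of U u] by linarith
  have bound: "AE x in lebesgue_on U. \<bar>w x\<bar> \<le> R" if "w \<in> Linf U" "Linf_norm U w \<le> R" for w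
    using AE_abs_le_Linf_norm[OF that(1)] by eventually_elim (use that(2) in linarith)
  have measurable: "(\<lambda>x. F (w x)) \<in> borel_measurable (lebesgue_on U)" if "w \<in> Linf U" for w
    by (rule measurable_compose[OF Linf_measurable[OF that] F])
  have "AE x in lebesgue_on U. \<bar>F (u x)\<bar> \<le> \<bar>F 0\<bar> + C * R"
    using bound[OF u]
  proof eventually_elim
    case (elim x)
    have "C * \<bar>u x - 0\<bar> \<le> C * R" using elim C by (intro mult_left_mono) auto
    then show ?case using Lipschitz[OF elim, of 0] R by simp
  qed
  then show "(\<lambda>x. F (u x)) \<in> Linf U"
    by (rule LinfI[OF measurable[OF u(1)]])
  show "Linf_dist U (\<lambda>x. F (u x)) (\<lambda>x. F (v x)) \<le> C * Linf_dist U u v"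
    if v: "v \<in> Linf U" "Linf_norm U v \<le> R"
  proof (rule Linf_norm_le)
    show "AE x in lebesgue_on U. \<bar>F (u x) - F (v x)\<bar> \<le> C * Linf_dist U u v"
      using bound[OF u] bound[OF v] AE_abs_le_Linf_norm[OF Linf_diff[OF u(1) v(1)]]
    proof eventually_elim
      case (elim x)
      have "\<bar>F (u x) - F (v x)\<bar> \<le> C * \<bar>u x - v x\<bar>" by (rule Lipschitz[OF elim(1,2)])
      also have "\<dots> \<le> C * Linf_dist U u v" using elim(3) C by (rule mult_left_mono)
      finally show ?case .
    qed
  qed (use C measurable u(1) v(1) in \<open>auto intro: borel_measurable_diff simp: Linf_norm_nonneg\<close>)
qed

lemma borel_measurable_signed_powr: "signed_powr p \<in> borel_measurable borel"
  unfolding signed_powr_def[abs_def] by measurable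

lemma
  assumes p: "1 < p" and u: "u \<in> Linf U" "Linf_norm U u \<le> R"
  shows Linf_signed_powr: "(\<lambda>x. signed_powr p (u x)) \<in> Linf U"
    and Linf_dist_signed_powr_le: "v \<in> Linf U \<Longrightarrow> Linf_norm U v \<le> R \<Longrightarrow>
      Linf_dist U (\<lambda>x. signed_powr p (u x)) (\<lambda>x. signed_powr p (v x))
        \<le> p * R powr (p - 1) * Linf_dist U u v"
proof -
  have "0 \<le> p * R powr (p - 1)" using p by simp
  note Lipschitz = borel_measurable_signed_powr this signed_powr_Lipschitz[OF p] u
  show "(\<lambda>x. signed_powr p (u x)) \<in> Linf U"
    by (rule Linf_Lipschitz_compose[OF Lipschitz])
  show "Linf_dist U (\<lambda>x. signed_powr p (u x)) (\<lambda>x. signed_powr p (v x))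
      \<le> p * R powr (p - 1) * Linf_dist U u v"
    if "v \<in> Linf U" "Linf_norm U v \<le> R"
    by (rule Linf_dist_Lipschitz_compose_le[OF Lipschitz that])
qed

lemma Linf_dist_mult_le:
  assumes "V \<in> Linf U" "W \<in> Linf U" "u \<in> Linf U" "v \<in> Linf U"
  shows "Linf_dist U (\<lambda>x. V x * u x) (\<lambda>x. W x * v x)
    \<le> Linf_norm U V * Linf_dist U u v + Linf_dist U V W * Linf_norm U v"
proof -
  note diffs = Linf_diff[OF assms(3,4)] Linf_diff[OF assms(1,2)]
  have "Linf_norm U (\<lambda>x. V x * (u x - v x) + (V x - W x) * v x)
      \<le> Linf_norm U (\<lambda>x. V x * (u x - v x)) + Linf_norm U (\<lambda>x. (V x - W x) * v x)"
    by (intro Linf_norm_add_le Linf_mult assms diffs)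
  also have "\<dots> \<le> Linf_norm U V * Linf_dist U u v + Linf_dist U V W * Linf_norm U v"
    by (intro add_mono Linf_norm_mult_le assms diffs)
  finally show ?thesis by (simp add: algebra_simps)
qed

lemma
  assumes "integral_solution U p f b g \<mu> u"
  shows integral_solution_in_Linf: "u \<in> Linf U"
    and AE_integral_solution: "AE x in lebesgue_on U. u x = green_op U g x
      - green_op U (\<lambda>y. potential U f \<mu> y * u y) x + green_op U (\<lambda>y. b y * signed_powr p (u y)) x"
  using assms by (simp_all add: integral_solution_def signed_powr_def mult.assoc)

context dirichlet_domain
begin

lemma l0_nonneg: "0 \<le> l0 U"
  using dim by (simp add: l0_def)

context
  fixes p R :: real and b g u v :: "'a \<Rightarrow> real" and f :: "'a \<Rightarrow>\<^sub>C real" and \<mu> \<nu> :: "'a set \<Rightarrow> real"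
  assumes p: "1 < p" and b: "b \<in> Linf U"
    and \<mu>: "finite_signed_measure U \<mu>" and \<nu>: "finite_signed_measure U \<nu>"
    and u: "integral_solution U p f b g \<mu> u" "Linf_norm U u \<le> R"
    and v: "integral_solution U p f b g \<nu> v" "Linf_norm U v \<le> R"
begin

lemma integral_solution_dist_le_terms:
  "Linf_dist U u v \<le> l0 U * Linf_dist U (\<lambda>x. b x * signed_powr p (u x)) (\<lambda>x. b x * signed_powr p (v x))
    + l0 U * Linf_dist U (\<lambda>x. potential U f \<mu> x * u x) (\<lambda>x. potential U f \<nu> x * v x)"
proof (rule Linf_norm_le)
  note in_Linf = integral_solution_in_Linf[OF u(1)] integral_solution_in_Linf[OF v(1)]
  have nonlinear: "(\<lambda>x. b x * signed_powr p (u x)) \<in> Linf U" "(\<lambda>x. b x * signed_powr p (v x)) \<in> Linf U"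
    by (intro Linf_mult b Linf_signed_powr[OF p _ u(2)] Linf_signed_powr[OF p _ v(2)] in_Linf)+
  have linear: "(\<lambda>x. potential U f \<mu> x * u x) \<in> Linf U" "(\<lambda>x. potential U f \<nu> x * v x) \<in> Linf U"
    by (intro Linf_mult potential_in_Linf bounded_U \<mu> \<nu> in_Linf)+
  show "(\<lambda>x. u x - v x) \<in> borel_measurable (lebesgue_on U)"
    by (intro Linf_measurable Linf_diff in_Linf)
  have "AE x in lebesgue_on U. x \<in> U"
    by (rule AE_I2) (simp add: space_restrict_space)
  then show "AE x in lebesgue_on U. \<bar>u x - v x\<bar>
      \<le> l0 U * Linf_dist U (\<lambda>x. b x * signed_powr p (u x)) (\<lambda>x. b x * signed_powr p (v x))
      + l0 U * Linf_dist U (\<lambda>x. potential U f \<mu> x * u x) (\<lambda>x. potential U f \<nu> x * v x)"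
    using AE_integral_solution[OF u(1)] AE_integral_solution[OF v(1)]
  proof eventually_elim
    case (elim x)
    show ?case
      using abs_green_op_diff_le[OF elim(1) nonlinear]
        abs_green_op_diff_le[OF elim(1) linear] elim(2,3) by linarith
  qed
qed (simp add: l0_nonneg Linf_norm_nonneg)

lemma integral_solution_stability:
  assumes \<kappa>: "l0 U * (norm f * tv_norm U \<mu>) + l0 U * (Linf_norm U b * (p * R powr (p - 1))) \<le> \<kappa>" "\<kappa> < 1"
  shows "Linf_dist U u v \<le> l0 U * R / (1 - \<kappa>) * Linf_dist U (potential U f \<mu>) (potential U f \<nu>)"
proof -
  define D where "D = Linf_dist U u v"
  define E where "E = Linf_dist U (potential U f \<mu>) (potential U f \<nu>)"
  note in_Linf = integral_solution_in_Linf[OF u(1)] integral_solution_in_Linf[OF v(1)]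
  have nonneg: "0 \<le> D" "0 \<le> E" by (simp_all add: D_def E_def Linf_norm_nonneg)
  have powers: "(\<lambda>x. signed_powr p (u x)) \<in> Linf U" "(\<lambda>x. signed_powr p (v x)) \<in> Linf U"
    by (intro Linf_signed_powr[OF p _ u(2)] Linf_signed_powr[OF p _ v(2)] in_Linf)+
  have "Linf_dist U (\<lambda>x. b x * signed_powr p (u x)) (\<lambda>x. b x * signed_powr p (v x))
      \<le> Linf_norm U b * Linf_dist U (\<lambda>x. signed_powr p (u x)) (\<lambda>x. signed_powr p (v x))"
    using Linf_norm_mult_le[OF b Linf_diff[OF powers]] by (simp add: right_diff_distrib)
  also have "\<dots> \<le> Linf_norm U b * (p * R powr (p - 1) * D)"
    unfolding D_def
    by (intro mult_left_mono Linf_norm_nonneg Linf_dist_signed_powr_le p in_Linf u(2) v(2))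
  finally have nonlinear: "Linf_dist U (\<lambda>x. b x * signed_powr p (u x)) (\<lambda>x. b x * signed_powr p (v x))
      \<le> Linf_norm U b * (p * R powr (p - 1) * D)" .
  have "Linf_dist U (\<lambda>x. potential U f \<mu> x * u x) (\<lambda>x. potential U f \<nu> x * v x)
      \<le> Linf_norm U (potential U f \<mu>) * D + E * Linf_norm U v"
    unfolding D_def E_def by (intro Linf_dist_mult_le potential_in_Linf bounded_U \<mu> \<nu> in_Linf)
  also have "\<dots> \<le> norm f * tv_norm U \<mu> * D + E * R"
    using nonneg v(2)
    by (intro add_mono mult_right_mono mult_left_mono Linf_norm_potential_le bounded_U \<mu>)
  finally have "D \<le> l0 U * (Linf_norm U b * (p * R powr (p - 1) * D))
      + l0 U * (norm f * tv_norm U \<mu> * D + E * R)"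
    using nonlinear l0_nonneg unfolding D_def
    by (intro order_trans[OF integral_solution_dist_le_terms] add_mono mult_left_mono)
  also have "\<dots> = (l0 U * (norm f * tv_norm U \<mu>) + l0 U * (Linf_norm U b * (p * R powr (p - 1)))) * D
      + l0 U * R * E"
    by (simp add: algebra_simps)
  also have "\<dots> \<le> \<kappa> * D + l0 U * R * E"
    using \<kappa>(1) nonneg(1) by (intro add_right_mono mult_right_mono)
  finally have "D * (1 - \<kappa>) \<le> l0 U * R * E" by (simp add: algebra_simps)
  then show ?thesis
    using \<kappa>(2) unfolding D_def[symmetric] E_def[symmetric] by (simp add: field_simps)
qed

end

end

locale semilinear_problem = dirichlet_domain U for U :: "'a::euclidean_space set" +
  fixes p c0 K \<epsilon>0 :: real and f :: "'a \<Rightarrow>\<^sub>C real" and b g :: "'a \<Rightarrow> real"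
  assumes nonempty_U: "U \<noteq> {}" and p: "1 < p" and f: "f \<noteq> 0"
    and b: "b \<in> Linf U" "\<not> (AE x in lebesgue_on U. b x = 0)"
    and K: "K = l0 U * p * Linf_norm U b" and c0: "0 < c0" "c0 < 1"
    and \<epsilon>0: "\<epsilon>0 = ((1 - c0) powr p / (2 powr p * K)) powr (1 / (p - 1))"
begin

definition solution_radius :: real where
  "solution_radius = 2 * \<epsilon>0 / (1 - c0)"

definition solution_Lipschitz_constant :: real where
  "solution_Lipschitz_constant = 2 * l0 U * solution_radius / (1 - c0)"

definition tv_bound :: real where
  "tv_bound = c0 / (l0 U * norm f)"

definition admissible_pair :: "('a set \<Rightarrow> real) \<Rightarrow> ('a \<Rightarrow> real) \<Rightarrow> bool" where
  "admissible_pair \<mu> u \<longleftrightarrow> \<mu> \<in> radon_measures U \<and> existence_conditions U p f b g \<epsilon>0 \<mu> \<and>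
     small_solution U p f b g \<epsilon>0 \<mu> u"

lemma l0_norm_pos: "0 < l0 U" "0 < norm f"
  using l0_pos nonempty_U f by auto

lemma K_pos: "0 < K"
proof -
  have "Linf_norm U b \<noteq> 0"
  proof
    assume "Linf_norm U b = 0"
    then have "AE x in lebesgue_on U. b x = 0"
      using AE_abs_le_Linf_norm[OF b(1)] by simp
    then show False using b(2) by simp
  qed
  then show ?thesis
    using Linf_norm_nonneg[of U b] l0_norm_pos p by (simp add: K order_less_le)
qed

lemma \<epsilon>0_pos: "0 < \<epsilon>0"
  using c0 K_pos by (simp add: \<epsilon>0)

lemma \<epsilon>0_powr: "\<epsilon>0 powr (p - 1) = (1 - c0) powr p / (2 powr p * K)"
  using p c0 K_pos by (simp add: \<epsilon>0 powr_powr)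

lemma solution_radius_nonneg: "0 \<le> solution_radius"
  using \<epsilon>0_pos c0 by (simp add: solution_radius_def)

lemma solution_Lipschitz_constant_nonneg: "0 \<le> solution_Lipschitz_constant"
  using solution_radius_nonneg l0_nonneg c0 by (simp add: solution_Lipschitz_constant_def)

lemma K_solution_radius_powr: "K * solution_radius powr (p - 1) = (1 - c0) / 2"
proof -
  have split_powr: "2 powr p = 2 * 2 powr (p - 1)" "(1 - c0) powr p = (1 - c0) * (1 - c0) powr (p - 1)"
    using powr_add[of 2 "p - 1" 1] powr_add[of "1 - c0" "p - 1" 1] c0 by (auto simp: mult.commute)
  have "solution_radius powr (p - 1) = 2 powr (p - 1) * \<epsilon>0 powr (p - 1) / (1 - c0) powr (p - 1)"
    using \<epsilon>0_pos c0 by (simp add: solution_radius_def powr_divide powr_mult)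
  also have "\<dots> = (1 - c0) / (2 * K)"
    unfolding \<epsilon>0_powr split_powr using c0 K_pos by (simp add: field_simps)
  finally show ?thesis using K_pos by simp
qed

lemma existence_conditions_imp_tau_less:
  assumes "existence_conditions U p f b g \<epsilon>0 \<mu>"
  shows "tau U f \<mu> < c0"
proof -
  define t where "t = tau U f \<mu>"
  have t: "t < 1" and contraction: "2 powr p * K * \<epsilon>0 powr (p - 1) / (1 - t) powr (p - 1) + t < 1"
    using assms by (auto simp: existence_conditions_def Kconst_def K t_def)
  have "(1 - c0) powr p / (1 - t) powr (p - 1) < 1 - t"
    using contraction K_pos by (simp add: \<epsilon>0_powr)
  then have "(1 - c0) powr p < (1 - t) * (1 - t) powr (p - 1)"
    using t by (simp add: pos_divide_less_eq)
  also have "\<dots> = (1 - t) powr p"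
    using t powr_add[of "1 - t" "p - 1" 1] by (simp add: mult.commute)
  finally have "\<not> (1 - t) powr p \<le> (1 - c0) powr p" by simp
  then have "1 - c0 < 1 - t"
    using powr_mono2[of p "1 - t" "1 - c0"] t p by linarith
  then show ?thesis by (simp add: t_def)
qed

context
  fixes \<mu> u assumes pair: "admissible_pair \<mu> u"
begin

lemma admissible_pair_finite_signed_measure: "finite_signed_measure U \<mu>"
  using pair open_U by (auto simp: admissible_pair_def intro: radon_measures_imp_finite_signed_measure)

lemma admissible_pair_tau_less: "tau U f \<mu> < c0"
  using pair existence_conditions_imp_tau_less by (simp add: admissible_pair_def)

lemma admissible_pair_tv_norm_le: "tv_norm U \<mu> \<le> tv_bound"
  using admissible_pair_tau_less l0_norm_pos by (simp add: tau_def tv_bound_def field_simps)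

lemma admissible_pair_integral_solution: "integral_solution U p f b g \<mu> u"
  using pair by (simp add: admissible_pair_def small_solution_def)

lemmas admissible_pair_in_Linf = integral_solution_in_Linf[OF admissible_pair_integral_solution]

lemma admissible_pair_norm_le: "Linf_norm U u \<le> solution_radius"
proof -
  have "Linf_norm U u \<le> 2 * \<epsilon>0 / (1 - tau U f \<mu>)"
    using pair by (simp add: admissible_pair_def small_solution_def)
  also have "\<dots> \<le> solution_radius"
    unfolding solution_radius_def using admissible_pair_tau_less c0 \<epsilon>0_pos
    by (intro divide_left_mono mult_pos_pos) auto
  finally show ?thesis .
qed

end

text \<open>The choice of \<open>\<epsilon>0\<close> splits the contraction constant $(1+c_0)/2$ as $c_0+(1-c_0)/2$.\<close>

lemma admissible_pair_dist_le:
  assumes u: "admissible_pair \<mu> u" and v: "admissible_pair \<nu> v"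
  shows "Linf_dist U u v \<le> solution_Lipschitz_constant * Linf_dist U (potential U f \<mu>) (potential U f \<nu>)"
proof -
  have "l0 U * (norm f * tv_norm U \<mu>) \<le> c0"
    using admissible_pair_tau_less[OF u] by (simp add: tau_def mult.assoc)
  moreover have "l0 U * (Linf_norm U b * (p * solution_radius powr (p - 1))) = (1 - c0) / 2"
    using K_solution_radius_powr by (simp add: K mult_ac)
  ultimately have contraction: "l0 U * (norm f * tv_norm U \<mu>)
      + l0 U * (Linf_norm U b * (p * solution_radius powr (p - 1))) \<le> (1 + c0) / 2"
    by (simp add: field_simps)
  have "Linf_dist U u v
      \<le> l0 U * solution_radius / (1 - (1 + c0) / 2) * Linf_dist U (potential U f \<mu>) (potential U f \<nu>)"
    using c0 by (intro integral_solution_stability[OF p b(1)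
          u[THEN admissible_pair_finite_signed_measure] v[THEN admissible_pair_finite_signed_measure]
          u[THEN admissible_pair_integral_solution] u[THEN admissible_pair_norm_le]
          v[THEN admissible_pair_integral_solution] v[THEN admissible_pair_norm_le] contraction]) simp
  also have "l0 U * solution_radius / (1 - (1 + c0) / 2) = solution_Lipschitz_constant"
    using c0 by (simp add: solution_Lipschitz_constant_def field_simps)
  finally show ?thesis .
qed

end

subsection \<open>Random fields with equicontinuous paths\<close>

lemma Linf_norm_le_pointwise:
  assumes "\<phi> \<in> Linf U" "\<And>x. x \<in> U \<Longrightarrow> \<bar>\<phi> x\<bar> \<le> C" "0 \<le> C"
  shows "Linf_norm U \<phi> \<le> C"
  using assms by (intro Linf_norm_le Linf_measurable AE_I2) (auto simp: space_restrict_space)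

lemma finite_net_in_dense_subset:
  fixes U :: "'a::heine_borel set"
  assumes U: "bounded U" and D: "D \<subseteq> U" "U \<subseteq> closure D" and d: "0 < d"
  obtains Q where "finite Q" "Q \<subseteq> D" "\<And>x. x \<in> U \<Longrightarrow> \<exists>q\<in>Q. dist x q < d"
proof -
  have "compact (closure U)" using U by (simp add: compact_closure)
  moreover have "closure U \<subseteq> (\<Union>q\<in>D. ball q d)"
  proof
    fix x assume "x \<in> closure U"
    then have "x \<in> closure D" using closure_minimal[OF D(2) closed_closure] by blast
    then obtain q where "q \<in> D" "dist q x < d"
      using d closure_approachable by blast
    then show "x \<in> (\<Union>q\<in>D. ball q d)" by auto
  qed
  ultimately obtain Q where Q: "Q \<subseteq> D" "finite Q" "closure U \<subseteq> (\<Union>q\<in>Q. ball q d)"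
    using compactE_image[of "closure U" D "\<lambda>q. ball q d"] by blast
  have "\<exists>q\<in>Q. dist x q < d" if "x \<in> U" for x
    using Q(3) closure_subset[of U] that by (force simp: dist_commute)
  then show ?thesis using that Q by blast
qed

lemma uniformly_equicontinuous_on_diff:
  fixes F G :: "('a::metric_space \<Rightarrow> real) set"
  assumes "uniformly_equicontinuous_on S F" "uniformly_equicontinuous_on S G"
  shows "uniformly_equicontinuous_on S {\<lambda>x. \<phi> x - \<psi> x | \<phi> \<psi>. \<phi> \<in> F \<and> \<psi> \<in> G}"
  unfolding uniformly_equicontinuous_on_def
proof (intro allI impI)
  fix e :: real assume "0 < e"
  then have "0 < e / 2" by simp
  obtain c where c: "0 < c"
    "\<And>\<phi> x y. \<phi> \<in> F \<Longrightarrow> x \<in> S \<Longrightarrow> y \<in> S \<Longrightarrow> dist x y < c \<Longrightarrow> dist (\<phi> x) (\<phi> y) < e / 2"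
    using uniformly_equicontinuous_onE[OF assms(1) \<open>0 < e / 2\<close>] by blast
  obtain d where d: "0 < d"
    "\<And>\<psi> x y. \<psi> \<in> G \<Longrightarrow> x \<in> S \<Longrightarrow> y \<in> S \<Longrightarrow> dist x y < d \<Longrightarrow> dist (\<psi> x) (\<psi> y) < e / 2"
    using uniformly_equicontinuous_onE[OF assms(2) \<open>0 < e / 2\<close>] by blast
  have "dist (\<phi> x - \<psi> x) (\<phi> y - \<psi> y) < e"
    if "\<phi> \<in> F" "\<psi> \<in> G" "x \<in> S" "y \<in> S" "dist x y < min c d" for \<phi> \<psi> x y
  proof -
    have "dist (\<phi> x) (\<phi> y) < e / 2" "dist (\<psi> x) (\<psi> y) < e / 2"
      using c(2)[of \<phi> x y] d(2)[of \<psi> x y] that by linarith+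
    then show ?thesis unfolding dist_real_def by linarith
  qed
  then show "\<exists>r>0. \<forall>\<eta>\<in>{\<lambda>x. \<phi> x - \<psi> x | \<phi> \<psi>. \<phi> \<in> F \<and> \<psi> \<in> G}. \<forall>x\<in>S. \<forall>y\<in>S.
      dist x y < r \<longrightarrow> dist (\<eta> x) (\<eta> y) < e"
    using c(1) d(1) by (intro exI[of _ "min c d"]) auto
qed

lemma uniformly_equicontinuous_on_finite_net:
  fixes U :: "'a::heine_borel set"
  assumes U: "bounded U" and D: "D \<subseteq> U" "U \<subseteq> closure D"
    and equicontinuous: "uniformly_equicontinuous_on U F" and e: "0 < e"
  obtains Q where "finite Q" "Q \<subseteq> D" "\<And>x. x \<in> U \<Longrightarrow> \<exists>q\<in>Q. \<forall>\<phi>\<in>F. dist (\<phi> x) (\<phi> q) < e"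
proof -
  obtain d where d: "0 < d"
    "\<And>\<phi> x y. \<phi> \<in> F \<Longrightarrow> x \<in> U \<Longrightarrow> y \<in> U \<Longrightarrow> dist x y < d \<Longrightarrow> dist (\<phi> x) (\<phi> y) < e"
    using uniformly_equicontinuous_onE[OF equicontinuous e] by blast
  obtain Q where Q: "finite Q" "Q \<subseteq> D" "\<And>x. x \<in> U \<Longrightarrow> \<exists>q\<in>Q. dist x q < d"
    using finite_net_in_dense_subset[OF U D d(1)] by blast
  have "\<exists>q\<in>Q. \<forall>\<phi>\<in>F. dist (\<phi> x) (\<phi> q) < e" if x: "x \<in> U" for x
  proof -
    obtain q where q: "q \<in> Q" "dist x q < d" using Q(3)[OF x] by blast
    then have "q \<in> U" using Q(2) D(1) by blast
    then show ?thesis using d(2)[OF _ x _ q(2)] q(1) by blast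
  qed
  then show ?thesis using that Q(1,2) by blast
qed

lemma uniform_limit_zero_of_equicontinuous:
  fixes h :: "nat \<Rightarrow> 'a::heine_borel \<Rightarrow> real"
  assumes U: "bounded U" and D: "D \<subseteq> U" "U \<subseteq> closure D"
    and equicontinuous: "uniformly_equicontinuous_on U (range h)"
    and limit: "\<And>q. q \<in> D \<Longrightarrow> (\<lambda>j. h j q) \<longlonglongrightarrow> 0"
  shows "uniform_limit U h (\<lambda>_. 0) sequentially"
proof (rule uniform_limitI)
  fix e :: real assume "0 < e"
  then have "0 < e / 2" by simp
  obtain Q where Q: "finite Q" "Q \<subseteq> D"
    "\<And>x. x \<in> U \<Longrightarrow> \<exists>q\<in>Q. \<forall>\<phi>\<in>range h. dist (\<phi> x) (\<phi> q) < e / 2"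
    using uniformly_equicontinuous_on_finite_net[OF U D equicontinuous \<open>0 < e / 2\<close>] by blast
  have "\<forall>\<^sub>F j in sequentially. \<forall>q\<in>Q. dist (h j q) 0 < e / 2"
    using Q(2) limit tendstoD[OF _ \<open>0 < e / 2\<close>] by (intro eventually_ball_finite[OF Q(1)]) blast
  then show "\<forall>\<^sub>F j in sequentially. \<forall>x\<in>U. dist (h j x) 0 < e"
  proof eventually_elim
    case (elim j)
    show ?case
    proof
      fix x assume "x \<in> U"
      then obtain q where q: "q \<in> Q" "dist (h j x) (h j q) < e / 2" using Q(3) by blast
      have "dist (h j x) 0 \<le> dist (h j x) (h j q) + dist (h j q) 0" by (rule dist_triangle)
      also have "\<dots> < e / 2 + e / 2"
        using q elim by (intro add_strict_mono) auto
      finally show "dist (h j x) 0 < e" by simp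
    qed
  qed
qed

lemma Linf_norm_tendsto_zero_of_uniform_limit:
  assumes "\<And>j. h j \<in> Linf U" and uniform: "uniform_limit U h (\<lambda>_. 0) sequentially"
  shows "(\<lambda>j. Linf_norm U (h j)) \<longlonglongrightarrow> 0"
proof (rule tendstoI)
  fix e :: real assume "0 < e"
  then have "0 < e / 2" by simp
  from uniform_limitD[OF uniform this]
  show "\<forall>\<^sub>F j in sequentially. dist (Linf_norm U (h j)) 0 < e"
  proof eventually_elim
    case (elim j)
    then have "Linf_norm U (h j) \<le> e / 2"
      using \<open>0 < e\<close> assms(1) by (intro Linf_norm_le_pointwise) (auto intro: less_imp_le)
    then show ?case using \<open>0 < e\<close> by (simp add: Linf_norm_nonneg)
  qed
qed

lemma simple_function_restrict:
  assumes Q: "finite Q" and F: "\<And>q. q \<in> Q \<Longrightarrow> simple_function M (F q)"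
  shows "simple_function M (\<lambda>\<omega>. \<lambda>q\<in>Q. F q \<omega>)"
  unfolding simple_function_def
proof
  let ?T = "\<lambda>\<omega>. \<lambda>q\<in>Q. F q \<omega>"
  have "?T ` space M \<subseteq> PiE Q (\<lambda>q. F q ` space M)" by auto
  then show "finite (?T ` space M)"
    by (rule finite_subset) (intro finite_PiE Q simple_functionD(1) F)
  show "\<forall>k\<in>?T ` space M. ?T -` {k} \<inter> space M \<in> sets M"
  proof
    fix k assume "k \<in> ?T ` space M"
    then obtain \<omega>0 where k: "k = ?T \<omega>0" by blast
    have "?T \<omega> = k \<longleftrightarrow> (\<forall>q\<in>Q. F q \<omega> = k q)" for \<omega>
      unfolding k by (auto simp: fun_eq_iff restrict_def)
    then have "?T -` {k} \<inter> space M = {\<omega> \<in> space M. \<forall>q\<in>Q. F q \<omega> = k q}" by blast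
    also have "\<dots> \<in> sets M"
    proof (rule sets.sets_Collect_finite_All[OF _ Q])
      fix q assume "q \<in> Q"
      have "{\<omega> \<in> space M. F q \<omega> = k q} = F q -` {k q} \<inter> space M" by blast
      then show "{\<omega> \<in> space M. F q \<omega> = k q} \<in> sets M"
        using simple_functionD(2)[OF F[OF \<open>q \<in> Q\<close>]] by simp
    qed
    finally show "?T -` {k} \<inter> space M \<in> sets M" .
  qed
qed

lemma abs_diff_le_of_floor_divide_eq:
  fixes s t e :: real
  assumes "0 < e" "\<lfloor>s / e\<rfloor> = \<lfloor>t / e\<rfloor>"
  shows "\<bar>s - t\<bar> \<le> e"
proof -
  have "\<bar>s / e - t / e\<bar> \<le> 1" using assms(2) by linarith
  then show ?thesis
    using assms(1) by (simp add: diff_divide_distrib[symmetric] abs_divide)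
qed

text \<open>The level sets record the field on a finite net up to a small error.\<close>

lemma Linf_approximable_equicontinuous:
  fixes V :: "'w \<Rightarrow> 'a::euclidean_space \<Rightarrow> real"
  assumes U: "bounded U" and V: "\<And>\<omega>. \<omega> \<in> space M \<Longrightarrow> V \<omega> \<in> Linf U"
    and measurable: "\<And>x. x \<in> U \<Longrightarrow> (\<lambda>\<omega>. V \<omega> x) \<in> borel_measurable M"
    and bounded: "\<And>\<omega> x. \<omega> \<in> space M \<Longrightarrow> x \<in> U \<Longrightarrow> \<bar>V \<omega> x\<bar> \<le> B"
    and equicontinuous: "uniformly_equicontinuous_on U (V ` space M)"
  shows "Linf_approximable M U V"
proof -
  have "\<exists>Q. finite Q \<and> Q \<subseteq> U \<and> (\<forall>x\<in>U. \<exists>q\<in>Q. \<forall>\<phi>\<in>V ` space M. dist (\<phi> x) (\<phi> q) < e / 3)"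
    if "0 < e" for e
  proof -
    have "0 < e / 3" using that by simp
    from uniformly_equicontinuous_on_finite_net[OF U order_refl closure_subset equicontinuous this]
    show ?thesis by metis
  qed
  then obtain Q where Q: "\<And>e. 0 < e \<Longrightarrow> finite (Q e)" "\<And>e. 0 < e \<Longrightarrow> Q e \<subseteq> U"
    "\<And>e x. 0 < e \<Longrightarrow> x \<in> U \<Longrightarrow> \<exists>q\<in>Q e. \<forall>\<phi>\<in>V ` space M. dist (\<phi> x) (\<phi> q) < e / 3"
    by metis
  define T where "T e \<omega> = (\<lambda>q\<in>Q e. \<lfloor>V \<omega> q / (e / 3)\<rfloor>)" for e \<omega>
  show ?thesis
  proof (rule Linf_approximable_of_level_sets[OF V, where T=T])
    show "simple_function M (T e)" if "0 < e" for e
      unfolding T_def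
    proof (rule simple_function_restrict[OF Q(1)[OF that]])
      fix q assume "q \<in> Q e"
      then have "q \<in> U" using Q(2)[OF that] by blast
      then show "simple_function M (\<lambda>\<omega>. \<lfloor>V \<omega> q / (e / 3)\<rfloor>)"
        using measurable bounded that by (intro simple_function_floor_divide[where B=B]) auto
    qed
    fix e :: real and \<omega> \<omega>'
    assume e: "0 < e" and \<omega>: "\<omega> \<in> space M" "\<omega>' \<in> space M" and level: "T e \<omega> = T e \<omega>'"
    have net: "\<bar>V \<omega> q - V \<omega>' q\<bar> \<le> e / 3" if "q \<in> Q e" for q
      using fun_cong[OF level, of q] that e by (intro abs_diff_le_of_floor_divide_eq) (auto simp: T_def)
    show "Linf_dist U (V \<omega>) (V \<omega>') \<le> e"
    proof (rule Linf_norm_le_pointwise)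
      fix x assume "x \<in> U"
      then obtain q where q: "q \<in> Q e" "\<And>\<omega>. \<omega> \<in> space M \<Longrightarrow> \<bar>V \<omega> x - V \<omega> q\<bar> < e / 3"
        using Q(3)[OF e] unfolding dist_real_def by (metis imageI)
      then show "\<bar>V \<omega> x - V \<omega>' x\<bar> \<le> e"
        using q(2)[OF \<omega>(1)] q(2)[OF \<omega>(2)] net[OF q(1)] by linarith
    qed (use e \<omega> V in \<open>auto intro: Linf_diff\<close>)
  qed
qed

subsection \<open>Almost sure limits of uncorrelated random variables\<close>

context prob_space
begin

lemma
  fixes s :: "nat \<Rightarrow> 'a \<Rightarrow> real"
  assumes "\<And>i. s i \<in> borel_measurable M" "f \<in> borel_measurable M"
    and "AE \<omega> in M. (\<lambda>i. s i \<omega>) \<longlonglongrightarrow> f \<omega>" and "\<And>i \<omega>. \<omega> \<in> space M \<Longrightarrow> \<bar>s i \<omega>\<bar> \<le> B"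
  shows integrable_bounded_limit: "integrable M f"
    and expectation_bounded_limit: "(\<lambda>i. expectation (s i)) \<longlonglongrightarrow> expectation f"
  using assms by (auto intro!: integrable_dominated_convergence[where w="\<lambda>_. B" and s=s]
      integral_dominated_convergence[where w="\<lambda>_. B"])

lemma AE_eq_expectation_of_second_moment:
  fixes Z :: "'a \<Rightarrow> real"
  assumes Z: "integrable M Z" "integrable M (\<lambda>\<omega>. (Z \<omega>)\<^sup>2)"
    and second_moment: "expectation (\<lambda>\<omega>. (Z \<omega>)\<^sup>2) = (expectation Z)\<^sup>2"
  shows "AE \<omega> in M. Z \<omega> = expectation Z"
proof -
  have "integrable M (\<lambda>\<omega>. (Z \<omega> - expectation Z)\<^sup>2)"
    using Z unfolding power2_diff by (intro Bochner_Integration.integrable_add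
        Bochner_Integration.integrable_diff) auto
  moreover have "expectation (\<lambda>\<omega>. (Z \<omega> - expectation Z)\<^sup>2) = 0"
    using variance_eq[OF Z] second_moment by simp
  ultimately have "AE \<omega> in M. (Z \<omega> - expectation Z)\<^sup>2 = 0"
    by (simp add: integral_nonneg_eq_0_iff_AE)
  then show ?thesis by simp
qed

lemma uncorrelated_limit_AE_constant:
  fixes Z :: "nat \<Rightarrow> 'a \<Rightarrow> real"
  assumes measurable[measurable]: "\<And>j. Z j \<in> borel_measurable M" "Z' \<in> borel_measurable M"
    and bounded: "\<And>j \<omega>. \<omega> \<in> space M \<Longrightarrow> \<bar>Z j \<omega>\<bar> \<le> B"
    and limit: "AE \<omega> in M. (\<lambda>j. Z j \<omega>) \<longlonglongrightarrow> Z' \<omega>"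
    and uncorrelated: "\<And>j. expectation (\<lambda>\<omega>. Z j \<omega> * Z (Suc j) \<omega>)
      = expectation (Z j) * expectation (Z (Suc j))"
  shows "AE \<omega> in M. Z' \<omega> = expectation Z'"
proof (rule AE_eq_expectation_of_second_moment)
  show "integrable M Z'"
    by (rule integrable_bounded_limit[OF measurable limit bounded])
  have mean: "(\<lambda>j. expectation (Z j)) \<longlonglongrightarrow> expectation Z'"
    by (rule expectation_bounded_limit[OF measurable limit bounded])
  have product_limit: "AE \<omega> in M. (\<lambda>j. Z j \<omega> * Z (Suc j) \<omega>) \<longlonglongrightarrow> (Z' \<omega>)\<^sup>2"
    using limit by eventually_elim (auto simp: power2_eq_square intro: tendsto_mult LIMSEQ_Suc)
  have product_bounded: "\<bar>Z j \<omega> * Z (Suc j) \<omega>\<bar> \<le> B * B" if "\<omega> \<in> space M" for j \<omega>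
    unfolding abs_mult using bounded[OF that, of j] bounded[OF that, of "Suc j"]
    by (intro mult_mono) auto
  have products: "\<And>j. (\<lambda>\<omega>. Z j \<omega> * Z (Suc j) \<omega>) \<in> borel_measurable M" "(\<lambda>\<omega>. (Z' \<omega>)\<^sup>2) \<in> borel_measurable M"
    by measurable
  show "integrable M (\<lambda>\<omega>. (Z' \<omega>)\<^sup>2)"
    by (rule integrable_bounded_limit[OF products product_limit product_bounded])
  have "(\<lambda>j. expectation (Z j) * expectation (Z (Suc j))) \<longlonglongrightarrow> expectation (\<lambda>\<omega>. (Z' \<omega>)\<^sup>2)"
    using expectation_bounded_limit[OF products product_limit product_bounded] by (simp only: uncorrelated)
  moreover have "(\<lambda>j. expectation (Z j) * expectation (Z (Suc j))) \<longlonglongrightarrow> expectation Z' * expectation Z'"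
    by (intro tendsto_mult mean LIMSEQ_Suc[OF mean])
  ultimately show "expectation (\<lambda>\<omega>. (Z' \<omega>)\<^sup>2) = (expectation Z')\<^sup>2"
    unfolding power2_eq_square by (rule LIMSEQ_unique)
qed

lemma expectation_mult_of_indep_vars:
  fixes Z :: "'i \<Rightarrow> 'a \<Rightarrow> real"
  assumes "indep_vars (\<lambda>_. borel) Z I" "i \<in> I" "j \<in> I" "i \<noteq> j" "integrable M (Z i)" "integrable M (Z j)"
  shows "expectation (\<lambda>\<omega>. Z i \<omega> * Z j \<omega>) = expectation (Z i) * expectation (Z j)"
proof -
  have "indep_vars (\<lambda>_. borel) Z {i, j}"
    using assms(1-3) by (intro indep_vars_subset[OF assms(1)]) auto
  then have "expectation (\<lambda>\<omega>. \<Prod>k\<in>{i, j}. Z k \<omega>) = (\<Prod>k\<in>{i, j}. expectation (Z k))"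
    using assms(5,6) by (intro indep_vars_lebesgue_integral) auto
  then show ?thesis using assms(4) by simp
qed

lemma uncorrelated_fields_converge_to_sample:
  fixes V :: "nat \<Rightarrow> 'a \<Rightarrow> 'b::euclidean_space \<Rightarrow> real" and V' :: "'a \<Rightarrow> 'b \<Rightarrow> real"
  assumes U: "bounded U" and V: "\<And>j \<omega>. \<omega> \<in> space M \<Longrightarrow> V j \<omega> \<in> Linf U"
    and equicontinuous: "uniformly_equicontinuous_on U (\<Union>j. V j ` space M)"
    and measurable: "\<And>j x. x \<in> U \<Longrightarrow> (\<lambda>\<omega>. V j \<omega> x) \<in> borel_measurable M"
      "\<And>x. x \<in> U \<Longrightarrow> (\<lambda>\<omega>. V' \<omega> x) \<in> borel_measurable M"
    and bounded: "\<And>j \<omega> x. \<omega> \<in> space M \<Longrightarrow> x \<in> U \<Longrightarrow> \<bar>V j \<omega> x\<bar> \<le> B"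
    and limit: "\<And>x. x \<in> U \<Longrightarrow> AE \<omega> in M. (\<lambda>j. V j \<omega> x) \<longlonglongrightarrow> V' \<omega> x"
    and uncorrelated: "\<And>j x. x \<in> U \<Longrightarrow> expectation (\<lambda>\<omega>. V j \<omega> x * V (Suc j) \<omega> x)
      = expectation (\<lambda>\<omega>. V j \<omega> x) * expectation (\<lambda>\<omega>. V (Suc j) \<omega> x)"
  obtains \<omega>0 where "\<omega>0 \<in> space M" "AE \<omega> in M. (\<lambda>j. Linf_dist U (V j \<omega>) (V j \<omega>0)) \<longlonglongrightarrow> 0"
proof -
  obtain D where D: "countable D" "D \<subseteq> U" "U \<subseteq> closure D"
    using separable[of U] by blast
  define c where "c x = expectation (\<lambda>\<omega>. V' \<omega> x)" for x
  have "AE \<omega> in M. (\<lambda>j. V j \<omega> x) \<longlonglongrightarrow> c x" if x: "x \<in> U" for x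
  proof -
    have "AE \<omega> in M. V' \<omega> x = c x"
      unfolding c_def
      by (rule uncorrelated_limit_AE_constant[OF
            measurable[OF x] bounded[OF _ x] limit[OF x] uncorrelated[OF x]])
    then show ?thesis using limit[OF x] by eventually_elim simp
  qed
  then have AE_D: "AE \<omega> in M. \<forall>x\<in>D. (\<lambda>j. V j \<omega> x) \<longlonglongrightarrow> c x"
    using D by (auto simp: AE_ball_countable)
  then obtain \<omega>0 where \<omega>0: "\<omega>0 \<in> space M" "\<forall>x\<in>D. (\<lambda>j. V j \<omega>0 x) \<longlonglongrightarrow> c x"
    using eventually_happens'[OF ae_filter_bot eventually_conj[OF AE_space]] by blast
  have "AE \<omega> in M. (\<lambda>j. Linf_dist U (V j \<omega>) (V j \<omega>0)) \<longlonglongrightarrow> 0"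
    using AE_D AE_space
  proof eventually_elim
    case (elim \<omega>)
    define h where "h j x = V j \<omega> x - V j \<omega>0 x" for j x
    have "range h \<subseteq> {\<lambda>x. \<phi> x - \<psi> x | \<phi> \<psi>. \<phi> \<in> (\<Union>j. V j ` space M) \<and> \<psi> \<in> (\<Union>j. V j ` space M)}"
      using elim(2) \<omega>0(1) by (auto simp: h_def[abs_def])
    then have "uniformly_equicontinuous_on U (range h)"
      by (rule uniformly_equicontinuous_on_subset[OF
            uniformly_equicontinuous_on_diff[OF equicontinuous equicontinuous]])
    moreover have "(\<lambda>j. h j q) \<longlonglongrightarrow> 0" if "q \<in> D" for q
      unfolding h_def using tendsto_diff[of "\<lambda>j. V j \<omega> q" "c q" sequentially "\<lambda>j. V j \<omega>0 q" "c q"]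
        elim(1) \<omega>0(2) that by simp
    ultimately have "uniform_limit U h (\<lambda>_. 0) sequentially"
      by (rule uniform_limit_zero_of_equicontinuous[OF U D(2,3)])
    moreover have "h j \<in> Linf U" for j
      unfolding h_def[abs_def] by (intro Linf_diff V elim(2) \<omega>0(1))
    ultimately have "(\<lambda>j. Linf_norm U (h j)) \<longlonglongrightarrow> 0"
      by (intro Linf_norm_tendsto_zero_of_uniform_limit)
    then show ?case by (simp add: h_def[abs_def])
  qed
  then show ?thesis using that \<omega>0(1) by blast
qed

end

subsection \<open>Weak laws of large numbers\<close>

lemma Cesaro_mean_tendsto_zero:
  fixes a :: "nat \<Rightarrow> real"
  assumes a: "a \<longlonglongrightarrow> 0"
  shows "(\<lambda>k. (\<Sum>j<k. a j) / real k) \<longlonglongrightarrow> 0"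
proof (rule LIMSEQ_I)
  fix r :: real assume r: "0 < r"
  obtain n where n: "\<And>j. n \<le> j \<Longrightarrow> \<bar>a j\<bar> < r / 2"
    using LIMSEQ_D[OF a half_gt_zero[OF r]] by auto
  define S where "S = (\<Sum>j<n. \<bar>a j\<bar>)"
  obtain k0 :: nat where k0: "2 * S / r < real k0" using reals_Archimedean2 by blast
  have "norm ((\<Sum>j<k. a j) / real k - 0) < r" if k: "max (max n k0) 1 \<le> k" for k
  proof -
    have "\<bar>\<Sum>j<k. a j\<bar> \<le> (\<Sum>j<k. \<bar>a j\<bar>)" by (rule sum_abs)
    also have "\<dots> = S + (\<Sum>j=n..<k. \<bar>a j\<bar>)"
      using k unfolding S_def lessThan_atLeast0 by (intro sum.atLeastLessThan_concat[symmetric]) auto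
    also have "(\<Sum>j=n..<k. \<bar>a j\<bar>) \<le> (\<Sum>j=n..<k. r / 2)"
      using n by (intro sum_mono less_imp_le) auto
    also have "\<dots> \<le> real k * (r / 2)"
      using r by (simp add: mult_right_mono)
    also have "S < real k * (r / 2)"
    proof -
      have "2 * S / r < real k" using k0 k by (simp add: less_le_trans)
      then show ?thesis using r by (simp add: field_simps)
    qed
    finally have "\<bar>\<Sum>j<k. a j\<bar> < r * real k" by (simp add: mult.commute)
    then show ?thesis using k by (simp add: divide_less_eq)
  qed
  then show "\<exists>n. \<forall>k\<ge>n. norm ((\<Sum>j<k. a j) / real k - 0) < r" by blast
qed

context prob_space
begin

lemma
  fixes Y W :: "nat \<Rightarrow> 'a \<Rightarrow> real"
  assumes Y: "\<And>k. Y k \<in> borel_measurable M" "\<And>k \<omega>. \<omega> \<in> space M \<Longrightarrow> 0 \<le> Y k \<omega>"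
    and W: "\<And>j. integrable M (W j)" "(\<lambda>j. expectation (W j)) \<longlonglongrightarrow> 0"
    and dominated: "\<And>k \<omega>. \<omega> \<in> space M \<Longrightarrow> Y k \<omega> \<le> (\<Sum>j<k. W j \<omega>) / real k"
  shows dominated_by_averages_event: "{\<omega> \<in> space M. \<delta> \<le> Y k \<omega>} \<in> sets M"
    and dominated_by_averages_prob_tendsto_zero:
      "0 < \<delta> \<Longrightarrow> (\<lambda>k. prob {\<omega> \<in> space M. \<delta> \<le> Y k \<omega>}) \<longlonglongrightarrow> 0"
proof -
  note [measurable] = Y(1)
  show "{\<omega> \<in> space M. \<delta> \<le> Y k \<omega>} \<in> sets M" by measurable
  assume \<delta>: "0 < \<delta>"
  have averages: "integrable M (\<lambda>\<omega>. (\<Sum>j<k. W j \<omega>) / real k)" for k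
    using W(1) by simp
  have integrable: "integrable M (Y k)" for k
  proof (rule Bochner_Integration.integrable_bound[OF averages[of k] Y(1)], rule AE_I2)
    fix \<omega> assume "\<omega> \<in> space M"
    then show "norm (Y k \<omega>) \<le> norm ((\<Sum>j<k. W j \<omega>) / real k)"
      using Y(2)[of \<omega> k] dominated[of \<omega> k] unfolding real_norm_def by linarith
  qed
  have Markov: "prob {\<omega> \<in> space M. \<delta> \<le> Y k \<omega>} \<le> ((\<Sum>j<k. expectation (W j)) / real k) / \<delta>" for k
  proof -
    have "prob {\<omega> \<in> space M. \<delta> \<le> Y k \<omega>} \<le> expectation (Y k) / \<delta>"
      using Y(2) \<delta> by (intro integral_Markov_inequality_measure[OF integrable, of "{}"]) auto
    moreover have "expectation (Y k) \<le> expectation (\<lambda>\<omega>. (\<Sum>j<k. W j \<omega>) / real k)"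
      by (intro integral_mono integrable averages dominated)
    moreover have "expectation (\<lambda>\<omega>. (\<Sum>j<k. W j \<omega>) / real k) = (\<Sum>j<k. expectation (W j)) / real k"
      using W(1) by simp
    ultimately show ?thesis using \<delta> by (smt (verit) divide_right_mono)
  qed
  show "(\<lambda>k. prob {\<omega> \<in> space M. \<delta> \<le> Y k \<omega>}) \<longlonglongrightarrow> 0"
  proof (rule Lim_null_comparison)
    show "(\<lambda>k. ((\<Sum>j<k. expectation (W j)) / real k) / \<delta>) \<longlonglongrightarrow> 0"
      using tendsto_divide[OF Cesaro_mean_tendsto_zero[OF W(2)] tendsto_const[of \<delta>]] \<delta> by simp
    show "\<forall>\<^sub>F k in sequentially. norm (prob {\<omega> \<in> space M. \<delta> \<le> Y k \<omega>})
        \<le> ((\<Sum>j<k. expectation (W j)) / real k) / \<delta>"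
      unfolding real_norm_def abs_of_nonneg[OF measure_nonneg]
      by (intro always_eventually allI Markov)
  qed
qed

lemma Linf_dist_integrable:
  "Linf_approximable M U Z \<Longrightarrow> c \<in> Linf U \<Longrightarrow> integrable M (\<lambda>\<omega>. Linf_dist U (Z \<omega>) c)"
  by (intro Linf_approximable_norm_integrable Linf_approximable_diff Linf_approximable_const)

lemma Linf_approximable_deviation:
  "Linf_approximable M U Z \<Longrightarrow> Linf_approximable M U (\<lambda>\<omega> x. Z \<omega> x - Linf_expectation M U Z x)"
  by (intro Linf_approximable_diff Linf_approximable_const Linf_expectation_in_Linf)

context
  fixes U :: "'b::euclidean_space set" and Y :: "nat \<Rightarrow> 'a \<Rightarrow> 'b \<Rightarrow> real" and c :: "nat \<Rightarrow> 'b \<Rightarrow> real"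
  assumes Y: "\<And>j. Linf_approximable M U (Y j)" and c: "\<And>j. c j \<in> Linf U"
    and concentration: "(\<lambda>j. expectation (\<lambda>\<omega>. Linf_dist U (Y j \<omega>) (c j))) \<longlonglongrightarrow> 0"
begin

lemma mean_deviation_tendsto_zero:
  assumes W: "\<And>j. integrable M (W j)" "\<And>j \<omega>. 0 \<le> W j \<omega>"
    and le: "\<And>j \<omega>. \<omega> \<in> space M \<Longrightarrow>
      W j \<omega> \<le> Linf_dist U (Y j \<omega>) (c j) + expectation (\<lambda>\<omega>. Linf_dist U (Y j \<omega>) (c j))"
  shows "(\<lambda>j. expectation (W j)) \<longlonglongrightarrow> 0"
proof (rule Lim_null_comparison)
  define a where "a j = expectation (\<lambda>\<omega>. Linf_dist U (Y j \<omega>) (c j))" for j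
  show "(\<lambda>j. 2 * a j) \<longlonglongrightarrow> 0"
    unfolding a_def by (rule tendsto_mult_right_zero[OF concentration])
  have "expectation (W j) \<le> 2 * a j" for j
  proof -
    have "expectation (W j) \<le> expectation (\<lambda>\<omega>. Linf_dist U (Y j \<omega>) (c j) + a j)"
      using le Linf_dist_integrable[OF Y c] by (intro integral_mono W) (auto simp: a_def)
    also have "\<dots> = 2 * a j"
      using Linf_dist_integrable[OF Y c] by (simp add: a_def prob_space)
    finally show ?thesis .
  qed
  then show "\<forall>\<^sub>F j in sequentially. norm (expectation (W j)) \<le> 2 * a j"
    using W(2) by (simp add: integral_nonneg)
qed

lemma mean_Linf_deviation_tendsto_zero:
  "(\<lambda>j. expectation (\<lambda>\<omega>. Linf_dist U (Y j \<omega>) (Linf_expectation M U (Y j)))) \<longlonglongrightarrow> 0"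
proof (rule mean_deviation_tendsto_zero)
  show "integrable M (\<lambda>\<omega>. Linf_dist U (Y j \<omega>) (Linf_expectation M U (Y j)))" for j
    by (intro Linf_dist_integrable Linf_expectation_in_Linf Y)
  fix j \<omega> assume \<omega>: "\<omega> \<in> space M"
  have "Linf_dist U (Y j \<omega>) (Linf_expectation M U (Y j))
      \<le> Linf_dist U (Y j \<omega>) (c j) + Linf_dist U (c j) (Linf_expectation M U (Y j))"
    by (intro Linf_dist_triangle Linf_approximable_in_Linf[OF Y \<omega>] c Linf_expectation_in_Linf Y)
  then show "Linf_dist U (Y j \<omega>) (Linf_expectation M U (Y j))
      \<le> Linf_dist U (Y j \<omega>) (c j) + expectation (\<lambda>\<omega>. Linf_dist U (Y j \<omega>) (c j))"
    using Linf_dist_expectation_le[OF Y[of j] c[of j]]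
      Linf_dist_commute[of U "c j" "Linf_expectation M U (Y j)"] by linarith
qed (rule Linf_norm_nonneg)

lemma mean_norm_deviation_tendsto_zero:
  "(\<lambda>j. expectation (\<lambda>\<omega>. \<bar>Linf_norm U (Y j \<omega>) - expectation (\<lambda>\<omega>. Linf_norm U (Y j \<omega>))\<bar>)) \<longlonglongrightarrow> 0"
proof (rule mean_deviation_tendsto_zero)
  note integrable = Linf_approximable_norm_integrable[OF Y]
  show "integrable M (\<lambda>\<omega>. \<bar>Linf_norm U (Y j \<omega>) - expectation (\<lambda>\<omega>. Linf_norm U (Y j \<omega>))\<bar>)" for j
    using integrable by simp
  fix j \<omega> assume \<omega>: "\<omega> \<in> space M"
  have close: "\<bar>Linf_norm U (Y j \<omega>) - Linf_norm U (c j)\<bar> \<le> Linf_dist U (Y j \<omega>) (c j)"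
    if "\<omega> \<in> space M" for \<omega>
    by (rule abs_Linf_norm_diff_le[OF Linf_approximable_in_Linf[OF Y that] c])
  have "\<bar>expectation (\<lambda>\<omega>. Linf_norm U (Y j \<omega>)) - Linf_norm U (c j)\<bar>
      = \<bar>expectation (\<lambda>\<omega>. Linf_norm U (Y j \<omega>) - Linf_norm U (c j))\<bar>"
    using integrable by (simp add: prob_space)
  also have "\<dots> \<le> expectation (\<lambda>\<omega>. \<bar>Linf_norm U (Y j \<omega>) - Linf_norm U (c j)\<bar>)"
    by (rule integral_abs_bound)
  also have "\<dots> \<le> expectation (\<lambda>\<omega>. Linf_dist U (Y j \<omega>) (c j))"
    using integrable close by (intro integral_mono Linf_dist_integrable[OF Y c]) auto
  finally show "\<bar>Linf_norm U (Y j \<omega>) - expectation (\<lambda>\<omega>. Linf_norm U (Y j \<omega>))\<bar>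
      \<le> Linf_dist U (Y j \<omega>) (c j) + expectation (\<lambda>\<omega>. Linf_dist U (Y j \<omega>) (c j))"
    using close[OF \<omega>] by linarith
qed simp

lemma Linf_weak_law:
  "Linf_tendsto_in_prob M U
     (\<lambda>k \<omega> x. \<Sum>j<k. (Y j \<omega> x - Linf_expectation M U (Y j) x) / real k) (\<lambda>\<omega> x. 0)"
proof -
  define A where "A k \<omega> x = (\<Sum>j<k. (Y j \<omega> x - Linf_expectation M U (Y j) x) / real k)" for k \<omega> x
  define W where "W j \<omega> = Linf_dist U (Y j \<omega>) (Linf_expectation M U (Y j))" for j \<omega>
  have A_eq: "A k \<omega> = (\<lambda>x. \<Sum>j<k. 1 / real k * (Y j \<omega> x - Linf_expectation M U (Y j) x))" for k \<omega>
    by (simp add: A_def[abs_def])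
  have A: "Linf_approximable M U (A k)" for k
    unfolding A_eq[abs_def]
    by (intro Linf_approximable_sum Linf_approximable_cmult Linf_approximable_deviation[OF Y]) simp
  have W: "integrable M (W j)" "(\<lambda>j. expectation (W j)) \<longlonglongrightarrow> 0" for j
    using Linf_dist_integrable[OF Y Linf_expectation_in_Linf[OF Y]]
      mean_Linf_deviation_tendsto_zero unfolding W_def[abs_def] .
  have dominated: "Linf_norm U (A k \<omega>) \<le> (\<Sum>j<k. W j \<omega>) / real k" if \<omega>: "\<omega> \<in> space M" for k \<omega>
  proof -
    note deviation = Linf_approximable_in_Linf[OF Linf_approximable_deviation[OF Y] \<omega>]
    have "Linf_norm U (A k \<omega>)
        \<le> (\<Sum>j<k. Linf_norm U (\<lambda>x. 1 / real k * (Y j \<omega> x - Linf_expectation M U (Y j) x)))"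
      unfolding A_eq by (intro Linf_norm_sum_le finite_lessThan Linf_cmult deviation)
    also have "\<dots> \<le> (\<Sum>j<k. \<bar>1 / real k\<bar> * W j \<omega>)"
      unfolding W_def by (intro sum_mono Linf_norm_cmult_le deviation)
    finally show ?thesis by (simp add: sum_divide_distrib)
  qed
  note dominated_facts = Linf_approximable_norm_measurable[OF A] Linf_norm_nonneg W dominated
  show ?thesis
    unfolding Linf_tendsto_in_prob_def A_def[symmetric]
    using dominated_by_averages_event[OF dominated_facts]
      dominated_by_averages_prob_tendsto_zero[OF dominated_facts]
      Linf_approximable_in_Linf[OF A] by (simp add: Linf_zero)
qed

lemma norm_weak_law:
  "tendsto_in_prob M
     (\<lambda>k \<omega>. \<Sum>j<k. (Linf_norm U (Y j \<omega>) - expectation (\<lambda>\<omega>. Linf_norm U (Y j \<omega>))) / real k) (\<lambda>\<omega>. 0)"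
proof -
  define W where "W j \<omega> = \<bar>Linf_norm U (Y j \<omega>) - expectation (\<lambda>\<omega>. Linf_norm U (Y j \<omega>))\<bar>" for j \<omega>
  define A where "A k \<omega> = (\<Sum>j<k.
    (Linf_norm U (Y j \<omega>) - expectation (\<lambda>\<omega>. Linf_norm U (Y j \<omega>))) / real k)" for k \<omega>
  have [measurable]: "(\<lambda>\<omega>. Linf_norm U (Y j \<omega>)) \<in> borel_measurable M" for j
    by (rule Linf_approximable_norm_measurable[OF Y])
  have A: "(\<lambda>\<omega>. \<bar>A k \<omega>\<bar>) \<in> borel_measurable M" for k
    unfolding A_def by measurable
  have W: "integrable M (W j)" "(\<lambda>j. expectation (W j)) \<longlonglongrightarrow> 0" for j
    using Linf_approximable_norm_integrable[OF Y] mean_norm_deviation_tendsto_zero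
    unfolding W_def[abs_def] by simp_all
  have dominated: "\<bar>A k \<omega>\<bar> \<le> (\<Sum>j<k. W j \<omega>) / real k" for k \<omega>
    unfolding A_def W_def sum_divide_distrib by (rule order_trans[OF sum_abs]) (simp add: abs_divide)
  note dominated_facts = A abs_ge_zero W dominated
  show ?thesis
    unfolding tendsto_in_prob_def A_def[symmetric]
    using dominated_by_averages_event[OF dominated_facts]
      dominated_by_averages_prob_tendsto_zero[OF dominated_facts] by simp
qed

end

end

subsection \<open>Random potentials\<close>

locale random_semilinear_problem = semilinear_problem U p c0 K \<epsilon>0 f b g + prob_space M
  for U :: "'a::euclidean_space set" and p c0 K \<epsilon>0 :: real and f :: "'a \<Rightarrow>\<^sub>C real"
    and b g :: "'a \<Rightarrow> real" and M :: "'w measure" +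
  fixes X :: "nat \<Rightarrow> 'w \<Rightarrow> 'a set \<Rightarrow> real" and X_lim :: "'w \<Rightarrow> 'a set \<Rightarrow> real"
    and u :: "nat \<Rightarrow> 'w \<Rightarrow> 'a \<Rightarrow> real"
  assumes indep: "indep_vars (\<lambda>_. radon_borel U) X {1..}"
    and admissible: "\<And>j. 1 \<le> j \<Longrightarrow> admissible_set M U p f b g \<epsilon>0 (X j) = space M"
    and small_solution: "\<And>j \<omega>. 1 \<le> j \<Longrightarrow> \<omega> \<in> space M \<Longrightarrow>
      small_solution U p f b g \<epsilon>0 (X j \<omega>) (u j \<omega>)"
    and X_lim_measurable: "X_lim \<in> M \<rightarrow>\<^sub>M radon_borel U"
    and X_limit: "AE \<omega> in M. (\<lambda>j. tv_dist U (X j \<omega>) (X_lim \<omega>)) \<longlonglongrightarrow> 0"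
begin

abbreviation random_potential :: "nat \<Rightarrow> 'w \<Rightarrow> 'a \<Rightarrow> real" where
  "random_potential j \<omega> \<equiv> potential U f (X (Suc j) \<omega>)"

abbreviation random_solution :: "nat \<Rightarrow> 'w \<Rightarrow> 'a \<Rightarrow> real" where
  "random_solution j \<omega> \<equiv> u (Suc j) \<omega>"

lemma X_measurable: "X (Suc j) \<in> M \<rightarrow>\<^sub>M radon_borel U"
  using indep by (simp add: indep_vars_def)

lemma admissible_pair_Suc:
  assumes "\<omega> \<in> space M"
  shows "admissible_pair (X (Suc j) \<omega>) (random_solution j \<omega>)"
proof -
  have "X (Suc j) \<omega> \<in> radon_measures U"
    using measurable_space[OF X_measurable assms] by (simp add: space_radon_borel)
  moreover have "\<omega> \<in> admissible_set M U p f b g \<epsilon>0 (X (Suc j))"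
    using assms admissible by simp
  ultimately show ?thesis
    using small_solution[OF _ assms] by (simp add: admissible_pair_def admissible_set_def)
qed

lemmas X_finite_signed_measure = admissible_pair_finite_signed_measure[OF admissible_pair_Suc]
  and random_solution_in_Linf = admissible_pair_in_Linf[OF admissible_pair_Suc]
  and random_solution_norm_le = admissible_pair_norm_le[OF admissible_pair_Suc]

lemma potential_radon_borel_measurable: "(\<lambda>\<mu>. potential U f \<mu> x) \<in> borel_measurable (radon_borel U)"
  using open_U by (intro potential_measurable) simp

lemma random_potential_measurable: "(\<lambda>\<omega>. random_potential j \<omega> x) \<in> borel_measurable M"
  by (rule measurable_compose[OF X_measurable potential_radon_borel_measurable])

lemma abs_random_potential_le:
  assumes "\<omega> \<in> space M"
  shows "\<bar>random_potential j \<omega> x\<bar> \<le> norm f * tv_bound"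
proof -
  have "\<bar>random_potential j \<omega> x\<bar> \<le> norm f * tv_norm U (X (Suc j) \<omega>)"
    by (rule abs_potential_le[OF X_finite_signed_measure[OF assms]])
  also have "\<dots> \<le> norm f * tv_bound"
    by (intro mult_left_mono admissible_pair_tv_norm_le[OF admissible_pair_Suc] assms) simp
  finally show ?thesis .
qed

lemma random_potential_in_Linf: "\<omega> \<in> space M \<Longrightarrow> random_potential j \<omega> \<in> Linf U"
  by (intro potential_in_Linf bounded_U X_finite_signed_measure)

lemma random_potential_equicontinuous:
  "uniformly_equicontinuous_on U (\<Union>j. random_potential j ` space M)"
  by (rule uniformly_equicontinuous_on_subset[OF
        uniformly_equicontinuous_on_potentials[OF bounded_U, of f tv_bound]])
    (auto intro!: imageI X_finite_signed_measure admissible_pair_tv_norm_le[OF admissible_pair_Suc])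

lemma random_solution_dist_le:
  "\<omega> \<in> space M \<Longrightarrow> \<omega>' \<in> space M \<Longrightarrow>
    Linf_dist U (random_solution j \<omega>) (random_solution j \<omega>')
      \<le> solution_Lipschitz_constant * Linf_dist U (random_potential j \<omega>) (random_potential j \<omega>')"
  by (intro admissible_pair_dist_le admissible_pair_Suc)

lemma random_solution_approximable: "Linf_approximable M U (random_solution j)"
proof (rule Linf_approximable_Lipschitz_image)
  have "uniformly_equicontinuous_on U (random_potential j ` space M)"
    by (rule uniformly_equicontinuous_on_subset[OF random_potential_equicontinuous]) blast
  then show "Linf_approximable M U (random_potential j)"
    by (intro Linf_approximable_equicontinuous[OF bounded_U random_potential_in_Linf
          random_potential_measurable abs_random_potential_le])
qed (rule random_solution_in_Linf random_solution_dist_le solution_Lipschitz_constant_nonneg; assumption)+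

lemma random_potential_limit:
  "AE \<omega> in M. (\<lambda>j. random_potential j \<omega> x) \<longlonglongrightarrow> potential U f (X_lim \<omega>) x"
  using X_limit AE_space
proof eventually_elim
  case (elim \<omega>)
  have "X_lim \<omega> \<in> radon_measures U"
    using measurable_space[OF X_lim_measurable elim(2)] by (simp add: space_radon_borel)
  then have X_lim: "finite_signed_measure U (X_lim \<omega>)"
    using open_U by (intro radon_measures_imp_finite_signed_measure) simp_all
  have "(\<lambda>j. random_potential j \<omega> x - potential U f (X_lim \<omega>) x) \<longlonglongrightarrow> 0"
  proof (rule Lim_null_comparison)
    show "(\<lambda>j. norm f * tv_dist U (X (Suc j) \<omega>) (X_lim \<omega>)) \<longlonglongrightarrow> 0"
      by (rule tendsto_mult_right_zero[OF LIMSEQ_Suc[OF elim(1)]])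
    show "\<forall>\<^sub>F j in sequentially. norm (random_potential j \<omega> x - potential U f (X_lim \<omega>) x)
        \<le> norm f * tv_dist U (X (Suc j) \<omega>) (X_lim \<omega>)"
      using abs_potential_measure_diff_le[OF X_finite_signed_measure[OF elim(2)] X_lim] by simp
  qed
  then show ?case by (simp add: LIM_zero_iff)
qed

lemma random_potential_uncorrelated:
  "expectation (\<lambda>\<omega>. random_potential j \<omega> x * random_potential (Suc j) \<omega> x)
    = expectation (\<lambda>\<omega>. random_potential j \<omega> x) * expectation (\<lambda>\<omega>. random_potential (Suc j) \<omega> x)"
proof (rule expectation_mult_of_indep_vars[where Z="\<lambda>j \<omega>. potential U f (X j \<omega>) x" and I="{1..}"])
  show "indep_vars (\<lambda>_. borel) (\<lambda>j \<omega>. potential U f (X j \<omega>) x) {1..}"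
    by (rule indep_vars_compose2[OF indep potential_radon_borel_measurable])
  have integrable: "integrable M (\<lambda>\<omega>. random_potential i \<omega> x)" for i
    using abs_random_potential_le
    by (intro integrable_const_bound[where B="norm f * tv_bound"] random_potential_measurable) auto
  show "integrable M (\<lambda>\<omega>. random_potential j \<omega> x)" "integrable M (\<lambda>\<omega>. random_potential (Suc j) \<omega> x)"
    by (rule integrable)+
qed auto

lemma solutions_concentrate:
  obtains \<omega>0 where "\<omega>0 \<in> space M"
    "(\<lambda>j. expectation (\<lambda>\<omega>. Linf_dist U (random_solution j \<omega>) (random_solution j \<omega>0))) \<longlonglongrightarrow> 0"
proof -
  have X_lim_point: "(\<lambda>\<omega>. potential U f (X_lim \<omega>) x) \<in> borel_measurable M" for x
    by (rule measurable_compose[OF X_lim_measurable potential_radon_borel_measurable])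
  obtain \<omega>0 where \<omega>0: "\<omega>0 \<in> space M"
    "AE \<omega> in M. (\<lambda>j. Linf_dist U (random_potential j \<omega>) (random_potential j \<omega>0)) \<longlonglongrightarrow> 0"
    using uncorrelated_fields_converge_to_sample[OF bounded_U random_potential_in_Linf
        random_potential_equicontinuous random_potential_measurable X_lim_point
        abs_random_potential_le random_potential_limit random_potential_uncorrelated] by blast
  have "AE \<omega> in M. (\<lambda>j. Linf_dist U (random_solution j \<omega>) (random_solution j \<omega>0)) \<longlonglongrightarrow> 0"
    using \<omega>0(2) AE_space
  proof eventually_elim
    case (elim \<omega>)
    show ?case
      by (rule Lim_null_comparison[OF _
            tendsto_mult_right_zero[OF elim(1), of solution_Lipschitz_constant]])
        (use random_solution_dist_le[OF elim(2) \<omega>0(1)] in \<open>simp add: Linf_norm_nonneg\<close>)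
  qed
  moreover have "\<bar>Linf_dist U (random_solution j \<omega>) (random_solution j \<omega>0)\<bar> \<le> 2 * solution_radius"
    if "\<omega> \<in> space M" for j \<omega>
    using Linf_dist_le_add_norms[OF random_solution_in_Linf[OF that] random_solution_in_Linf[OF \<omega>0(1)], of j j]
      random_solution_norm_le[OF that, of j] random_solution_norm_le[OF \<omega>0(1), of j]
    by (simp add: Linf_norm_nonneg)
  moreover have "(\<lambda>\<omega>. Linf_dist U (random_solution j \<omega>) (random_solution j \<omega>0)) \<in> borel_measurable M"
    for j
    by (intro Linf_approximable_norm_measurable Linf_approximable_diff Linf_approximable_const
        random_solution_approximable random_solution_in_Linf \<omega>0(1))
  ultimately have "(\<lambda>j. expectation (\<lambda>\<omega>. Linf_dist U (random_solution j \<omega>) (random_solution j \<omega>0)))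
      \<longlonglongrightarrow> expectation (\<lambda>_. 0)"
    by (intro expectation_bounded_limit) auto
  then show ?thesis using that \<omega>0(1) by simp
qed

end

theorem theorem3p7:
  fixes U :: "(real ^ 'n) set" and p c0 K \<epsilon>0 :: real
    and f :: "(real ^ 'n) \<Rightarrow>\<^sub>C real" and b g :: "real ^ 'n \<Rightarrow> real"
    and M :: "'w measure"
    and X :: "nat \<Rightarrow> 'w \<Rightarrow> (real ^ 'n) set \<Rightarrow> real"
    and X_lim :: "'w \<Rightarrow> (real ^ 'n) set \<Rightarrow> real"
    and u :: "nat \<Rightarrow> 'w \<Rightarrow> real ^ 'n \<Rightarrow> real"
  assumes dim: "CARD('n) \<ge> 3"
    and p: "p > 1"
    and U: "open U" "connected U" "U \<noteq> {}" "bounded U"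
    and M: "prob_space M" "complete_measure M"
    and f: "f \<noteq> 0"
    and b: "b \<in> Linf U" "\<not> (AE x in lebesgue_on U. b x = 0)"
    and K: "K = l0 U * p * Linf_norm U b"
    and g: "g \<in> Linf U"
           "Linf_norm U g < 1 / l0 U * (1 / (2 powr p * K)) powr (1 / (p - 1))"
    and c0: "0 < c0" "c0 < 1"
    and \<epsilon>0: "\<epsilon>0 = ((1 - c0) powr p / (2 powr p * K)) powr (1 / (p - 1))"
    and indep: "prob_space.indep_vars M (\<lambda>_. radon_borel U) X {1..}"
    and admissible: "\<And>j. j \<ge> 1 \<Longrightarrow> admissible_set M U p f b g \<epsilon>0 (X j) = space M"
    and sol: "\<And>j \<omega>. j \<ge> 1 \<Longrightarrow> \<omega> \<in> space M \<Longrightarrow> small_solution U p f b g \<epsilon>0 (X j \<omega>) (u j \<omega>)"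
    and X_lim: "X_lim \<in> M \<rightarrow>\<^sub>M radon_borel U"
    and conv: "AE \<omega> in M. (\<lambda>j. tv_dist U (X j \<omega>) (X_lim \<omega>)) \<longlonglongrightarrow> 0"
    and L: "(SUP j\<in>{1..}. esssup M (\<lambda>\<omega>. ereal (tv_norm U (X j \<omega>)))) < ereal (1 / (l0 U * norm f))"
  shows "Linf_tendsto_in_prob M U
           (\<lambda>k \<omega> x. \<Sum>j=1..k. (u j \<omega> x - Linf_expectation M U (u j) x) / real k)
           (\<lambda>\<omega> x. 0)
       \<and> tendsto_in_prob M
           (\<lambda>k \<omega>. \<Sum>j=1..k. (Linf_norm U (u j \<omega>) - (\<integral>\<omega>'. Linf_norm U (u j \<omega>') \<partial>M)) / real k)
           (\<lambda>\<omega>. 0)"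
proof -
  interpret prob_space M by (rule M(1))
  interpret random_semilinear_problem U p c0 K \<epsilon>0 f b g M X X_lim u
    by unfold_locales (use dim p U f b K c0 \<epsilon>0 indep admissible sol X_lim conv in auto)
  obtain \<omega>0 where "\<omega>0 \<in> space M"
    "(\<lambda>j. expectation (\<lambda>\<omega>. Linf_dist U (random_solution j \<omega>) (random_solution j \<omega>0))) \<longlonglongrightarrow> 0"
    by (rule solutions_concentrate)
  then show ?thesis
    using Linf_weak_law[OF random_solution_approximable random_solution_in_Linf]
      norm_weak_law[OF random_solution_approximable random_solution_in_Linf]
    by (simp add: sum.atLeast1_atMost_eq)
qed

end
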